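(* Let $X$ be a compact connected Riemannian $n$-manifold for some $n\ge 2$. Suppose that $X$ admits a triangulation $\varphi\colon\Sigma\to X$ which is $D$-bi-Lipschitz when restricted to any $n$-simplex of $\Sigma$, and that the number of $n$-simplices of $\Sigma$ is bounded by $N$. Then every $1$-Lipschitz map $f\colon A\to Y$ defined on a subset $A\subset X$ and mapping to a complete $\mathrm{CAT}(0)$ space $Y$ admits a Lipschitz extension $F\colon X\to Y$ with Lipschitz constant at most $$D\cdot N^{10\log(n)}.$$
   Context: $\log$ is the natural logarithm. $X$ carries its Riemannian distance $d$. A $\mathrm{CAT}(0)$ space is a geodesic metric space all of whose geodesic triangles are not thicker than their comparison triangles in the Euclidean plane. Simplicial complexes are geometric: for a non-empty index set $I$, $\Sigma(I)=\{x\in\ell_2(I): x_i\ge 0,\ \sum_{i\in I} x_i=1\}$; an $n$-simplex in $\Sigma(I)$ is a set $\{x\in\Sigma(I):\sum_{j\in J}x_j=1\}$ with $J\subset I$ having $n+1$ elements; a simplicial complex $\Sigma$ is a subset of some $\Sigma(I)$ that is a union of simplices. Each simplex carries the (Euclidean) metric induced by the $\ell_2$-norm $|\cdot|$. A triangulation of $X$ is a homeomorphism $\varphi\colon\Sigma\to X$ from a simplicial complex $\Sigma$. The map $\varphi$ is $D$-bi-Lipschitz on an $n$-simplex $\Delta$ in the usual sense: $D^{-1}|p-q|\le d(\varphi(p),\varphi(q))\le D\,|p-q|$ for all $p,q\in\Delta$. *)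

theory Defs
  imports "HOL-Analysis.Analysis"
begin

section \<open>Riemannian manifolds and their distance\<close>

text \<open>On an open subset of a Euclidean space, \<open>k_times_differentiable_on k S f\<close> says that all
  iterated directional derivatives of \<open>f\<close> of order less than \<open>k\<close> are totally differentiable and
  those of order \<open>k\<close> are continuous, i.e. that \<open>f\<close> is of class \<open>C\<^sup>k\<close>.\<close>

primrec k_times_differentiable_on ::
  "nat \<Rightarrow> 'a::euclidean_space set \<Rightarrow> ('a \<Rightarrow> 'b::real_normed_vector) \<Rightarrow> bool" where
  "k_times_differentiable_on 0 S f \<longleftrightarrow> continuous_on S f"
| "k_times_differentiable_on (Suc k) S f \<longleftrightarrow>
     (\<forall>x\<in>S. f differentiable (at x)) \<and>
     (\<forall>v. k_times_differentiable_on k S (\<lambda>x. frechet_derivative f (at x) v))"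

definition smooth_on ::
  "'a::euclidean_space set \<Rightarrow> ('a \<Rightarrow> 'b::real_normed_vector) \<Rightarrow> bool" where
  "smooth_on S f \<longleftrightarrow> (\<forall>k. k_times_differentiable_on k S f)"

text \<open>A chart is a pair of its domain and its coordinate map; values of the coordinate map
  outside the domain are irrelevant.\<close>

type_synonym ('x, 'e) chart = "'x set \<times> ('x \<Rightarrow> 'e)"

definition transition :: "('x, 'e) chart \<Rightarrow> ('x, 'e) chart \<Rightarrow> 'e \<Rightarrow> 'e" where
  "transition c c' = snd c' \<circ> inv_into (fst c) (snd c)"

text \<open>\<open>g c p v w\<close> is the inner product at \<open>p\<close> of the two tangent vectors whose coordinates
  in the chart \<open>c\<close> are \<open>v\<close> and \<open>w\<close>. Manifolds have no boundary, and their dimension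
  is \<open>DIM('e)\<close>.\<close>

locale riemannian_manifold =
  fixes X :: "'x topology"
    and atlas :: "('x, 'e::euclidean_space) chart set"
    and g :: "('x, 'e) chart \<Rightarrow> 'x \<Rightarrow> 'e \<Rightarrow> 'e \<Rightarrow> real"
  assumes Hausdorff: "Hausdorff_space X"
    and second_countable: "second_countable X"
    and cover: "topspace X = (\<Union>c\<in>atlas. fst c)"
    and chart_domain: "\<And>c. c \<in> atlas \<Longrightarrow> openin X (fst c)"
    and chart_range: "\<And>c. c \<in> atlas \<Longrightarrow> open (snd c ` fst c)"
    and chart_homeo: "\<And>c. c \<in> atlas \<Longrightarrow>
      homeomorphic_map (subtopology X (fst c)) (top_of_set (snd c ` fst c)) (snd c)"
    and transition_smooth: "\<And>c c'. c \<in> atlas \<Longrightarrow> c' \<in> atlas \<Longrightarrow>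
      smooth_on (snd c ` (fst c \<inter> fst c')) (transition c c')"
    and g_bilinear: "\<And>c p. c \<in> atlas \<Longrightarrow> p \<in> fst c \<Longrightarrow> bilinear (g c p)"
    and g_sym: "\<And>c p v w. c \<in> atlas \<Longrightarrow> p \<in> fst c \<Longrightarrow> g c p v w = g c p w v"
    and g_pos: "\<And>c p v. c \<in> atlas \<Longrightarrow> p \<in> fst c \<Longrightarrow> v \<noteq> 0 \<Longrightarrow> g c p v v > 0"
    and g_smooth: "\<And>c v w. c \<in> atlas \<Longrightarrow>
      smooth_on (snd c ` fst c) (\<lambda>u. g c (inv_into (fst c) (snd c) u) v w)"
    and g_transition: "\<And>c c' p v w. c \<in> atlas \<Longrightarrow> c' \<in> atlas \<Longrightarrow> p \<in> fst c \<inter> fst c' \<Longrightarrow>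
      g c p v w = g c' p (frechet_derivative (transition c c') (at (snd c p)) v)
                         (frechet_derivative (transition c c') (at (snd c p)) w)"

definition C1_curve_on ::
  "'x topology \<Rightarrow> ('x, 'e::euclidean_space) chart set \<Rightarrow> real \<Rightarrow> real \<Rightarrow> (real \<Rightarrow> 'x) \<Rightarrow> bool" where
  "C1_curve_on X atlas a b \<gamma> \<longleftrightarrow>
     continuous_map (top_of_set {a..b}) X \<gamma> \<and>
     (\<forall>(U, \<psi>)\<in>atlas.
        (\<forall>t\<in>{a..b}. \<gamma> t \<in> U \<longrightarrow> (\<psi> \<circ> \<gamma>) differentiable (at t within {a..b})) \<and>
        continuous_on {t\<in>{a..b}. \<gamma> t \<in> U}
          (\<lambda>t. vector_derivative (\<psi> \<circ> \<gamma>) (at t within {a..b})))"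

definition piecewise_C1_curve ::
  "'x topology \<Rightarrow> ('x, 'e::euclidean_space) chart set \<Rightarrow> (real \<Rightarrow> 'x) \<Rightarrow> bool" where
  "piecewise_C1_curve X atlas \<gamma> \<longleftrightarrow>
     (\<exists>(k::nat) t. t 0 = 0 \<and> t k = 1 \<and>
        (\<forall>i<k. t i < t (Suc i) \<and> C1_curve_on X atlas (t i) (t (Suc i)) \<gamma>))"

text \<open>The choice of the chart is immaterial by the transformation rule for \<open>g\<close>. At the finitely many
  break points of a piecewise \<open>C\<^sup>1\<close> curve the value is arbitrary, which does not affect the length.\<close>

definition riemannian_speed ::
  "('x, 'e::euclidean_space) chart set \<Rightarrow> (('x, 'e) chart \<Rightarrow> 'x \<Rightarrow> 'e \<Rightarrow> 'e \<Rightarrow> real) \<Rightarrow>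
   (real \<Rightarrow> 'x) \<Rightarrow> real \<Rightarrow> real" where
  "riemannian_speed atlas g \<gamma> t =
     (let c = (SOME c. c \<in> atlas \<and> \<gamma> t \<in> fst c);
          v = vector_derivative (snd c \<circ> \<gamma>) (at t)
      in sqrt (g c (\<gamma> t) v v))"

definition riemannian_length ::
  "('x, 'e::euclidean_space) chart set \<Rightarrow> (('x, 'e) chart \<Rightarrow> 'x \<Rightarrow> 'e \<Rightarrow> 'e \<Rightarrow> real) \<Rightarrow>
   (real \<Rightarrow> 'x) \<Rightarrow> real" where
  "riemannian_length atlas g \<gamma> = integral {0..1} (riemannian_speed atlas g \<gamma>)"

definition riemannian_dist ::
  "'x topology \<Rightarrow> ('x, 'e::euclidean_space) chart set \<Rightarrow>
   (('x, 'e) chart \<Rightarrow> 'x \<Rightarrow> 'e \<Rightarrow> 'e \<Rightarrow> real) \<Rightarrow> 'x \<Rightarrow> 'x \<Rightarrow> real" where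
  "riemannian_dist X atlas g p q =
     Inf {riemannian_length atlas g \<gamma> |\<gamma>. piecewise_C1_curve X atlas \<gamma> \<and> \<gamma> 0 = p \<and> \<gamma> 1 = q}"

section \<open>CAT(0) spaces\<close>

definition geodesic :: "'y metric \<Rightarrow> 'y \<Rightarrow> 'y \<Rightarrow> (real \<Rightarrow> 'y) \<Rightarrow> bool" where
  "geodesic Y x y \<gamma> \<longleftrightarrow>
     \<gamma> \<in> {0..mdist Y x y} \<rightarrow> mspace Y \<and> \<gamma> 0 = x \<and> \<gamma> (mdist Y x y) = y \<and>
     (\<forall>s\<in>{0..mdist Y x y}. \<forall>t\<in>{0..mdist Y x y}. mdist Y (\<gamma> s) (\<gamma> t) = \<bar>s - t\<bar>)"

definition geodesic_space :: "'y metric \<Rightarrow> bool" where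
  "geodesic_space Y \<longleftrightarrow> (\<forall>x\<in>mspace Y. \<forall>y\<in>mspace Y. \<exists>\<gamma>. geodesic Y x y \<gamma>)"

text \<open>Pairs of a point on the side \<open>\<gamma>\<close> from \<open>x\<close> to \<open>y\<close> and its comparison point on the
  Euclidean segment from \<open>x'\<close> to \<open>y'\<close>.\<close>

definition comparison_pairs ::
  "'y metric \<Rightarrow> 'y \<Rightarrow> 'y \<Rightarrow> (real \<Rightarrow> 'y) \<Rightarrow> real^2 \<Rightarrow> real^2 \<Rightarrow> ('y \<times> (real^2)) set" where
  "comparison_pairs Y x y \<gamma> x' y' =
     {(\<gamma> t, p') |t p'. t \<in> {0..mdist Y x y} \<and> p' \<in> closed_segment x' y' \<and> dist x' p' = t}"

text \<open>Spaces are non-empty by convention.\<close>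

definition CAT0_space :: "'y metric \<Rightarrow> bool" where
  "CAT0_space Y \<longleftrightarrow>
     mspace Y \<noteq> {} \<and> geodesic_space Y \<and>
     (\<forall>x\<in>mspace Y. \<forall>y\<in>mspace Y. \<forall>z\<in>mspace Y. \<forall>\<alpha> \<beta> \<gamma>. \<forall>x' y' z'.
        geodesic Y x y \<alpha> \<and> geodesic Y y z \<beta> \<and> geodesic Y z x \<gamma> \<and>
        dist x' y' = mdist Y x y \<and> dist y' z' = mdist Y y z \<and> dist z' x' = mdist Y z x \<longrightarrow>
        (let P = comparison_pairs Y x y \<alpha> x' y' \<union> comparison_pairs Y y z \<beta> y' z' \<union>
                 comparison_pairs Y z x \<gamma> z' x'
         in \<forall>(p, p')\<in>P. \<forall>(q, q')\<in>P. mdist Y p q \<le> dist p' q'))"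

section \<open>Geometric simplicial complexes\<close>

definition ell2 :: "'i set \<Rightarrow> ('i \<Rightarrow> real) set" where
  "ell2 I = {x. (\<forall>i. i \<notin> I \<longrightarrow> x i = 0) \<and> (\<lambda>i. (x i)\<^sup>2) summable_on I}"

definition ell2_dist :: "'i set \<Rightarrow> ('i \<Rightarrow> real) \<Rightarrow> ('i \<Rightarrow> real) \<Rightarrow> real" where
  "ell2_dist I x y = sqrt (\<Sum>\<^sub>\<infinity>i\<in>I. (x i - y i)\<^sup>2)"

definition ell2_metric :: "'i set \<Rightarrow> ('i \<Rightarrow> real) metric" where
  "ell2_metric I = metric (ell2 I, ell2_dist I)"

lemma ell2_diff_summable:
  assumes "x \<in> ell2 I" "y \<in> ell2 I"
  shows "(\<lambda>i. (x i - y i)\<^sup>2) summable_on I"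
proof (rule summable_on_comparison_test)
  show "(\<lambda>i. 2 * (x i)\<^sup>2 + 2 * (y i)\<^sup>2) summable_on I"
    using assms by (intro summable_on_add summable_on_cmult_right) (auto simp: ell2_def)
  show "(x i - y i)\<^sup>2 \<le> 2 * (x i)\<^sup>2 + 2 * (y i)\<^sup>2" for i
    using zero_le_power2[of "x i + y i"] by (simp add: power2_eq_square algebra_simps)
qed auto

lemma L2_set_le_ell2_dist:
  assumes "x \<in> ell2 I" "y \<in> ell2 I" "finite F" "F \<subseteq> I"
  shows "L2_set (\<lambda>i. x i - y i) F \<le> ell2_dist I x y"
  unfolding L2_set_def ell2_dist_def using assms
  by (intro real_sqrt_le_mono finite_sum_le_infsum ell2_diff_summable) auto

lemma Metric_space_ell2: "Metric_space (ell2 I) (ell2_dist I)"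
proof
  fix x y :: "'a \<Rightarrow> real"
  show "0 \<le> ell2_dist I x y"
    by (simp add: ell2_dist_def infsum_nonneg)
  show "ell2_dist I x y = ell2_dist I y x"
    by (simp add: ell2_dist_def power2_commute)
  show "ell2_dist I x y = 0 \<longleftrightarrow> x = y" if x: "x \<in> ell2 I" and y: "y \<in> ell2 I"
  proof
    assume "ell2_dist I x y = 0"
    then have "(x i - y i)\<^sup>2 = 0" if "i \<in> I" for i
      using L2_set_le_ell2_dist[OF x y, of "{i}"] that by (simp add: L2_set_def)
    with x y show "x = y"
      by (fastforce simp: ell2_def fun_eq_iff)
  qed (simp add: ell2_dist_def)
next
  fix x y z :: "'a \<Rightarrow> real"
  assume x: "x \<in> ell2 I" and y: "y \<in> ell2 I" and z: "z \<in> ell2 I"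
  let ?s = "ell2_dist I x y + ell2_dist I y z"
  have s: "0 \<le> ?s"
    by (simp add: ell2_dist_def infsum_nonneg)
  have "(\<Sum>\<^sub>\<infinity>i\<in>I. (x i - z i)\<^sup>2) \<le> ?s\<^sup>2"
  proof (rule infsum_le_finite_sums[OF ell2_diff_summable[OF x z]])
    fix F assume F: "finite F" "F \<subseteq> I"
    have "L2_set (\<lambda>i. x i - z i) F \<le> L2_set (\<lambda>i. x i - y i) F + L2_set (\<lambda>i. y i - z i) F"
      using L2_set_triangle_ineq[of "\<lambda>i. x i - y i" "\<lambda>i. y i - z i" F] by simp
    also have "\<dots> \<le> ?s"
      by (intro add_mono L2_set_le_ell2_dist x y z F)
    finally show "(\<Sum>i\<in>F. (x i - z i)\<^sup>2) \<le> ?s\<^sup>2"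
      unfolding L2_set_def by (rule sqrt_le_D)
  qed
  then show "ell2_dist I x z \<le> ?s"
    unfolding ell2_dist_def[of I x z] using s by (simp add: real_le_lsqrt infsum_nonneg)
qed

lemma mspace_ell2_metric [simp]: "mspace (ell2_metric I) = ell2 I"
  by (simp add: ell2_metric_def Metric_space.mspace_metric Metric_space_ell2)

lemma mdist_ell2_metric [simp]: "mdist (ell2_metric I) = ell2_dist I"
  by (simp add: ell2_metric_def Metric_space.mdist_metric Metric_space_ell2)

definition full_simplex :: "'i set \<Rightarrow> ('i \<Rightarrow> real) set" where
  "full_simplex I = {x \<in> ell2 I. (\<forall>i\<in>I. 0 \<le> x i) \<and> (x has_sum 1) I}"

definition is_simplex :: "'i set \<Rightarrow> nat \<Rightarrow> ('i \<Rightarrow> real) set \<Rightarrow> bool" where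
  "is_simplex I n \<Delta> \<longleftrightarrow>
     (\<exists>J\<subseteq>I. finite J \<and> card J = n + 1 \<and> \<Delta> = {x \<in> full_simplex I. (\<Sum>j\<in>J. x j) = 1})"

definition simplicial_complex :: "'i set \<Rightarrow> ('i \<Rightarrow> real) set \<Rightarrow> bool" where
  "simplicial_complex I S \<longleftrightarrow>
     I \<noteq> {} \<and> S \<subseteq> full_simplex I \<and> (\<exists>\<F>. (\<forall>\<Delta>\<in>\<F>. \<exists>n. is_simplex I n \<Delta>) \<and> S = \<Union>\<F>)"

definition simplices_of :: "'i set \<Rightarrow> nat \<Rightarrow> ('i \<Rightarrow> real) set \<Rightarrow> ('i \<Rightarrow> real) set set" where
  "simplices_of I n S = {\<Delta>. is_simplex I n \<Delta> \<and> \<Delta> \<subseteq> S}"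

text \<open>The complex carries the topology of the norm of \<open>\<ell>\<^sub>2\<close>. A compact complex has finitely many
  vertices, since distinct vertices have distance \<open>sqrt 2\<close>; so for compact spaces this
  is the same as using the weak topology.\<close>

definition is_triangulation ::
  "'i set \<Rightarrow> ('i \<Rightarrow> real) set \<Rightarrow> 'x topology \<Rightarrow> (('i \<Rightarrow> real) \<Rightarrow> 'x) \<Rightarrow> bool" where
  "is_triangulation I S X \<phi> \<longleftrightarrow>
     simplicial_complex I S \<and> homeomorphic_map (subtopology (mtopology_of (ell2_metric I)) S) X \<phi>"

definition bi_lipschitz_on ::
  "real \<Rightarrow> 'a set \<Rightarrow> ('a \<Rightarrow> 'a \<Rightarrow> real) \<Rightarrow> ('b \<Rightarrow> 'b \<Rightarrow> real) \<Rightarrow> ('a \<Rightarrow> 'b) \<Rightarrow> bool" where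
  "bi_lipschitz_on D S d d' \<phi> \<longleftrightarrow>
     (\<forall>p\<in>S. \<forall>q\<in>S. inverse D * d p q \<le> d' (\<phi> p) (\<phi> q) \<and> d' (\<phi> p) (\<phi> q) \<le> D * d p q)"

end

theory Submission
  imports Defs
begin

text \<open>
  Points of \<open>X\<close> are sent to barycenters in \<open>Y\<close>. Barycenters in complete CAT(0) spaces are
  \<open>1\<close>-Lipschitz in the total variation of the weights times the diameter of the points, so it suffices
  to find a partition of unity subordinate to a Whitney covering of the complement of \<open>A\<close> that varies
  slowly. Powers of bump functions, with an exponent logarithmic in the multiplicity \<open>M\<close> of the
  covering, give the Lipschitz constant \<open>O(log M)\<close>. Counting points in grid cubes inside the \<open>N\<close>
  simplices shows \<open>M \<le> N * (16 * D\<^sup>2 * sqrt (n + 1)) ^ (n + 1)\<close>; hence \<open>D\<close> enters only through \<open>log D\<close>.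

  The bound \<open>D * N powr (10 * ln n)\<close> absorbs the numerical constants because \<open>N \<ge> n + 2\<close>: by invariance
  of domain the \<open>n\<close>-simplices cover \<open>X\<close> and every facet of an \<open>n\<close>-simplex lies in a second one.
\<close>

section \<open>Barycenters in CAT(0) spaces\<close>

text \<open>The extension argument sees the geometry of \<open>X\<close> only through a count:
  \<open>2 ^ q\<close> bounds the size of every set whose mutual distances lie between
  \<open>r\<close> and \<open>20/3 * r\<close>. The ratio comes from Whitney centres that are
  separated by an eighth of their distance to \<open>A\<close> while their bumps reach out to a
  quarter of it. The gain from powers is that the quotient of the sum of \<open>u k ^ q\<close> by
  the sum of \<open>u k ^ Suc q\<close> is at most 3 once \<open>2 ^ q\<close> bounds the number of
  positive weights. So the constant is \<open>280 * real (Suc q)\<close> instead of a multiple of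
  \<open>2 ^ q\<close>. With \<open>n + 2 \<le> N\<close>, the logarithm of the packing bound is at
  most \<open>D\<close> times a quadratic polynomial in \<open>N\<close>. The final factor is at
  most \<open>D * (392 * N^2)\<close>, and \<open>N \<ge> 4\<close> turns it into \<open>D\<close>
  times the power 13/2 of \<open>N\<close>; this exponent is below \<open>10 * ln 2\<close>. The
  hypotheses control \<open>n\<close>-simplices only, so it must be proved that no simplex has
  larger dimension and that every point lies in an \<open>n\<close>-simplex. This is where the
  manifold topology enters. The metric enters through the pseudometric axioms.\<close>

lemma comparison_triangle_exists:
  fixes a b c :: real
  assumes "0 \<le> a" "0 \<le> b" "0 \<le> c" "a \<le> b + c" "b \<le> a + c" "c \<le> a + b"
  obtains x y z :: "real^2" where "dist x y = a" "dist y z = b" "dist z x = c"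
proof (cases "a = 0")
  case True
  then have "b = c" using assms by simp
  show ?thesis
    by (rule that[of 0 0 "vector [c, 0]"])
      (use True \<open>b = c\<close> assms in \<open>auto simp: dist_vec_def L2_set_def UNIV_2 dist_real_def\<close>)
next
  case False
  with assms have a: "a > 0" by simp
  \<comment> \<open>Law of cosines: with the first side from 0 to \<open>(a, 0)\<close>, this is the
    first coordinate of the third vertex. The triangle inequalities amount to
    \<open>\<bar>u\<bar> \<le> c\<close>, so that a second coordinate \<open>v\<close>
    exists.\<close>
  define u where "u = (a\<^sup>2 + c\<^sup>2 - b\<^sup>2) / (2 * a)"
  have ua: "2 * a * u = a\<^sup>2 + c\<^sup>2 - b\<^sup>2" using a by (simp add: u_def)
  have "\<bar>2 * a * u\<bar> \<le> 2 * a * c"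
  proof (rule abs_leI)
    have "(a - c)\<^sup>2 \<le> b\<^sup>2" using assms by (intro power2_le_iff_abs_le[THEN iffD2]) auto
    then show "2 * a * u \<le> 2 * a * c" unfolding ua by (simp add: power2_eq_square algebra_simps)
    have "b\<^sup>2 \<le> (a + c)\<^sup>2" using assms by (intro power_mono) auto
    then show "- (2 * a * u) \<le> 2 * a * c" unfolding ua by (simp add: power2_eq_square algebra_simps)
  qed
  then have "\<bar>u\<bar> \<le> c" using a by (simp add: abs_mult)
  then have uc: "u\<^sup>2 \<le> c\<^sup>2" using assms by (simp add: power2_le_iff_abs_le)
  define v where "v = sqrt (c\<^sup>2 - u\<^sup>2)"
  have v: "v\<^sup>2 = c\<^sup>2 - u\<^sup>2" using uc by (simp add: v_def)
  have "(a - u)\<^sup>2 + v\<^sup>2 = b\<^sup>2" unfolding v using ua by (simp add: power2_eq_square algebra_simps)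
  then have b: "sqrt ((a - u)\<^sup>2 + v\<^sup>2) = b" using assms by simp
  have c: "sqrt (u\<^sup>2 + v\<^sup>2) = c" unfolding v using assms by simp
  show ?thesis
    by (rule that[of 0 "vector [a, 0]" "vector [u, v]"])
      (use assms b c in \<open>auto simp: dist_vec_def L2_set_def UNIV_2 dist_real_def power2_commute\<close>)
qed

text \<open>Stewart's theorem, in the form that comparison triangles carry over to
  \<open>Y\<close>.\<close>

lemma euclidean_weighted_parallelogram:
  fixes x y z :: "'a::real_inner"
  shows "(dist x ((1 - t) *\<^sub>R y + t *\<^sub>R z))\<^sup>2 =
    (1 - t) * (dist x y)\<^sup>2 + t * (dist x z)\<^sup>2 - t * (1 - t) * (dist y z)\<^sup>2"
  by (simp add: dist_norm power2_norm_eq_inner inner_simps inner_commute algebra_simps)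

text \<open>Comparison with the Euclidean triangle turns Stewart's theorem into an inequality. The
  point \<open>m\<close> lies on a geodesic from \<open>y\<close> to \<open>z\<close> and is fixed
  before \<open>x\<close>, so that a single \<open>m\<close> serves all the points \<open>x\<close>
  of a weighted sum.\<close>

lemma CAT0_weighted_CN:
  assumes Y: "CAT0_space Y" and y: "y \<in> mspace Y" and z: "z \<in> mspace Y"
    and t: "0 \<le> t" "t \<le> 1"
  obtains m where "m \<in> mspace Y"
    "\<And>x. x \<in> mspace Y \<Longrightarrow>
      (mdist Y x m)\<^sup>2 \<le> (1 - t) * (mdist Y x y)\<^sup>2 + t * (mdist Y x z)\<^sup>2 - t * (1 - t) * (mdist Y y z)\<^sup>2"
proof -
  have geo: "\<exists>\<gamma>. geodesic Y p q \<gamma>" if "p \<in> mspace Y" "q \<in> mspace Y" for p q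
    using Y that by (auto simp: CAT0_space_def geodesic_space_def)
  from geo[OF y z] obtain \<beta> where \<beta>: "geodesic Y y z \<beta>" by blast
  define m where "m = \<beta> (t * mdist Y y z)"
  have tin: "t * mdist Y y z \<in> {0..mdist Y y z}" using t by (simp add: mult_left_le_one_le)
  have m: "m \<in> mspace Y" using \<beta> tin unfolding m_def geodesic_def by blast
  show ?thesis
  proof (rule that[OF m])
    fix x assume x: "x \<in> mspace Y"
    from geo[OF x y] obtain \<alpha> where \<alpha>: "geodesic Y x y \<alpha>" by blast
    from geo[OF z x] obtain \<gamma> where \<gamma>: "geodesic Y z x \<gamma>" by blast
    obtain x' y' z' :: "real^2" where
      xyz': "dist x' y' = mdist Y x y" "dist y' z' = mdist Y y z" "dist z' x' = mdist Y z x"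
    proof (rule comparison_triangle_exists)
      show "mdist Y x y \<le> mdist Y y z + mdist Y z x"
        using mdist_triangle[of x Y z y] x y z by (simp add: mdist_commute add.commute)
      show "mdist Y y z \<le> mdist Y x y + mdist Y z x"
        using mdist_triangle[of y Y x z] x y z by (simp add: mdist_commute)
      show "mdist Y z x \<le> mdist Y x y + mdist Y y z"
        using mdist_triangle[of x Y y z] x y z by (simp add: mdist_commute)
    qed auto
    define m' where "m' = (1 - t) *\<^sub>R y' + t *\<^sub>R z'"
    have "dist y' m' = t * dist y' z'"
    proof -
      have "y' - m' = t *\<^sub>R (y' - z')" by (simp add: m'_def algebra_simps)
      then show ?thesis using t by (simp add: dist_norm)
    qed
    then have "(m, m') \<in> comparison_pairs Y y z \<beta> y' z'"
      unfolding comparison_pairs_def m_def using tin xyz' t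
      by (auto simp: m'_def closed_segment_def)
    moreover have "(x, x') \<in> comparison_pairs Y x y \<alpha> x' y'"
      unfolding comparison_pairs_def using \<alpha> by (auto simp: geodesic_def intro!: exI[of _ 0])
    ultimately have "mdist Y x m \<le> dist x' m'"
      using Y x y z \<alpha> \<beta> \<gamma> xyz' unfolding CAT0_space_def Let_def by blast
    then have "(mdist Y x m)\<^sup>2 \<le> (dist x' m')\<^sup>2" by (intro power_mono) auto
    also have "\<dots> = (1 - t) * (mdist Y x y)\<^sup>2 + t * (mdist Y x z)\<^sup>2 - t * (1 - t) * (mdist Y y z)\<^sup>2"
      unfolding m'_def euclidean_weighted_parallelogram xyz' using xyz'(3)
      by (simp add: dist_commute mdist_commute)
    finally show "(mdist Y x m)\<^sup>2 \<le> \<dots>" .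
  qed
qed

lemma power2_add_le_weighted:
  fixes p q s :: real
  assumes "0 < s" "s < 1"
  shows "(p + q)\<^sup>2 \<le> p\<^sup>2 / s + q\<^sup>2 / (1 - s)"
proof -
  have "p\<^sup>2 / s + q\<^sup>2 / (1 - s) - (p + q)\<^sup>2 = ((1 - s) * p - s * q)\<^sup>2 / (s * (1 - s))"
    using assms by (simp add: field_simps power2_eq_square)
  also have "\<dots> \<ge> 0" using assms by simp
  finally show ?thesis by simp
qed

text \<open>The quadrilateral inequality of Reshetnyak and Berg-Nikolaev, a Cauchy-Schwarz
  inequality without inner product. The diagonal from \<open>a\<close> to \<open>c\<close> is
  bounded by a detour through a point \<open>m\<close> of the other diagonal; the weighted CN
  inequality is then applied at \<open>a\<close> and at \<open>c\<close>.\<close>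

lemma CAT0_quadrilateral:
  assumes Y: "CAT0_space Y"
    and abcd: "a \<in> mspace Y" "b \<in> mspace Y" "c \<in> mspace Y" "d \<in> mspace Y"
  shows "(mdist Y a c)\<^sup>2 + (mdist Y b d)\<^sup>2 \<le>
    (mdist Y b c)\<^sup>2 + (mdist Y a d)\<^sup>2 + 2 * mdist Y a b * mdist Y c d"
proof (cases "mdist Y a b = 0 \<or> mdist Y c d = 0")
  case True
  then have "a = b \<or> c = d" using abcd by simp
  then show ?thesis by auto
next
  case False
  define u v where "u = mdist Y a b" and "v = mdist Y c d"
  have uv: "u > 0" "v > 0" using False by (simp_all add: u_def v_def less_le)
  \<comment> \<open>the point on the diagonal is chosen so that \<open>(1 - t) / t * u\<^sup>2 + t / (1 - t) * v\<^sup>2 = 2 * u * v\<close>\<close>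
  define t where "t = u / (u + v)"
  have t: "0 < t" "t < 1" using uv by (auto simp: t_def)
  have t1: "1 - t = v / (u + v)" using uv by (simp add: t_def field_simps)
  obtain m where m: "m \<in> mspace Y" and CN: "\<And>x. x \<in> mspace Y \<Longrightarrow>
      (mdist Y x m)\<^sup>2 \<le> (1 - t) * (mdist Y x b)\<^sup>2 + t * (mdist Y x d)\<^sup>2 - t * (1 - t) * (mdist Y b d)\<^sup>2"
    using CAT0_weighted_CN[OF Y abcd(2,4) less_imp_le[OF t(1)] less_imp_le[OF t(2)]] by blast
  have 1: "(mdist Y a m)\<^sup>2 / t \<le> (1 - t) / t * u\<^sup>2 + (mdist Y a d)\<^sup>2 - (1 - t) * (mdist Y b d)\<^sup>2"
    using CN[OF abcd(1)] t by (simp add: field_simps u_def power2_eq_square)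
  have 2: "(mdist Y c m)\<^sup>2 / (1 - t) \<le> (mdist Y b c)\<^sup>2 + t / (1 - t) * v\<^sup>2 - t * (mdist Y b d)\<^sup>2"
  proof -
    have "(mdist Y c m)\<^sup>2 / (1 - t) \<le> ((1 - t) * (mdist Y c b)\<^sup>2 + t * (mdist Y c d)\<^sup>2
        - t * (1 - t) * (mdist Y b d)\<^sup>2) / (1 - t)"
      using CN[OF abcd(3)] t by (intro divide_right_mono) auto
    also have "\<dots> = (mdist Y b c)\<^sup>2 + t / (1 - t) * v\<^sup>2 - t * (mdist Y b d)\<^sup>2"
      using t by (simp add: diff_divide_distrib add_divide_distrib v_def mdist_commute)
    finally show ?thesis .
  qed
  have "mdist Y a c \<le> mdist Y a m + mdist Y c m"
    using mdist_triangle[of a Y m c] abcd m by (simp add: mdist_commute)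
  then have "(mdist Y a c)\<^sup>2 \<le> (mdist Y a m + mdist Y c m)\<^sup>2" by (intro power_mono) auto
  also have "\<dots> \<le> (mdist Y a m)\<^sup>2 / t + (mdist Y c m)\<^sup>2 / (1 - t)"
    using power2_add_le_weighted t by blast
  also have "\<dots> \<le> (1 - t) / t * u\<^sup>2 + t / (1 - t) * v\<^sup>2 + (mdist Y a d)\<^sup>2 + (mdist Y b c)\<^sup>2
      - (mdist Y b d)\<^sup>2"
    using 1 2 by (simp add: algebra_simps)
  also have "(1 - t) / t = v / u" unfolding t1 using uv by (simp add: t_def)
  also have "t / (1 - t) = u / v" unfolding t1 using uv by (simp add: t_def)
  finally show ?thesis
    using uv by (simp add: power2_eq_square flip: u_def v_def)
qed

text \<open>The variance inequality replaces minimality of the weighted sum of squared distances. It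
  implies minimality, and it is the form in which two barycenters can be tested against each
  other.\<close>

definition barycenter_on :: "'y metric \<Rightarrow> 'k set \<Rightarrow> ('k \<Rightarrow> real) \<Rightarrow> ('k \<Rightarrow> 'y) \<Rightarrow> 'y \<Rightarrow> bool" where
  "barycenter_on Y K u y b \<longleftrightarrow> b \<in> mspace Y \<and>
     (\<forall>z\<in>mspace Y. (mdist Y z b)\<^sup>2 + (\<Sum>k\<in>K. u k * (mdist Y b (y k))\<^sup>2) \<le>
        (\<Sum>k\<in>K. u k * (mdist Y z (y k))\<^sup>2))"

text \<open>The functional \<open>G\<close> is uniformly convex by the weighted CN inequality, so a
  minimising sequence is Cauchy. The variance inequality at the minimiser \<open>b\<close> comes
  from moving an infinitesimal amount from \<open>b\<close> towards \<open>z\<close>.\<close>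

lemma barycenter_exists:
  assumes Y: "CAT0_space Y" and compl: "mcomplete_of Y"
    and K: "finite K" and y: "\<And>k. k \<in> K \<Longrightarrow> y k \<in> mspace Y"
    and u: "\<And>k. k \<in> K \<Longrightarrow> 0 \<le> u k" "sum u K = 1"
  obtains b where "barycenter_on Y K u y b"
proof -
  interpret M: Metric_space "mspace Y" "mdist Y" by (rule Metric_space_mspace_mdist)
  define G where "G z = (\<Sum>k\<in>K. u k * (mdist Y z (y k))\<^sup>2)" for z
  have G0: "0 \<le> G z" for z unfolding G_def using u by (intro sum_nonneg) auto
  have convex: "\<exists>m\<in>mspace Y. G m \<le> (1 - t) * G p + t * G q - t * (1 - t) * (mdist Y p q)\<^sup>2"
    if pq: "p \<in> mspace Y" "q \<in> mspace Y" and t: "0 \<le> t" "t \<le> 1" for p q t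
  proof -
    obtain m where m: "m \<in> mspace Y" and CN: "\<And>x. x \<in> mspace Y \<Longrightarrow>
      (mdist Y x m)\<^sup>2 \<le> (1 - t) * (mdist Y x p)\<^sup>2 + t * (mdist Y x q)\<^sup>2 - t * (1 - t) * (mdist Y p q)\<^sup>2"
      using CAT0_weighted_CN[OF Y pq t] by blast
    have "G m \<le> (\<Sum>k\<in>K. u k * ((1 - t) * (mdist Y p (y k))\<^sup>2 + t * (mdist Y q (y k))\<^sup>2
        - t * (1 - t) * (mdist Y p q)\<^sup>2))"
      unfolding G_def using CN[OF y] u(1) by (intro sum_mono mult_left_mono) (auto simp: mdist_commute)
    also have "\<dots> = (1 - t) * G p + t * G q - t * (1 - t) * (mdist Y p q)\<^sup>2 * sum u K"
      unfolding G_def sum_distrib_left sum.distrib[symmetric] sum_subtractf[symmetric]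
      by (intro sum.cong) (auto simp: algebra_simps)
    finally show ?thesis using m u by auto
  qed
  define gm where "gm = Inf (G ` mspace Y)"
  have ne: "mspace Y \<noteq> {}" using Y by (simp add: CAT0_space_def)
  have bdd: "bdd_below (G ` mspace Y)" using G0 by (intro bdd_belowI[of _ 0]) auto
  have gm: "gm \<le> G z" if "z \<in> mspace Y" for z
    unfolding gm_def using bdd that by (simp add: cInf_lower)
  have "\<exists>z\<in>mspace Y. G z < gm + inverse (real (Suc i))" for i
    using cInf_lessD[of "G ` mspace Y" "gm + inverse (real (Suc i))"] ne
    unfolding gm_def by auto
  then obtain s where s: "\<And>i. s i \<in> mspace Y" "\<And>i. G (s i) < gm + inverse (real (Suc i))" by metis
  \<comment> \<open>The value of \<open>G\<close> at a midpoint is still at least the infimum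
    \<open>gm\<close>, which bounds the distance of two almost minimisers.\<close>
  have close: "(mdist Y p q)\<^sup>2 \<le> 2 * (G p - gm) + 2 * (G q - gm)"
    if pq: "p \<in> mspace Y" "q \<in> mspace Y" for p q
  proof -
    obtain m where "m \<in> mspace Y"
      "G m \<le> (1 - 1/2) * G p + 1/2 * G q - 1/2 * (1 - 1/2) * (mdist Y p q)\<^sup>2"
      using convex[OF pq, of "1/2"] by auto
    then show ?thesis using gm[of m] by (simp add: field_simps)
  qed
  have "M.MCauchy s"
    unfolding M.MCauchy_def
  proof (intro conjI allI impI)
    show "range s \<subseteq> mspace Y" using s by auto
    fix e :: real assume e: "e > 0"
    then obtain n where n: "inverse (real (Suc n)) < e\<^sup>2 / 4"
      using reals_Archimedean[of "e\<^sup>2 / 4"] by auto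
    have "mdist Y (s i) (s j) < e" if "n \<le> i" "n \<le> j" for i j
    proof -
      have *: "G (s k) - gm < e\<^sup>2 / 4" if "n \<le> k" for k
      proof -
        have "inverse (real (Suc k)) \<le> inverse (real (Suc n))" using that by (simp add: field_simps)
        then show ?thesis using s(2)[of k] n by linarith
      qed
      have "(mdist Y (s i) (s j))\<^sup>2 < e\<^sup>2"
        using close[OF s(1) s(1), of i j] *[OF that(1)] *[OF that(2)] by (simp add: field_simps)
      then show ?thesis using e by (simp add: power2_less_imp_less)
    qed
    then show "\<exists>N. \<forall>n n'. N \<le> n \<longrightarrow> N \<le> n' \<longrightarrow> mdist Y (s n) (s n') < e" by blast
  qed
  then obtain b where lim: "limitin (mtopology_of Y) s b sequentially"
    using compl unfolding mcomplete_of_def M.mcomplete_def by (auto simp: mtopology_of_def)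
  then have b: "b \<in> mspace Y" by (metis limitin_topspace topspace_mtopology_of)
  have dist0: "(\<lambda>i. mdist Y (s i) b) \<longlonglongrightarrow> 0"
    using lim by (auto simp: mtopology_of_def M.limit_metric_sequentially LIMSEQ_iff) (meson)
  have "(\<lambda>i. mdist Y (s i) (y k)) \<longlonglongrightarrow> mdist Y b (y k)" if "k \<in> K" for k
  proof (rule Lim_transform[of "\<lambda>_. mdist Y b (y k)"])
    have "\<bar>mdist Y (s i) (y k) - mdist Y b (y k)\<bar> \<le> mdist Y (s i) b" for i
      using M.mdist_reverse_triangle[of "s i" "y k" b] s(1) b y[OF that] by (simp add: mdist_commute)
    then show "(\<lambda>i. mdist Y (s i) (y k) - mdist Y b (y k)) \<longlonglongrightarrow> 0"
      by (intro Lim_null_comparison[OF _ dist0]) auto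
  qed auto
  then have "(\<lambda>i. G (s i)) \<longlonglongrightarrow> G b"
    unfolding G_def by (intro tendsto_intros)
  moreover have "(\<lambda>i. gm + inverse (real (Suc i))) \<longlonglongrightarrow> gm + 0"
    by (intro tendsto_intros LIMSEQ_inverse_real_of_nat)
  ultimately have "G b \<le> gm + 0" by (rule LIMSEQ_le) (use s(2) in \<open>auto intro: less_imp_le\<close>)
  then have Gb: "G b = gm" using gm[OF b] by simp
  have "(mdist Y z b)\<^sup>2 + G b \<le> G z" if z: "z \<in> mspace Y" for z
  proof -
    \<comment> \<open>Convexity along the geodesic from \<open>b\<close> to \<open>z\<close>,
      divided by \<open>t\<close>; the limit for \<open>t\<close> tending to 0 removes the factor
      \<open>1 - t\<close>.\<close>
    have "(1 - t) * (mdist Y b z)\<^sup>2 \<le> G z - G b" if t: "0 < t" "t < 1" for t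
    proof -
      obtain m where "m \<in> mspace Y" "G m \<le> (1 - t) * G b + t * G z - t * (1 - t) * (mdist Y b z)\<^sup>2"
        using convex[OF b z, of t] t by auto
      then have "t * ((1 - t) * (mdist Y b z)\<^sup>2) \<le> t * (G z - G b)"
        using gm[of m] Gb by (simp add: algebra_simps)
      then show ?thesis using t by simp
    qed
    then have ev: "eventually (\<lambda>t. (1 - t) * (mdist Y b z)\<^sup>2 \<le> G z - G b) (at_right (0::real))"
      by (auto simp: eventually_at_right_field intro: exI[of _ 1])
    have "((\<lambda>t. (1 - t) * (mdist Y b z)\<^sup>2) \<longlongrightarrow> (1 - 0) * (mdist Y b z)\<^sup>2) (at_right (0::real))"
      by (intro tendsto_intros)
    then have "(1 - 0) * (mdist Y b z)\<^sup>2 \<le> G z - G b"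
      by (rule tendsto_upperbound[OF _ ev]) simp
    then show ?thesis by (simp add: mdist_commute)
  qed
  then have "barycenter_on Y K u y b" using b by (simp add: barycenter_on_def G_def)
  then show ?thesis using that by blast
qed

text \<open>Testing each variance inequality at the other barycenter and adding gives
  \<open>2 * d\<^sup>2\<close> at most the sum of \<open>(u k - w k) * h k\<close>. By the
  quadrilateral inequality \<open>h\<close> oscillates by at most \<open>2 * d * R\<close>. Both
  weights have sum 1, so \<open>h\<close> may be centred at its midrange, which leaves
  \<open>\<bar>h k - m\<bar> \<le> d * R\<close>; then \<open>d\<close> cancels.\<close>

lemma barycenter_dist_le:
  assumes Y: "CAT0_space Y" and K: "finite K" and y: "\<And>k. k \<in> K \<Longrightarrow> y k \<in> mspace Y"
    and R: "\<And>k l. k \<in> K \<Longrightarrow> l \<in> K \<Longrightarrow> mdist Y (y k) (y l) \<le> R"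
    and u: "sum u K = 1" "barycenter_on Y K u y b"
    and w: "sum w K = 1" "barycenter_on Y K w y c"
  shows "mdist Y b c \<le> R * (\<Sum>k\<in>K. \<bar>u k - w k\<bar>) / 2"
proof -
  have bc: "b \<in> mspace Y" "c \<in> mspace Y" using u w by (auto simp: barycenter_on_def)
  have Kne: "K \<noteq> {}" using u by auto
  define d where "d = mdist Y b c"
  define h where "h k = (mdist Y c (y k))\<^sup>2 - (mdist Y b (y k))\<^sup>2" for k
  define hi lo where "hi = Max (h ` K)" and "lo = Min (h ` K)"
  have "hi \<in> h ` K" "lo \<in> h ` K" unfolding hi_def lo_def using K Kne by (auto intro: Max_in Min_in)
  then obtain k l where kl: "k \<in> K" "l \<in> K" "hi = h k" "lo = h l" by auto
  \<comment> \<open>The quadrilateral has the vertices \<open>c\<close>, \<open>b\<close>,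
    \<open>y k\<close>, \<open>y l\<close>, in this order.\<close>
  have "h k - h l \<le> 2 * d * mdist Y (y l) (y k)"
    using CAT0_quadrilateral[OF Y bc(2,1) y[OF kl(1)] y[OF kl(2)]]
    by (simp add: h_def d_def mdist_commute)
  also have "\<dots> \<le> 2 * d * R" using R[OF kl(2,1)] by (intro mult_left_mono) (auto simp: d_def)
  finally have hl: "hi - lo \<le> 2 * d * R" using kl by simp
  define m where "m = (hi + lo) / 2"
  have hm: "\<bar>h k - m\<bar> \<le> d * R" if "k \<in> K" for k
  proof -
    have "h k \<le> hi" "lo \<le> h k" unfolding hi_def lo_def using K that by auto
    then show ?thesis using hl by (simp add: m_def abs_le_iff field_simps)
  qed
  have "d\<^sup>2 \<le> (\<Sum>k\<in>K. u k * h k)"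
    using u(2) bc(2) unfolding barycenter_on_def h_def d_def
    by (auto simp: algebra_simps sum_subtractf mdist_commute)
  moreover have "d\<^sup>2 \<le> (\<Sum>k\<in>K. - w k * h k)"
    using w(2) bc(1) unfolding barycenter_on_def h_def d_def
    by (auto simp: algebra_simps sum_subtractf sum_negf mdist_commute)
  ultimately have "2 * d\<^sup>2 \<le> (\<Sum>k\<in>K. (u k - w k) * h k)"
    by (simp add: algebra_simps sum_subtractf sum_negf)
  also have "\<dots> = (\<Sum>k\<in>K. (u k - w k) * (h k - m))"
  proof -
    have "(\<Sum>k\<in>K. (u k - w k) * m) = 0"
      using u(1) w(1) by (simp add: sum_subtractf flip: sum_distrib_right)
    then show ?thesis by (simp add: right_diff_distrib sum_subtractf)
  qed
  also have "\<dots> \<le> (\<Sum>k\<in>K. \<bar>u k - w k\<bar> * (d * R))"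
  proof (rule sum_mono)
    fix k assume "k \<in> K"
    have "(u k - w k) * (h k - m) \<le> \<bar>u k - w k\<bar> * \<bar>h k - m\<bar>" by (metis abs_ge_self abs_mult)
    also have "\<dots> \<le> \<bar>u k - w k\<bar> * (d * R)" by (intro mult_left_mono hm \<open>k \<in> K\<close>) simp
    finally show "(u k - w k) * (h k - m) \<le> \<dots>" .
  qed
  also have "\<dots> = d * (R * (\<Sum>k\<in>K. \<bar>u k - w k\<bar>))"
    by (simp add: sum_distrib_left algebra_simps)
  finally have le: "d * (2 * d) \<le> d * (R * (\<Sum>k\<in>K. \<bar>u k - w k\<bar>))"
    by (simp add: power2_eq_square)
  have "0 \<le> R" using R[OF kl(1) kl(1)] by (meson mdist_nonneg order_trans)
  then show ?thesis
    using le by (cases "d = 0") (auto simp: d_def sum_nonneg less_le)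
qed

text \<open>The point \<open>y l\<close> is the barycenter of the unit mass at \<open>l\<close>, and
  two probability weights differ by at most 2 in total.\<close>

lemma barycenter_dist_point:
  assumes Y: "CAT0_space Y" and K: "finite K" and y: "\<And>k. k \<in> K \<Longrightarrow> y k \<in> mspace Y"
    and R: "\<And>k l. k \<in> K \<Longrightarrow> l \<in> K \<Longrightarrow> mdist Y (y k) (y l) \<le> R"
    and u: "\<And>k. k \<in> K \<Longrightarrow> 0 \<le> u k" "sum u K = 1" "barycenter_on Y K u y b" and l: "l \<in> K"
  shows "mdist Y b (y l) \<le> R"
proof -
  let ?w = "\<lambda>k. if k = l then 1 else 0 :: real"
  have w: "sum ?w K = 1" using K l by simp
  have yl: "y l \<in> mspace Y" using y l .
  have "barycenter_on Y K ?w y (y l)"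
    using K l yl by (simp add: barycenter_on_def if_distrib[of "\<lambda>x. x * _"] cong: if_cong)
  from barycenter_dist_le[OF Y K y R u(2,3) w this]
  have le: "mdist Y b (y l) \<le> R * (\<Sum>k\<in>K. \<bar>u k - ?w k\<bar>) / 2" .
  have "(\<Sum>k\<in>K. \<bar>u k - ?w k\<bar>) \<le> (\<Sum>k\<in>K. u k + ?w k)"
    using u(1) by (intro sum_mono) (fastforce simp: abs_le_iff)
  also have "\<dots> = 2" using u(2) w by (simp add: sum.distrib)
  finally have "R * (\<Sum>k\<in>K. \<bar>u k - ?w k\<bar>) \<le> R * 2"
    using order_trans[OF mdist_nonneg R[OF l l]] by (rule mult_left_mono)
  then show ?thesis using le by simp
qed

section \<open>Lipschitz extension by slowly varying partitions of unity\<close>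

text \<open>Each of the \<open>q + 1\<close> terms in the factorisation of the difference is at most
  the \<open>q\<close>-th power of the larger number. Keeping \<open>q\<close>-th powers on the
  right makes the bound summable over the covering by the next lemma.\<close>

lemma abs_power_diff_le:
  fixes a b :: real
  assumes "0 \<le> a" "0 \<le> b"
  shows "\<bar>a ^ Suc q - b ^ Suc q\<bar> \<le> real (Suc q) * \<bar>a - b\<bar> * (a ^ q + b ^ q)"
proof -
  have le: "a ^ p * b ^ (q - p) \<le> a ^ q + b ^ q" if "p \<le> q" for p
  proof -
    have "a ^ p * b ^ (q - p) \<le> max a b ^ p * max a b ^ (q - p)"
      using assms by (intro mult_mono power_mono) auto
    also have "\<dots> = max a b ^ q" using that by (simp flip: power_add)
    also have "\<dots> \<le> a ^ q + b ^ q" using assms by (simp add: max_def)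
    finally show ?thesis .
  qed
  have "a ^ Suc q - b ^ Suc q = (a - b) * (\<Sum>p<Suc q. a ^ p * b ^ (q - p))"
    by (rule diff_power_eq_sum)
  then have "\<bar>a ^ Suc q - b ^ Suc q\<bar> = \<bar>a - b\<bar> * (\<Sum>p<Suc q. a ^ p * b ^ (q - p))"
    using assms by (simp add: abs_mult sum_nonneg del: sum.lessThan_Suc)
  also have "\<dots> \<le> \<bar>a - b\<bar> * (\<Sum>p<Suc q. a ^ q + b ^ q)"
    using le by (intro mult_left_mono sum_mono) auto
  also have "\<dots> = real (Suc q) * \<bar>a - b\<bar> * (a ^ q + b ^ q)" by simp
  finally show ?thesis .
qed

text \<open>A weight of at least 1/2 satisfies \<open>u k ^ q \<le> 2 * u k ^ Suc q\<close>. The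
  smaller ones number at most \<open>2 ^ q\<close> and contribute at most \<open>(1/2) ^ q\<close>
  each, hence together at most 1, which the lower bound on the right-hand sum absorbs.\<close>

lemma sum_power_le_sum_power_Suc:
  fixes u :: "'k \<Rightarrow> real"
  assumes K: "finite K" and u: "\<And>k. k \<in> K \<Longrightarrow> 0 \<le> u k" and q: "q \<ge> 1"
    and card: "card {k\<in>K. u k > 0} \<le> 2 ^ q" and U: "1 \<le> (\<Sum>k\<in>K. u k ^ Suc q)"
  shows "(\<Sum>k\<in>K. u k ^ q) \<le> 3 * (\<Sum>k\<in>K. u k ^ Suc q)"
proof -
  let ?S = "{k\<in>K. u k > 0}"
  have zero: "u k = 0" if "k \<in> K - ?S" for k using that u[of k] by auto
  \<comment> \<open>The exponent has to be positive: for \<open>p = 0\<close> the vanishing weights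
    would contribute \<open>0 ^ 0 = 1\<close> each.\<close>
  have restrict: "(\<Sum>k\<in>K. u k ^ p) = (\<Sum>k\<in>?S. u k ^ p)" if "p \<ge> 1" for p
    using K zero that by (intro sum.mono_neutral_right) auto
  have "(\<Sum>k\<in>?S. u k ^ q) \<le> (\<Sum>k\<in>?S. 2 * u k ^ Suc q + (1/2) ^ q)"
  proof (rule sum_mono)
    fix k assume k: "k \<in> ?S"
    show "u k ^ q \<le> 2 * u k ^ Suc q + (1/2) ^ q"
    proof (cases "u k \<ge> 1/2")
      case True
      then have "1 * u k ^ q \<le> (2 * u k) * u k ^ q" using k by (intro mult_right_mono) auto
      then show ?thesis by (simp add: add_increasing2 mult.assoc)
    next
      case False
      then have "u k ^ q \<le> (1/2) ^ q" using k by (intro power_mono) auto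
      then show ?thesis using k by (simp add: add_increasing)
    qed
  qed
  also have "\<dots> = 2 * (\<Sum>k\<in>?S. u k ^ Suc q) + real (card ?S) * (1/2) ^ q"
    by (simp add: sum.distrib sum_distrib_left)
  also have "real (card ?S) * (1/2) ^ q \<le> 2 ^ q * (1/2) ^ q"
    using of_nat_mono[OF card, where 'a=real] by (intro mult_right_mono) auto
  also have "(2::real) ^ q * (1/2) ^ q = 1" by (simp flip: power_mult_distrib)
  finally show ?thesis using U restrict[of q] restrict[of "Suc q"] q by simp
qed

text \<open>Raising the weights to a power logarithmic in the size of their supports makes the
  normalised weights vary by that logarithm only, instead of by the size itself.\<close>

lemma normalized_power_weights_diff:
  fixes u w :: "'k \<Rightarrow> real"
  assumes K: "finite K" and u: "\<And>k. k \<in> K \<Longrightarrow> 0 \<le> u k" and w: "\<And>k. k \<in> K \<Longrightarrow> 0 \<le> w k"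
    and q: "q \<ge> 1"
    and cards: "card {k\<in>K. u k > 0} \<le> 2 ^ q" "card {k\<in>K. w k > 0} \<le> 2 ^ q"
    and UW: "U = (\<Sum>k\<in>K. u k ^ Suc q)" "W = (\<Sum>k\<in>K. w k ^ Suc q)" "1 \<le> U" "1 \<le> W"
    and \<delta>: "\<And>k. k \<in> K \<Longrightarrow> \<bar>u k - w k\<bar> \<le> \<delta>"
  shows "(\<Sum>k\<in>K. \<bar>u k ^ Suc q / U - w k ^ Suc q / W\<bar>) \<le> 12 * real (Suc q) * \<delta>"
proof -
  have Kne: "K \<noteq> {}" using UW by auto
  then have \<delta>0: "0 \<le> \<delta>" using \<delta> by (meson abs_ge_zero ex_in_conv order_trans)
  define E where "E = (\<Sum>k\<in>K. \<bar>u k ^ Suc q - w k ^ Suc q\<bar>)"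
  have "E \<le> (\<Sum>k\<in>K. real (Suc q) * \<delta> * (u k ^ q + w k ^ q))"
    unfolding E_def
  proof (rule sum_mono)
    fix k assume k: "k \<in> K"
    have "\<bar>u k ^ Suc q - w k ^ Suc q\<bar> \<le> real (Suc q) * \<bar>u k - w k\<bar> * (u k ^ q + w k ^ q)"
      using abs_power_diff_le u w k by blast
    also have "\<dots> \<le> real (Suc q) * \<delta> * (u k ^ q + w k ^ q)"
      using \<delta> u w k by (intro mult_right_mono mult_left_mono) auto
    finally show "\<bar>u k ^ Suc q - w k ^ Suc q\<bar> \<le> \<dots>" .
  qed
  also have "\<dots> = real (Suc q) * \<delta> * ((\<Sum>k\<in>K. u k ^ q) + (\<Sum>k\<in>K. w k ^ q))"
    by (simp only: sum_distrib_left[symmetric] sum.distrib)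
  also have "\<dots> \<le> real (Suc q) * \<delta> * (3 * U + 3 * W)"
    unfolding UW(1,2) using \<delta>0 K u w q cards UW
    by (intro mult_left_mono add_mono sum_power_le_sum_power_Suc) auto
  finally have E: "E \<le> 3 * real (Suc q) * \<delta> * (U + W)" by (simp add: algebra_simps)
  have UWE: "\<bar>U - W\<bar> \<le> E"
    unfolding UW(1,2) E_def sum_subtractf[symmetric] by (rule sum_abs)
  \<comment> \<open>By symmetry the larger total is called \<open>A\<close>. Then
    \<open>E / A \<le> 6 * real (Suc q) * \<delta>\<close>, and this is paid twice: once for the
    change of the numerators and once for the change of the total, which gives 12.\<close>
  have one_side: "(\<Sum>k\<in>K. \<bar>a k / A - b k / B\<bar>) \<le> 12 * real (Suc q) * \<delta>"
    if A: "A = sum a K" "1 \<le> A" and B: "B = sum b K" "1 \<le> B" and AB: "A \<ge> B"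
      and b: "\<And>k. k \<in> K \<Longrightarrow> 0 \<le> b k" and ab: "(\<Sum>k\<in>K. \<bar>a k - b k\<bar>) = E" "\<bar>A - B\<bar> \<le> E"
      and E': "E \<le> 3 * real (Suc q) * \<delta> * (A + B)"
    for a b :: "'k \<Rightarrow> real" and A B
  proof -
    have EA: "E \<le> 3 * real (Suc q) * \<delta> * (A + A)"
      using \<delta>0 AB by (intro order_trans[OF E'] mult_left_mono) auto
    have "(\<Sum>k\<in>K. \<bar>a k / A - b k / B\<bar>) \<le> (\<Sum>k\<in>K. \<bar>a k - b k\<bar> / A + b k * (\<bar>A - B\<bar> / (A * B)))"
    proof (rule sum_mono)
      fix k assume k: "k \<in> K"
      have "a k / A - b k / B = (a k - b k) / A + b k * ((B - A) / (A * B))"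
        using A B by (simp add: field_simps)
      then have "\<bar>a k / A - b k / B\<bar> \<le> \<bar>(a k - b k) / A\<bar> + \<bar>b k * ((B - A) / (A * B))\<bar>"
        by (metis abs_triangle_ineq)
      also have "\<dots> = \<bar>a k - b k\<bar> / A + b k * (\<bar>A - B\<bar> / (A * B))"
        using A B b[OF k] by (simp add: abs_mult abs_minus_commute)
      finally show "\<bar>a k / A - b k / B\<bar> \<le> \<dots>" .
    qed
    also have "\<dots> = E / A + B * (\<bar>A - B\<bar> / (A * B))"
      by (simp add: sum.distrib ab(1)[symmetric] B(1) sum_divide_distrib sum_distrib_right)
    also have "\<dots> \<le> E / A + E / A"
      using A(2) B(2) divide_right_mono[OF ab(2), of A] by simp
    also have "\<dots> \<le> 3 * real (Suc q) * \<delta> * (A + A) / A + 3 * real (Suc q) * \<delta> * (A + A) / A"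
      using A(2) EA by (intro add_mono divide_right_mono) auto
    also have "\<dots> = 12 * real (Suc q) * \<delta>" using A(2) by (simp add: field_simps)
    finally show ?thesis .
  qed
  show ?thesis
  proof (cases "U \<ge> W")
    case True
    show ?thesis
      by (rule one_side) (use True UW E UWE w in \<open>auto simp: E_def\<close>)
  next
    case False
    have "(\<Sum>k\<in>K. \<bar>w k ^ Suc q / W - u k ^ Suc q / U\<bar>) \<le> 12 * real (Suc q) * \<delta>"
      by (rule one_side)
        (use False UW E UWE u in \<open>auto simp: E_def abs_minus_commute add.commute\<close>)
    then show ?thesis by (simp add: abs_minus_commute)
  qed
qed

lemma maximal_separated_subset_exists:
  fixes P :: "'a \<Rightarrow> 'a \<Rightarrow> bool"
  assumes sym: "\<And>x y. P x y \<Longrightarrow> P y x"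
  obtains Z where "Z \<subseteq> B" "\<And>x y. x \<in> Z \<Longrightarrow> y \<in> Z \<Longrightarrow> x \<noteq> y \<Longrightarrow> P x y"
    "\<And>x. x \<in> B \<Longrightarrow> x \<notin> Z \<Longrightarrow> \<exists>z\<in>Z. \<not> P x z"
proof -
  let ?\<A> = "{Z. Z \<subseteq> B \<and> (\<forall>x\<in>Z. \<forall>y\<in>Z. x \<noteq> y \<longrightarrow> P x y)}"
  have ex: "\<exists>M\<in>?\<A>. \<forall>X\<in>?\<A>. M \<subseteq> X \<longrightarrow> X = M"
  proof (rule subset_Zorn')
    fix C assume C: "subset.chain ?\<A> C"
    then have sub: "Z \<in> ?\<A>" if "Z \<in> C" for Z using that by (auto simp: subset_chain_def)
    have "P x y" if xy: "x \<in> \<Union>C" "y \<in> \<Union>C" "x \<noteq> y" for x y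
    proof -
      obtain Z1 Z2 where Z: "Z1 \<in> C" "x \<in> Z1" "Z2 \<in> C" "y \<in> Z2" using xy by auto
      then have "Z1 \<subseteq> Z2 \<or> Z2 \<subseteq> Z1" using C by (auto simp: subset_chain_def)
      then show ?thesis using Z xy sub by blast
    qed
    then show "\<Union>C \<in> ?\<A>" using sub by blast
  qed
  from ex obtain Z where Z: "Z \<in> ?\<A>" and max: "\<forall>Z'\<in>?\<A>. Z \<subseteq> Z' \<longrightarrow> Z' = Z" by (rule bexE)
  have "\<exists>z\<in>Z. \<not> P x z" if x: "x \<in> B" "x \<notin> Z" for x
  proof (rule ccontr)
    assume "\<not> ?thesis"
    then have "\<forall>z\<in>Z. P x z \<and> P z x" using sym by blast
    then have "insert x Z \<in> ?\<A>" using Z x by simp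
    then show False using bspec[OF max, of "insert x Z"] x by auto
  qed
  then show ?thesis using that[of Z] Z by simp
qed

section \<open>Whitney coverings and the extension theorem in pseudometric spaces\<close>

locale pseudometric =
  fixes X :: "'x set" and d :: "'x \<Rightarrow> 'x \<Rightarrow> real"
  assumes nonneg: "x \<in> X \<Longrightarrow> y \<in> X \<Longrightarrow> 0 \<le> d x y"
    and refl: "x \<in> X \<Longrightarrow> d x x = 0"
    and sym: "x \<in> X \<Longrightarrow> y \<in> X \<Longrightarrow> d x y = d y x"
    and triangle: "x \<in> X \<Longrightarrow> y \<in> X \<Longrightarrow> z \<in> X \<Longrightarrow> d x z \<le> d x y + d y z"
begin

lemma infdist_exists:
  assumes A: "A \<subseteq> X" "A \<noteq> {}"
  obtains \<rho> where "\<And>x. x \<in> X \<Longrightarrow> 0 \<le> \<rho> x" "\<And>x a. x \<in> X \<Longrightarrow> a \<in> A \<Longrightarrow> \<rho> x \<le> d x a"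
    "\<And>x y. x \<in> X \<Longrightarrow> y \<in> X \<Longrightarrow> \<rho> x \<le> \<rho> y + d x y"
    "\<And>x r. x \<in> X \<Longrightarrow> \<rho> x < r \<Longrightarrow> \<exists>a\<in>A. d x a < r"
proof
  define \<rho> where "\<rho> x = Inf (d x ` A)" for x
  have bdd: "bdd_below (d x ` A)" if "x \<in> X" for x
    using A that nonneg by (intro bdd_belowI[of _ 0]) auto
  show "0 \<le> \<rho> x" if "x \<in> X" for x
    unfolding \<rho>_def using A that nonneg by (intro cInf_greatest) auto
  show le: "\<rho> x \<le> d x a" if "x \<in> X" "a \<in> A" for x a
    unfolding \<rho>_def using bdd[OF that(1)] that by (intro cInf_lower) auto
  show less: "\<exists>a\<in>A. d x a < r" if "x \<in> X" "\<rho> x < r" for x r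
    using cInf_lessD[of "d x ` A" r] A that unfolding \<rho>_def by auto
  show "\<rho> x \<le> \<rho> y + d x y" if xy: "x \<in> X" "y \<in> X" for x y
  proof (rule field_le_epsilon)
    fix e :: real assume "e > 0"
    then obtain a where a: "a \<in> A" "d y a < \<rho> y + e" using less[OF xy(2), of "\<rho> y + e"] by auto
    have "\<rho> x \<le> d x a" using le xy a by blast
    also have "\<dots> \<le> d x y + d y a" using triangle xy a A by blast
    finally show "\<rho> x \<le> \<rho> y + d x y + e" using a by simp
  qed
qed

text \<open>Reduction to a closed domain, off which the distance to it is positive. A limit value
  \<open>h x\<close> is controlled only through its distances to all \<open>f a\<close>. This
  suffices for two limit points: pass through one \<open>a\<close> close to \<open>x\<close>, at the
  cost of \<open>2 * d x a\<close>.\<close>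

lemma extend_to_closure:
  assumes compl: "mcomplete_of Y" and A: "A \<subseteq> X" "A \<noteq> {}" and f: "f \<in> A \<rightarrow> mspace Y"
    and lip: "\<And>x y. x \<in> A \<Longrightarrow> y \<in> A \<Longrightarrow> mdist Y (f x) (f y) \<le> d x y"
  obtains B h where "A \<subseteq> B" "B \<subseteq> X" "\<And>x. x \<in> X \<Longrightarrow> (\<And>e. e > 0 \<Longrightarrow> \<exists>b\<in>B. d x b < e) \<Longrightarrow> x \<in> B"
    "h \<in> B \<rightarrow> mspace Y" "\<And>x. x \<in> A \<Longrightarrow> h x = f x"
    "\<And>x y. x \<in> B \<Longrightarrow> y \<in> B \<Longrightarrow> mdist Y (h x) (h y) \<le> d x y"
proof -
  interpret M: Metric_space "mspace Y" "mdist Y" by (rule Metric_space_mspace_mdist)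
  define B where "B = {x\<in>X. \<forall>e>0. \<exists>a\<in>A. d x a < e}"
  have BX: "B \<subseteq> X" by (auto simp: B_def)
  have AB: "A \<subseteq> B" using A refl by (force simp: B_def)
  have val: "\<exists>y\<in>mspace Y. (\<forall>a\<in>A. mdist Y y (f a) \<le> d x a) \<and> (x \<in> A \<longrightarrow> y = f x)" if x: "x \<in> B" for x
  proof (cases "x \<in> A")
    case True
    then show ?thesis using lip f by (intro bexI[of _ "f x"]) auto
  next
    case False
    have "\<exists>a\<in>A. d x a < inverse (real (Suc i))" for i using x by (simp add: B_def)
    then obtain s where s: "\<And>i. s i \<in> A" "\<And>i. d x (s i) < inverse (real (Suc i))" by metis
    have sX: "s i \<in> X" for i using s A by blast
    have xX: "x \<in> X" using x BX by blast
    have dd: "mdist Y (f (s i)) (f a) \<le> d x (s i) + d x a" if "a \<in> A" for i a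
      using lip[OF s(1)[of i] that] triangle[OF sX[of i] xX, of a] sym[OF sX[of i] xX] that A by auto
    have small: "d x (s i) < e" if "inverse (real (Suc n)) < e" "n \<le> i" for i n e
    proof -
      have "inverse (real (Suc i)) \<le> inverse (real (Suc n))" using that by (simp add: field_simps)
      then show ?thesis using s(2)[of i] that by linarith
    qed
    have "M.MCauchy (f \<circ> s)"
      unfolding M.MCauchy_def
    proof (intro conjI allI impI)
      show "range (f \<circ> s) \<subseteq> mspace Y" using s f by auto
      fix e :: real assume e: "e > 0"
      then obtain n where n: "inverse (real (Suc n)) < e / 2"
        using reals_Archimedean[of "e / 2"] by auto
      have "mdist Y ((f \<circ> s) i) ((f \<circ> s) j) < e" if "n \<le> i" "n \<le> j" for i j
        using dd[OF s(1)[of j], of i] small[OF n that(1)] small[OF n that(2)] by simp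
      then show "\<exists>N. \<forall>n n'. N \<le> n \<longrightarrow> N \<le> n' \<longrightarrow> mdist Y ((f \<circ> s) n) ((f \<circ> s) n') < e" by blast
    qed
    then obtain y where lim: "limitin M.mtopology (f \<circ> s) y sequentially"
      using compl unfolding mcomplete_of_def M.mcomplete_def by auto
    then have y: "y \<in> mspace Y" by (simp add: M.limitin_mspace)
    have "mdist Y y (f a) \<le> d x a" if a: "a \<in> A" for a
    proof (rule field_le_epsilon)
      fix e :: real assume e: "e > 0"
      obtain n1 where n1: "\<And>i. i \<ge> n1 \<Longrightarrow> mdist Y (f (s i)) y < e / 2"
        using lim e unfolding M.limit_metric_sequentially by (metis comp_apply half_gt_zero)
      obtain n2 where n2: "inverse (real (Suc n2)) < e / 2"
        using reals_Archimedean[of "e / 2"] e by auto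
      let ?i = "max n1 n2"
      have "mdist Y y (f a) \<le> mdist Y y (f (s ?i)) + mdist Y (f (s ?i)) (f a)"
        using mdist_triangle[OF y, of "f (s ?i)" "f a"] f a s by auto
      then show "mdist Y y (f a) \<le> d x a + e"
        using n1[of ?i] small[OF n2, of ?i] dd[OF a, of ?i] by (simp add: mdist_commute)
    qed
    then show ?thesis using y False by blast
  qed
  then obtain h where h: "\<And>x. x \<in> B \<Longrightarrow> h x \<in> mspace Y"
    "\<And>x a. x \<in> B \<Longrightarrow> a \<in> A \<Longrightarrow> mdist Y (h x) (f a) \<le> d x a" "\<And>x. x \<in> A \<Longrightarrow> h x = f x"
    using AB by (metis subsetD)
  show ?thesis
  proof (rule that[of B h])
    show "x \<in> B" if x: "x \<in> X" and close: "\<And>e. e > 0 \<Longrightarrow> \<exists>b\<in>B. d x b < e" for x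
    proof -
      have "\<exists>a\<in>A. d x a < e" if e: "e > 0" for e
      proof -
        obtain b where b: "b \<in> B" "d x b < e / 2" using close e by (meson half_gt_zero)
        then obtain a where a: "a \<in> A" "d b a < e / 2" using e half_gt_zero unfolding B_def by blast
        have "d x a \<le> d x b + d b a" using triangle x a b A BX by blast
        then show ?thesis using a b by (intro bexI[of _ a]) auto
      qed
      then show ?thesis using x by (simp add: B_def)
    qed
    show "mdist Y (h x) (h y) \<le> d x y" if xy: "x \<in> B" "y \<in> B" for x y
    proof (rule field_le_epsilon)
      fix e :: real assume e: "e > 0"
      then obtain a where a: "a \<in> A" "d x a < e / 2" using xy unfolding B_def by (auto dest: spec[of _ "e / 2"])
      have X: "x \<in> X" "y \<in> X" "a \<in> X" using xy a A BX by auto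
      have "f a \<in> mspace Y" using f a by auto
      then have "mdist Y (h x) (h y) \<le> mdist Y (h x) (f a) + mdist Y (h y) (f a)"
        using mdist_triangle[of "h x" Y "f a" "h y"] h(1) xy by (simp add: mdist_commute)
      also have "\<dots> \<le> d x a + d y a" using h(2) xy a by (intro add_mono) auto
      also have "d y a \<le> d x y + d x a" using triangle[of y x a] sym[of x y] X by simp
      finally show "mdist Y (h x) (h y) \<le> d x y + e" using a by simp
    qed
  qed (use AB BX h in auto)
qed

text \<open>Off \<open>A\<close> the extension is the barycenter of the values of \<open>f\<close>
  at almost nearest points of the Whitney centres near \<open>x\<close>. Points closer than a tenth
  of their distance to \<open>A\<close> are compared through their weights, others through the size
  of the values. The close case yields the constant 820/3, rounded up to 280.\<close>

theorem lipschitz_extension_CAT0_closed: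
  assumes Y: "CAT0_space Y" and compl: "mcomplete_of Y"
    and A: "A \<subseteq> X" "A \<noteq> {}"
    and closed: "\<And>x. x \<in> X \<Longrightarrow> (\<And>e. e > 0 \<Longrightarrow> \<exists>a\<in>A. d x a < e) \<Longrightarrow> x \<in> A"
    and f: "f \<in> A \<rightarrow> mspace Y"
    and lip: "\<And>x y. x \<in> A \<Longrightarrow> y \<in> A \<Longrightarrow> mdist Y (f x) (f y) \<le> d x y"
    and q: "q \<ge> 1"
    and packing: "\<forall>Z\<subseteq>X. \<forall>r>0. (\<forall>z\<in>Z. \<forall>z'\<in>Z. d z z' \<le> 20/3 * r \<and> (z \<noteq> z' \<longrightarrow> r \<le> d z z')) \<longrightarrow>
      finite Z \<and> card Z \<le> 2 ^ q"
  obtains F where "F \<in> X \<rightarrow> mspace Y" "\<And>x. x \<in> A \<Longrightarrow> F x = f x"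
    "\<And>x y. x \<in> X \<Longrightarrow> y \<in> X \<Longrightarrow> mdist Y (F x) (F y) \<le> 280 * real (Suc q) * d x y"
proof -
  obtain \<rho> where \<rho>0: "\<And>x. x \<in> X \<Longrightarrow> 0 \<le> \<rho> x"
    and \<rho>_le: "\<And>x a. x \<in> X \<Longrightarrow> a \<in> A \<Longrightarrow> \<rho> x \<le> d x a"
    and \<rho>_lip: "\<And>x y. x \<in> X \<Longrightarrow> y \<in> X \<Longrightarrow> \<rho> x \<le> \<rho> y + d x y"
    and \<rho>_less: "\<And>x r. x \<in> X \<Longrightarrow> \<rho> x < r \<Longrightarrow> \<exists>a\<in>A. d x a < r"
    using infdist_exists[OF A] by blast
  define V where "V = X - A"
  have \<rho>pos: "\<rho> x > 0" if "x \<in> V" for x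
    using that closed[of x] \<rho>_less[of x] \<rho>0[of x] unfolding V_def by (metis DiffE less_le not_less)
  have VX: "V \<subseteq> X" by (auto simp: V_def)
  \<comment> \<open>Both orders of the arguments occur because the separation relation must be
    symmetric on the whole type, while \<open>d\<close> is symmetric on \<open>X\<close>
    only.\<close>
  obtain Z where ZV: "Z \<subseteq> V"
    and sep: "\<And>z z'. z \<in> Z \<Longrightarrow> z' \<in> Z \<Longrightarrow> z \<noteq> z' \<Longrightarrow>
      min (\<rho> z) (\<rho> z') / 8 \<le> d z z' \<and> min (\<rho> z) (\<rho> z') / 8 \<le> d z' z"
    and max: "\<And>x. x \<in> V \<Longrightarrow> x \<notin> Z \<Longrightarrow> \<exists>z\<in>Z. \<not> (min (\<rho> x) (\<rho> z) / 8 \<le> d x z \<and> min (\<rho> x) (\<rho> z) / 8 \<le> d z x)"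
    using maximal_separated_subset_exists
      [of "\<lambda>z z'. min (\<rho> z) (\<rho> z') / 8 \<le> d z z' \<and> min (\<rho> z) (\<rho> z') / 8 \<le> d z' z" V]
    by (metis min.commute)
  have ZX: "Z \<subseteq> X" using ZV VX by blast
  have cover: "\<exists>z\<in>Z. d x z < \<rho> z / 8" if x: "x \<in> V" for x
  proof (cases "x \<in> Z")
    case True
    then show ?thesis using \<rho>pos[OF x] refl x VX by (intro bexI[of _ x]) auto
  next
    case False
    then obtain z where z: "z \<in> Z" "\<not> (min (\<rho> x) (\<rho> z) / 8 \<le> d x z \<and> min (\<rho> x) (\<rho> z) / 8 \<le> d z x)"
      using max x by blast
    moreover have "d x z = d z x" using sym x z VX ZX by blast
    ultimately have "d x z < min (\<rho> x) (\<rho> z) / 8" by auto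
    then have "d x z < \<rho> z / 8" by linarith
    then show ?thesis using z by blast
  qed
  have "\<exists>a\<in>A. d z a < 5/4 * \<rho> z" if "z \<in> Z" for z
    using \<rho>_less[of z "5/4 * \<rho> z"] \<rho>pos[of z] that ZV VX by auto
  then obtain a where a: "\<And>z. z \<in> Z \<Longrightarrow> a z \<in> A" "\<And>z. z \<in> Z \<Longrightarrow> d z (a z) < 5/4 * \<rho> z" by metis
  \<comment> \<open>The bump is at least 1 within \<open>\<rho> z / 8\<close>, the radius at which
    the centres cover \<open>V\<close>, and vanishes beyond \<open>\<rho> z / 4\<close>. The former
    makes the normaliser \<open>U x\<close> at least 1.\<close>
  define \<psi> where "\<psi> x z = Max {0, 2 - 8 * d x z / \<rho> z}" for x z
  define K where "K x = {z\<in>Z. \<psi> x z > 0}" for x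
  define U where "U x = (\<Sum>z\<in>K x. \<psi> x z ^ Suc q)" for x
  define \<theta> where "\<theta> x z = \<psi> x z ^ Suc q / U x" for x z
  have \<psi>0: "0 \<le> \<psi> x z" for x z by (simp add: \<psi>_def)
  have Kd: "d x z < \<rho> z / 4" if "z \<in> K x" for x z
    using that \<rho>pos[of z] ZV by (auto simp: K_def \<psi>_def max_def field_simps split: if_splits)
  have KZ: "K x \<subseteq> Z" for x by (auto simp: K_def)
  have notK: "\<psi> x z = 0" if "z \<in> Z" "z \<notin> K x" for x z using that \<psi>0[of x z] by (auto simp: K_def)
  \<comment> \<open>From \<open>d x z < \<rho> z / 4\<close> one gets
    \<open>3/4 * \<rho> z \<le> \<rho> x \<le> 5/4 * \<rho> z\<close>, and \<open>d x (a z)\<close>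
    is at most \<open>(1/4 + 5/4) * \<rho> z\<close>, hence at most
    \<open>2 * \<rho> x\<close>.\<close>
  have K\<rho>: "\<rho> z \<le> 4/3 * \<rho> x" "\<rho> x \<le> 5/4 * \<rho> z" "d x (a z) \<le> 2 * \<rho> x" if x: "x \<in> X" and z: "z \<in> K x" for x z
  proof -
    have zX: "z \<in> X" "a z \<in> X" using z KZ ZX a A by blast+
    show 1: "\<rho> z \<le> 4/3 * \<rho> x" using \<rho>_lip[OF zX(1) x] Kd[OF z] sym[OF zX(1) x] by simp
    show "\<rho> x \<le> 5/4 * \<rho> z" using \<rho>_lip[OF x zX(1)] Kd[OF z] by simp
    have "d x (a z) \<le> d x z + d z (a z)" using triangle x zX by blast
    then show "d x (a z) \<le> 2 * \<rho> x" using Kd[OF z] a(2)[of z] z KZ[of x] 1 by fastforce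
  qed
  have Kfin: "finite (K x)" "card (K x) \<le> 2 ^ q" if x: "x \<in> V" for x
  proof -
    have xX: "x \<in> X" using x VX by blast
    have KX: "K x \<subseteq> X" using KZ ZX by blast
    \<comment> \<open>At scale \<open>\<rho> x / 10\<close>: centres in \<open>K x\<close> are
      separated by \<open>1/8 * 4/5 * \<rho> x = \<rho> x / 10\<close>, and their mutual distance is
      at most \<open>2 * 1/4 * 4/3 * \<rho> x\<close>, which is 20/3 of that scale.\<close>
    have "finite (K x) \<and> card (K x) \<le> 2 ^ q"
    proof (intro packing[rule_format, OF KX, of "\<rho> x / 10"] ballI conjI impI)
      show "0 < \<rho> x / 10" using \<rho>pos[OF x] by simp
      fix z z' assume z: "z \<in> K x" "z' \<in> K x"
      then have X: "z \<in> X" "z' \<in> X" using KX by auto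
      have "d z z' \<le> d x z + d x z'" using triangle[OF X(1) xX X(2)] sym[OF X(1) xX] by simp
      then show "d z z' \<le> 20/3 * (\<rho> x / 10)"
        using Kd[OF z(1)] Kd[OF z(2)] K\<rho>(1)[OF xX z(1)] K\<rho>(1)[OF xX z(2)] by simp
      assume "z \<noteq> z'"
      then have "min (\<rho> z) (\<rho> z') / 8 \<le> d z z'" using sep z KZ by blast
      then show "\<rho> x / 10 \<le> d z z'"
        using K\<rho>(2)[OF xX z(1)] K\<rho>(2)[OF xX z(2)] by (simp add: min_def split: if_splits)
    qed
    then show "finite (K x)" "card (K x) \<le> 2 ^ q" by auto
  qed
  have U1: "1 \<le> U x" if x: "x \<in> V" for x
  proof -
    obtain z where z: "z \<in> Z" "d x z < \<rho> z / 8" using cover[OF x] by blast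
    then have \<psi>1: "\<psi> x z \<ge> 1"
      using \<rho>pos[of z] ZV by (auto simp: \<psi>_def le_max_iff_disj field_simps)
    then have "z \<in> K x" using z by (simp add: K_def)
    then have "\<psi> x z ^ Suc q \<le> U x"
      unfolding U_def using Kfin[OF x] \<psi>0 by (intro member_le_sum) auto
    moreover have "1 \<le> \<psi> x z ^ Suc q" using \<psi>1 by (rule one_le_power)
    ultimately show ?thesis by simp
  qed
  have sum1: "sum (\<theta> x) L = 1" if x: "x \<in> V" and L: "finite L" "K x \<subseteq> L" "L \<subseteq> Z" for x L
  proof -
    have "sum (\<theta> x) L = sum (\<theta> x) (K x)"
      using L notK[of _ x] by (intro sum.mono_neutral_right) (auto simp: \<theta>_def)
    also have "\<dots> = 1" using U1[OF x] unfolding \<theta>_def by (simp add: U_def flip: sum_divide_distrib)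
    finally show ?thesis .
  qed
  have \<theta>0: "0 \<le> \<theta> x z" if "x \<in> V" for x z using U1[OF that] \<psi>0 by (simp add: \<theta>_def)
  have fa: "f (a z) \<in> mspace Y" if "z \<in> Z" for z using a f that by auto
  have "\<exists>b. barycenter_on Y (K x) (\<theta> x) (f \<circ> a) b" if x: "x \<in> V" for x
    using barycenter_exists[OF Y compl Kfin(1)[OF x], of "f \<circ> a" "\<theta> x"] fa KZ \<theta>0[OF x] sum1[OF x Kfin(1)[OF x] _ KZ]
    by (metis comp_apply order_refl subsetD)
  then obtain b where b: "\<And>x. x \<in> V \<Longrightarrow> barycenter_on Y (K x) (\<theta> x) (f \<circ> a) (b x)" by metis
  \<comment> \<open>The weights vanish outside \<open>K x\<close>, so \<open>b x\<close> is also a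
    barycenter over any larger finite index set. This makes \<open>b x\<close> and
    \<open>b y\<close> comparable over the common set \<open>K x \<union> K y\<close>.\<close>
  have bary: "barycenter_on Y L (\<theta> x) (f \<circ> a) (b x)" if x: "x \<in> V" and L: "finite L" "K x \<subseteq> L" "L \<subseteq> Z" for x L
  proof -
    have "(\<Sum>k\<in>L. \<theta> x k * c k) = (\<Sum>k\<in>K x. \<theta> x k * c k)" for c
      using L notK[of _ x] by (intro sum.mono_neutral_right) (auto simp: \<theta>_def)
    then show ?thesis using b[OF x] by (simp add: barycenter_on_def)
  qed
  define F where "F x = (if x \<in> A then f x else b x)" for x
  have FY: "F x \<in> mspace Y" if "x \<in> X" for x
    using that b[of x] f by (auto simp: F_def V_def barycenter_on_def)
  have near: "mdist Y (b x) (f (a z)) \<le> 4 * \<rho> x" if x: "x \<in> V" and z: "z \<in> K x" for x z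
  proof -
    have xX: "x \<in> X" using x VX by blast
    have "mdist Y (b x) ((f \<circ> a) z) \<le> 4 * \<rho> x"
    proof (rule barycenter_dist_point[OF Y Kfin(1)[OF x] _ _ \<theta>0[OF x] sum1[OF x Kfin(1)[OF x] order_refl KZ] b[OF x] z])
      show "(f \<circ> a) k \<in> mspace Y" if "k \<in> K x" for k using fa KZ that by auto
      fix k l assume kl: "k \<in> K x" "l \<in> K x"
      then have X: "a k \<in> A" "a l \<in> A" "a k \<in> X" "a l \<in> X" using a KZ A by blast+
      have "mdist Y (f (a k)) (f (a l)) \<le> d x (a k) + d x (a l)"
        using lip[OF X(1,2)] triangle[OF X(3) xX X(4)] sym[OF X(3) xX] by simp
      then show "mdist Y ((f \<circ> a) k) ((f \<circ> a) l) \<le> 4 * \<rho> x"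
        using K\<rho>(3)[OF xX kl(1)] K\<rho>(3)[OF xX kl(2)] by simp
    qed
    then show ?thesis by simp
  qed
  have Kne: "K x \<noteq> {}" if x: "x \<in> V" for x using sum1[OF x Kfin(1)[OF x] order_refl KZ] by auto
  \<comment> \<open>The constant is 1 + 2 + 4: a direct step, the distance from \<open>y\<close> to
    an almost nearest point \<open>a z\<close>, and the distance from \<open>b y\<close> to
    \<open>f (a z)\<close>, with \<open>\<rho> y \<le> d x y\<close>.\<close>
  have one_in: "mdist Y (F x) (F y) \<le> 7 * d x y" if x: "x \<in> A" and y: "y \<in> V" for x y
  proof -
    obtain z where z: "z \<in> K y" using Kne[OF y] by blast
    have X: "x \<in> X" "y \<in> X" "a z \<in> X" "a z \<in> A" "z \<in> Z" using x y A VX z a KZ by blast+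
    have "mdist Y (f x) (b y) \<le> mdist Y (f x) (f (a z)) + mdist Y (b y) (f (a z))"
      using mdist_triangle[of "f x" Y "f (a z)" "b y"] FY[OF X(1)] FY[OF X(2)] fa[OF X(5)] x y
      by (simp add: F_def V_def mdist_commute)
    also have "\<dots> \<le> d x (a z) + 4 * \<rho> y" using lip x X near[OF y z] by (intro add_mono) auto
    also have "d x (a z) \<le> d x y + d y (a z)" using triangle X by blast
    also have "d y (a z) \<le> 2 * \<rho> y" using K\<rho>(3) X z by blast
    also have "\<rho> y \<le> d x y" using \<rho>_le[OF X(2) x] sym[OF X(1,2)] by simp
    finally show ?thesis using x y by (simp add: F_def V_def)
  qed
  have both_out: "mdist Y (F x) (F y) \<le> 280 * real (Suc q) * d x y"
    if x: "x \<in> V" and y: "y \<in> V" and xy: "\<rho> y \<le> \<rho> x" for x y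
  proof -
    have X: "x \<in> X" "y \<in> X" using x y VX by auto
    have d0: "0 \<le> d x y" using nonneg X by blast
    have q1: "1 * d x y \<le> real (Suc q) * d x y" using d0 by (intro mult_right_mono) auto
    define L where "L = K x \<union> K y"
    have L: "finite L" "K x \<subseteq> L" "K y \<subseteq> L" "L \<subseteq> Z" using Kfin x y KZ by (auto simp: L_def)
    have dL: "mdist Y (f (a k)) (f (a l)) \<le> 4 * \<rho> x + d x y" if kl: "k \<in> L" "l \<in> L" for k l
    proof -
      have aX: "a k \<in> X" "a l \<in> X" "a k \<in> A" "a l \<in> A" using kl L a A by blast+
      have bnd: "d x (a m) \<le> 2 * \<rho> x \<or> d y (a m) \<le> 2 * \<rho> x" if "m \<in> L" for m
        using that K\<rho>(3)[OF X(1)] K\<rho>(3)[OF X(2)] xy unfolding L_def by fastforce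
      have tri: "d (a k) (a l) \<le> d u (a k) + d u v + d v (a l)" if "u \<in> X" "v \<in> X" for u v
        using triangle[OF aX(1) that(1) aX(2)] triangle[OF that(1,2) aX(2)] sym[OF aX(1) that(1)] by simp
      have "d (a k) (a l) \<le> 4 * \<rho> x + d x y"
        using bnd[OF kl(1)] bnd[OF kl(2)] tri[OF X(1,1)] tri[OF X(1,2)] tri[OF X(2,1)] tri[OF X(2,2)]
          refl[OF X(1)] refl[OF X(2)] sym[OF X] d0 by auto
      then show ?thesis using lip[OF aX(3,4)] by linarith
    qed
    show ?thesis
    proof (cases "d x y < \<rho> x / 10")
      \<comment> \<open>Far points: both barycenters are close to some values of \<open>f\<close>,
        and \<open>12 * \<rho> x + d x y \<le> 121 * d x y\<close>.\<close>
      case False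
      obtain z z' where z: "z \<in> K x" "z' \<in> K y" using Kne x y by blast
      have fz: "f (a z) \<in> mspace Y" "f (a z') \<in> mspace Y" using fa z KZ by blast+
      have FF: "F x \<in> mspace Y" "F y \<in> mspace Y" using FY X by auto
      have "mdist Y (F x) (F y) \<le> mdist Y (F x) (f (a z)) + mdist Y (f (a z)) (f (a z')) + mdist Y (F y) (f (a z'))"
        using mdist_triangle[OF FF(1) fz(1) FF(2)] mdist_triangle[OF fz FF(2)] by (simp add: mdist_commute)
      also have "\<dots> \<le> 4 * \<rho> x + (4 * \<rho> x + d x y) + 4 * \<rho> y"
        using near[OF x z(1)] near[OF y z(2)] dL[of z z'] z x y by (intro add_mono) (auto simp: F_def V_def L_def)
      also have "\<dots> \<le> 280 * (1 * d x y)" using False xy d0 by simp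
      also have "\<dots> \<le> 280 * (real (Suc q) * d x y)" using q1 by simp
      finally show ?thesis by (simp add: algebra_simps)
    next
      case True
      \<comment> \<open>Lipschitz bound for the bumps: their slope is \<open>8 / \<rho> k\<close>,
        and \<open>\<rho> k \<ge> 4/5 * \<rho> y \<ge> 18/25 * \<rho> x\<close>; moreover
        \<open>8 / (18/25) = 100/9\<close>.\<close>
      define \<delta> where "\<delta> = 100/9 * d x y / \<rho> x"
      have \<rho>x: "\<rho> x > 0" using \<rho>pos x by blast
      have \<rho>y: "\<rho> y \<ge> 9/10 * \<rho> x" using \<rho>_lip[OF X] True by simp
      have supp: "{k\<in>L. \<psi> v k > 0} = K v" if "K v \<subseteq> L" for v using that L by (auto simp: K_def)
      have UL: "U v = (\<Sum>k\<in>L. \<psi> v k ^ Suc q)" if "K v \<subseteq> L" for v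
        unfolding U_def using L that notK[of _ v] by (intro sum.mono_neutral_left) auto
      have \<delta>: "\<bar>\<psi> x k - \<psi> y k\<bar> \<le> \<delta>" if k: "k \<in> L" for k
      proof -
        have kX: "k \<in> X" and kV: "k \<in> V" using k L ZX ZV by blast+
        have "\<rho> k \<ge> 4/5 * \<rho> y" using k K\<rho>(2)[OF X(1), of k] K\<rho>(2)[OF X(2), of k] xy unfolding L_def by fastforce
        then have \<rho>k: "\<rho> k \<ge> 18/25 * \<rho> x" using \<rho>y by simp
        have "\<bar>\<psi> x k - \<psi> y k\<bar> \<le> \<bar>8 * d x k / \<rho> k - 8 * d y k / \<rho> k\<bar>"
          unfolding \<psi>_def by (auto simp: max_def)
        also have "\<dots> = 8 * \<bar>d x k - d y k\<bar> / \<rho> k"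
        proof -
          have "8 * d x k / \<rho> k - 8 * d y k / \<rho> k = 8 * (d x k - d y k) / \<rho> k"
            by (simp add: diff_divide_distrib)
          then have "\<bar>8 * d x k / \<rho> k - 8 * d y k / \<rho> k\<bar> = \<bar>8 * (d x k - d y k)\<bar> / \<bar>\<rho> k\<bar>"
            by (simp only: abs_divide)
          then show ?thesis using \<rho>pos[OF kV] by (simp only: abs_mult)
        qed
        also have "\<dots> \<le> 8 * d x y / \<rho> k"
          using triangle[OF X(1,2) kX] triangle[OF X(2,1) kX] sym[OF X] \<rho>pos[OF kV]
          by (intro divide_right_mono) auto
        also have "\<dots> \<le> 8 * d x y / (18/25 * \<rho> x)"
          using \<rho>k \<rho>x d0 by (intro divide_left_mono) auto
        also have "\<dots> = \<delta>" by (simp add: \<delta>_def)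
        finally show ?thesis .
      qed
      have diff: "(\<Sum>k\<in>L. \<bar>\<theta> x k - \<theta> y k\<bar>) \<le> 12 * real (Suc q) * \<delta>"
        unfolding \<theta>_def
        by (rule normalized_power_weights_diff[OF L(1) \<psi>0 \<psi>0 q _ _ UL[OF L(2)] UL[OF L(3)] U1[OF x] U1[OF y] \<delta>])
          (use supp[OF L(2)] supp[OF L(3)] Kfin(2) x y in auto)
      have "mdist Y (b x) (b y) \<le> (4 * \<rho> x + d x y) * (\<Sum>k\<in>L. \<bar>\<theta> x k - \<theta> y k\<bar>) / 2"
        by (rule barycenter_dist_le[OF Y L(1), of "f \<circ> a"])
          (use fa L dL x y sum1 bary in auto)
      \<comment> \<open>The values compared have mutual distance at most
        \<open>4 * \<rho> x + d x y \<le> 41/10 * \<rho> x\<close>. The factor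
        \<open>\<rho> x\<close> cancels against the denominator of \<open>\<delta>\<close>.\<close>
      also have "\<dots> \<le> (41/10 * \<rho> x) * (12 * real (Suc q) * \<delta>) / 2"
        using diff True \<rho>x d0 by (intro divide_right_mono mult_mono sum_nonneg) auto
      also have "\<dots> = 820/3 * (real (Suc q) * d x y)" using \<rho>x by (simp add: \<delta>_def field_simps)
      also have "\<dots> \<le> 280 * (real (Suc q) * d x y)" using d0 by (intro mult_right_mono) auto
      finally show ?thesis using x y by (simp add: F_def V_def algebra_simps)
    qed
  qed
  show ?thesis
  proof (rule that[of F])
    show "F \<in> X \<rightarrow> mspace Y" using FY by blast
    show "F x = f x" if "x \<in> A" for x using that by (simp add: F_def)
    fix x y assume X: "x \<in> X" "y \<in> X"
    have d0: "0 \<le> d x y" using nonneg X by blast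
    then have q1: "c * d x y \<le> 280 * real (Suc q) * d x y" if "c \<le> 280" for c
      using that by (intro mult_right_mono) auto
    consider "x \<in> A" "y \<in> A" | "x \<in> A" "y \<in> V" | "x \<in> V" "y \<in> A" | "x \<in> V" "y \<in> V"
      using X by (auto simp: V_def)
    then show "mdist Y (F x) (F y) \<le> 280 * real (Suc q) * d x y"
    proof cases
      case 1 then show ?thesis using lip[of x y] q1[of 1] by (simp add: F_def)
    next
      case 2 then show ?thesis using one_in[of x y] q1[of 7] by simp
    next
      case 3 then show ?thesis using one_in[of y x] q1[of 7] sym[OF X] by (simp add: mdist_commute)
    next
      case 4 then show ?thesis
        using both_out[of x y] both_out[of y x] sym[OF X] by (metis linear mdist_commute)
    qed
  qed
qed

corollary lipschitz_extension_CAT0: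
  assumes Y: "CAT0_space Y" "mcomplete_of Y"
    and A: "A \<subseteq> X" "A \<noteq> {}" and f: "f \<in> A \<rightarrow> mspace Y"
    and lip: "\<And>x y. x \<in> A \<Longrightarrow> y \<in> A \<Longrightarrow> mdist Y (f x) (f y) \<le> d x y"
    and q: "q \<ge> 1"
    and packing: "\<forall>Z\<subseteq>X. \<forall>r>0. (\<forall>z\<in>Z. \<forall>z'\<in>Z. d z z' \<le> 20/3 * r \<and> (z \<noteq> z' \<longrightarrow> r \<le> d z z')) \<longrightarrow>
      finite Z \<and> card Z \<le> 2 ^ q"
  obtains F where "F \<in> X \<rightarrow> mspace Y" "\<And>x. x \<in> A \<Longrightarrow> F x = f x"
    "\<And>x y. x \<in> X \<Longrightarrow> y \<in> X \<Longrightarrow> mdist Y (F x) (F y) \<le> 280 * real (Suc q) * d x y"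
proof -
  obtain B h where B: "A \<subseteq> B" "B \<subseteq> X"
      "\<And>x. x \<in> X \<Longrightarrow> (\<And>e. e > 0 \<Longrightarrow> \<exists>b\<in>B. d x b < e) \<Longrightarrow> x \<in> B"
    and h: "h \<in> B \<rightarrow> mspace Y" "\<And>x. x \<in> A \<Longrightarrow> h x = f x"
      "\<And>x y. x \<in> B \<Longrightarrow> y \<in> B \<Longrightarrow> mdist Y (h x) (h y) \<le> d x y"
    using extend_to_closure[OF Y(2) A f lip] by metis
  have Bne: "B \<noteq> {}" using A B by auto
  obtain F where F: "F \<in> X \<rightarrow> mspace Y" "\<And>x. x \<in> B \<Longrightarrow> F x = h x"
    "\<And>x y. x \<in> X \<Longrightarrow> y \<in> X \<Longrightarrow> mdist Y (F x) (F y) \<le> 280 * real (Suc q) * d x y"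
    using lipschitz_extension_CAT0_closed[OF Y B(2) Bne B(3) h(1,3) q packing] by metis
  show ?thesis by (rule that[OF F(1) _ F(3)]) (use F(2) h(2) B(1) in auto)
qed

end

section \<open>The Riemannian distance is a pseudometric\<close>

lemma C1_curve_on_iff:
  assumes "a < b"
  shows "C1_curve_on X atlas a b \<gamma> \<longleftrightarrow> continuous_map (top_of_set {a..b}) X \<gamma> \<and>
    (\<forall>c\<in>atlas. \<exists>v. continuous_on {t\<in>{a..b}. \<gamma> t \<in> fst c} v \<and>
      (\<forall>t\<in>{a..b}. \<gamma> t \<in> fst c \<longrightarrow> (snd c \<circ> \<gamma> has_vector_derivative v t) (at t within {a..b})))"
    (is "_ \<longleftrightarrow> _ \<and> ?R")
proof -
  let ?D = "\<lambda>c t. vector_derivative (snd c \<circ> \<gamma>) (at t within {a..b})"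
  have "(\<forall>(U, \<psi>)\<in>atlas.
        (\<forall>t\<in>{a..b}. \<gamma> t \<in> U \<longrightarrow> (\<psi> \<circ> \<gamma>) differentiable (at t within {a..b})) \<and>
        continuous_on {t\<in>{a..b}. \<gamma> t \<in> U}
          (\<lambda>t. vector_derivative (\<psi> \<circ> \<gamma>) (at t within {a..b}))) \<longleftrightarrow> ?R" (is "?L \<longleftrightarrow> _")
  proof
    assume L: ?L
    show ?R
    proof (rule ballI, rule exI, rule conjI)
      fix c assume c: "c \<in> atlas"
      then show "continuous_on {t\<in>{a..b}. \<gamma> t \<in> fst c} (?D c)" using L by (auto simp: case_prod_beta)
      show "\<forall>t\<in>{a..b}. \<gamma> t \<in> fst c \<longrightarrow> (snd c \<circ> \<gamma> has_vector_derivative ?D c t) (at t within {a..b})"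
        using L c by (auto simp: case_prod_beta simp flip: vector_derivative_works)
    qed
  next
    assume R: ?R
    have "(\<forall>t\<in>{a..b}. \<gamma> t \<in> fst c \<longrightarrow> (snd c \<circ> \<gamma>) differentiable (at t within {a..b})) \<and>
        continuous_on {t\<in>{a..b}. \<gamma> t \<in> fst c} (?D c)" if c: "c \<in> atlas" for c
    proof -
      obtain v where v: "continuous_on {t\<in>{a..b}. \<gamma> t \<in> fst c} v"
        "\<And>t. t\<in>{a..b} \<Longrightarrow> \<gamma> t \<in> fst c \<Longrightarrow> (snd c \<circ> \<gamma> has_vector_derivative v t) (at t within {a..b})"
        using R c by blast
      \<comment> \<open>Derivatives within a nondegenerate interval are unique, so any witness
        \<open>v\<close> agrees with the derivative that \<open>vector_derivative\<close>
        selects.\<close>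
      have "continuous_on {t\<in>{a..b}. \<gamma> t \<in> fst c} (?D c)"
        using v(1) vector_derivative_within_closed_interval[OF assms _ v(2)]
        by (subst continuous_on_cong[OF HOL.refl, of _ _ v]) auto
      then show ?thesis using v(2) by (blast intro: differentiableI_vector)
    qed
    then show ?L by (auto simp: case_prod_beta)
  qed
  then show ?thesis unfolding C1_curve_on_def by blast
qed

lemma C1_curve_on_cong:
  assumes "a < b" "\<And>t. t \<in> {a..b} \<Longrightarrow> \<gamma> t = \<gamma>' t" "C1_curve_on X atlas a b \<gamma>"
  shows "C1_curve_on X atlas a b \<gamma>'"
proof -
  have "continuous_map (top_of_set {a..b}) X \<gamma>'"
    using assms by (auto simp: C1_curve_on_def intro: continuous_map_eq)
  moreover have "\<exists>v. continuous_on {t\<in>{a..b}. \<gamma>' t \<in> fst c} v \<and>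
      (\<forall>t\<in>{a..b}. \<gamma>' t \<in> fst c \<longrightarrow> (snd c \<circ> \<gamma>' has_vector_derivative v t) (at t within {a..b}))"
    if c: "c \<in> atlas" for c
  proof -
    obtain v where v: "continuous_on {t\<in>{a..b}. \<gamma> t \<in> fst c} v"
      "\<And>t. t\<in>{a..b} \<Longrightarrow> \<gamma> t \<in> fst c \<Longrightarrow> (snd c \<circ> \<gamma> has_vector_derivative v t) (at t within {a..b})"
      using assms(3) c unfolding C1_curve_on_iff[OF assms(1)] by blast
    have eq: "{t\<in>{a..b}. \<gamma>' t \<in> fst c} = {t\<in>{a..b}. \<gamma> t \<in> fst c}" using assms(2) by auto
    have "(snd c \<circ> \<gamma>' has_vector_derivative v t) (at t within {a..b})"
      if "t \<in> {a..b}" "\<gamma>' t \<in> fst c" for t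
      by (rule has_vector_derivative_transform[of t "{a..b}" _ "snd c \<circ> \<gamma>"]) (use that assms(2) v(2) in auto)
    then show ?thesis using v(1) unfolding eq by blast
  qed
  ultimately show ?thesis unfolding C1_curve_on_iff[OF assms(1)] by blast
qed

text \<open>The condition on the image leaves the sign of \<open>m\<close> open, so that rescaling
  and reversal are treated together.\<close>

lemma C1_curve_on_affine:
  assumes "a < b" "\<alpha> < \<beta>" and img: "(\<lambda>s. m * s + e) ` {\<alpha>..\<beta>} = {a..b}"
    and C1: "C1_curve_on X atlas a b \<gamma>"
  shows "C1_curve_on X atlas \<alpha> \<beta> (\<gamma> \<circ> (\<lambda>s. m * s + e))"
  unfolding C1_curve_on_iff[OF assms(2)]
proof (intro conjI ballI)
  let ?h = "\<lambda>s. m * s + e"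
  have h: "continuous_map (top_of_set {\<alpha>..\<beta>}) (top_of_set {a..b}) ?h"
    using img by (auto intro!: continuous_intros)
  show "continuous_map (top_of_set {\<alpha>..\<beta>}) X (\<gamma> \<circ> ?h)"
    by (rule continuous_map_compose[OF h]) (use C1 in \<open>simp add: C1_curve_on_def\<close>)
  fix c assume c: "c \<in> atlas"
  obtain v where v: "continuous_on {t\<in>{a..b}. \<gamma> t \<in> fst c} v"
    "\<And>t. t\<in>{a..b} \<Longrightarrow> \<gamma> t \<in> fst c \<Longrightarrow> (snd c \<circ> \<gamma> has_vector_derivative v t) (at t within {a..b})"
    using C1 c unfolding C1_curve_on_iff[OF assms(1)] by blast
  have hin: "?h s \<in> {a..b}" if "s \<in> {\<alpha>..\<beta>}" for s using img that by blast
  show "\<exists>w. continuous_on {t\<in>{\<alpha>..\<beta>}. (\<gamma> \<circ> ?h) t \<in> fst c} w \<and>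
      (\<forall>t\<in>{\<alpha>..\<beta>}. (\<gamma> \<circ> ?h) t \<in> fst c \<longrightarrow>
        (snd c \<circ> (\<gamma> \<circ> ?h) has_vector_derivative w t) (at t within {\<alpha>..\<beta>}))"
  proof (intro exI conjI ballI impI)
    show "continuous_on {t\<in>{\<alpha>..\<beta>}. (\<gamma> \<circ> ?h) t \<in> fst c} (\<lambda>s. m *\<^sub>R v (?h s))"
      using hin by (intro continuous_intros continuous_on_compose2[OF v(1)]) auto
    fix s assume s: "s \<in> {\<alpha>..\<beta>}" "(\<gamma> \<circ> ?h) s \<in> fst c"
    have "(?h has_vector_derivative m) (at s within {\<alpha>..\<beta>})"
      by (auto intro!: derivative_eq_intros simp: has_vector_derivative_def)
    moreover have "(snd c \<circ> \<gamma> has_vector_derivative v (?h s)) (at (?h s) within ?h ` {\<alpha>..\<beta>})"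
      unfolding img using v(2)[OF hin[OF s(1)]] s by simp
    ultimately show "(snd c \<circ> (\<gamma> \<circ> ?h) has_vector_derivative m *\<^sub>R v (?h s)) (at s within {\<alpha>..\<beta>})"
      unfolding o_assoc by (rule vector_diff_chain_within)
  qed
qed

text \<open>The subdivision of \<open>piecewise_C1_curve\<close> in inductive form with free end
  points, so that properties can be proved piece by piece and curves can be joined.\<close>

inductive piecewise_C1_on ::
  "'x topology \<Rightarrow> ('x, 'e::euclidean_space) chart set \<Rightarrow> (real \<Rightarrow> 'x) \<Rightarrow> real \<Rightarrow> real \<Rightarrow> bool"
  for X atlas \<gamma> where
  empty: "piecewise_C1_on X atlas \<gamma> a a"
| step: "piecewise_C1_on X atlas \<gamma> a b \<Longrightarrow> b < c \<Longrightarrow> C1_curve_on X atlas b c \<gamma> \<Longrightarrow>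
    piecewise_C1_on X atlas \<gamma> a c"

lemma piecewise_C1_on_le: "piecewise_C1_on X atlas \<gamma> a b \<Longrightarrow> a \<le> b"
  by (induction rule: piecewise_C1_on.induct) auto

lemma piecewise_C1_curve_iff: "piecewise_C1_curve X atlas \<gamma> \<longleftrightarrow> piecewise_C1_on X atlas \<gamma> 0 1"
proof
  assume "piecewise_C1_curve X atlas \<gamma>"
  then obtain k t where t: "t 0 = 0" "t k = 1"
    and p: "\<And>i. i < k \<Longrightarrow> t i < t (Suc i) \<and> C1_curve_on X atlas (t i) (t (Suc i)) \<gamma>"
    unfolding piecewise_C1_curve_def by blast
  have "piecewise_C1_on X atlas \<gamma> (t 0) (t i)" if "i \<le> k" for i
    using that by (induction i) (use p in \<open>auto intro: piecewise_C1_on.intros\<close>)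
  from this[of k] show "piecewise_C1_on X atlas \<gamma> 0 1" using t by simp
next
  have "\<exists>k t. t 0 = a \<and> t k = b \<and> (\<forall>i<k. t i < t (Suc i) \<and> C1_curve_on X atlas (t i) (t (Suc i)) \<gamma>)"
    if "piecewise_C1_on X atlas \<gamma> a b" for a b
    using that
  proof (induction rule: piecewise_C1_on.induct)
    case (empty a)
    show ?case by (intro exI[of _ 0] exI[of _ "\<lambda>_. a"]) auto
  next
    case (step a b c)
    then obtain k t where t: "t 0 = a" "t k = b"
      "\<forall>i<k. t i < t (Suc i) \<and> C1_curve_on X atlas (t i) (t (Suc i)) \<gamma>" by blast
    show ?case
      by (intro exI[of _ "Suc k"] exI[of _ "t(Suc k := c)"]) (use t step in \<open>auto simp: less_Suc_eq\<close>)
  qed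
  then show "piecewise_C1_on X atlas \<gamma> 0 1 \<Longrightarrow> piecewise_C1_curve X atlas \<gamma>"
    unfolding piecewise_C1_curve_def by (metis (no_types, lifting))
qed

lemma piecewise_C1_on_trans:
  "piecewise_C1_on X atlas \<gamma> b c \<Longrightarrow> piecewise_C1_on X atlas \<gamma> a b \<Longrightarrow> piecewise_C1_on X atlas \<gamma> a c"
  by (induction rule: piecewise_C1_on.induct) (auto intro: piecewise_C1_on.intros)

lemma piecewise_C1_on_cong:
  assumes "piecewise_C1_on X atlas \<gamma> a b" "\<And>t. t \<in> {a..b} \<Longrightarrow> \<gamma> t = \<gamma>' t"
  shows "piecewise_C1_on X atlas \<gamma>' a b"
  using assms
proof (induction rule: piecewise_C1_on.induct)
  case (step a b c)
  have "a \<le> b" using step piecewise_C1_on_le by blast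
  have "C1_curve_on X atlas b c \<gamma>'"
    by (rule C1_curve_on_cong[OF step.hyps(2) _ step.hyps(3)]) (use step.prems \<open>a \<le> b\<close> in auto)
  moreover have "piecewise_C1_on X atlas \<gamma>' a b"
    by (rule step.IH) (use step.prems step.hyps(2) in auto)
  ultimately show ?case using step.hyps(2) piecewise_C1_on.step by blast
qed (rule piecewise_C1_on.empty)

lemma piecewise_C1_on_affine_pos:
  assumes "piecewise_C1_on X atlas \<gamma> a b" "m > 0"
  shows "piecewise_C1_on X atlas (\<gamma> \<circ> (\<lambda>s. m * s + e)) ((a - e) / m) ((b - e) / m)"
  using assms(1)
proof (induction rule: piecewise_C1_on.induct)
  case (step a b c)
  have lt: "(b - e) / m < (c - e) / m" using step assms by (simp add: divide_strict_right_mono)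
  have "(\<lambda>s. m * s + e) ` {(b - e) / m..(c - e) / m} = {b..c}"
    using assms step lt by (subst image_affinity_atLeastAtMost) auto
  then show ?case
    using step lt by (intro piecewise_C1_on.step[OF step.IH lt] C1_curve_on_affine[of b c]) auto
qed (rule piecewise_C1_on.empty)

lemma piecewise_C1_on_reverse:
  assumes "piecewise_C1_on X atlas \<gamma> a b"
  shows "piecewise_C1_on X atlas (\<gamma> \<circ> (\<lambda>s. - 1 * s + e)) (e - b) (e - a)"
  using assms
proof (induction rule: piecewise_C1_on.induct)
  case (step a b c)
  have "(\<lambda>s. - 1 * s + e) ` {e - c..e - b} = {b..c}"
    using step by (subst image_affinity_atLeastAtMost) auto
  then have "C1_curve_on X atlas (e - c) (e - b) (\<gamma> \<circ> (\<lambda>s. - 1 * s + e))"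
    using step by (intro C1_curve_on_affine[of b c]) auto
  then have "piecewise_C1_on X atlas (\<gamma> \<circ> (\<lambda>s. - 1 * s + e)) (e - c) (e - b)"
    using step by (intro piecewise_C1_on.step[OF piecewise_C1_on.empty]) auto
  then show ?case using piecewise_C1_on_trans[OF step.IH] by blast
qed (rule piecewise_C1_on.empty)

text \<open>The smoothness condition on a piece speaks of derivatives within a closed interval,
  whereas \<open>riemannian_speed\<close> takes the two-sided derivative. They agree away from the
  break points.\<close>

lemma piecewise_C1_on_differentiable:
  assumes "piecewise_C1_on X atlas \<gamma> a b"
  shows "\<exists>E. finite E \<and> (\<forall>t\<in>{a..b} - E. \<forall>c\<in>atlas. \<gamma> t \<in> fst c \<longrightarrow> (snd c \<circ> \<gamma>) differentiable (at t))"
  using assms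
proof (induction rule: piecewise_C1_on.induct)
  case (empty a)
  show ?case by (intro exI[of _ "{a}"]) auto
next
  case (step a b c)
  then obtain E where E: "finite E"
    "\<forall>t\<in>{a..b} - E. \<forall>c\<in>atlas. \<gamma> t \<in> fst c \<longrightarrow> (snd c \<circ> \<gamma>) differentiable (at t)" by blast
  have "(snd ch \<circ> \<gamma>) differentiable (at t)"
    if t: "t \<in> {a..c} - (E \<union> {b, c})" and ch: "ch \<in> atlas" "\<gamma> t \<in> fst ch" for t ch
  proof (cases "t \<le> b")
    case True
    then show ?thesis using E t ch by auto
  next
    case False
    then have "t \<in> {b<..<c}" using t by auto
    moreover have "(snd ch \<circ> \<gamma>) differentiable (at t within {b..c})"
      using step(3) \<open>t \<in> {b<..<c}\<close> ch by (auto simp: C1_curve_on_def case_prod_beta)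
    ultimately show ?thesis by (simp add: at_within_Icc_at)
  qed
  moreover have "finite (E \<union> {b, c})" using E by simp
  ultimately show ?case by blast
qed

text \<open>The condition \<open>a < b\<close> matters, since an empty subdivision says nothing
  about the curve.\<close>

lemma piecewise_C1_on_in_topspace:
  assumes "piecewise_C1_on X atlas \<gamma> a b" "a < b" "t \<in> {a..b}"
  shows "\<gamma> t \<in> topspace X"
proof -
  have "a = b \<or> (\<forall>t\<in>{a..b}. \<gamma> t \<in> topspace X)"
    using assms(1)
  proof (induction rule: piecewise_C1_on.induct)
    case (step a b c)
    have "\<gamma> t \<in> topspace X" if "t \<in> {b..c}" for t
      using step(3) that by (auto simp: C1_curve_on_def continuous_map_def)
    then show ?case using step by (metis atLeastAtMost_iff linear order_antisym)
  qed simp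
  then show ?thesis using assms by auto
qed

lemma riemannian_speed_cong:
  assumes "open S" "s \<in> S" "\<And>t. t \<in> S \<Longrightarrow> \<gamma> t = \<gamma>' t"
  shows "riemannian_speed atlas g \<gamma> s = riemannian_speed atlas g \<gamma>' s"
proof -
  have "vector_derivative (h \<circ> \<gamma>) (at s) = vector_derivative (h \<circ> \<gamma>') (at s)" for h :: "'a \<Rightarrow> 'b"
  proof (rule vector_derivative_cong_eq)
    show "\<forall>\<^sub>F x in nhds s. x \<in> UNIV \<longrightarrow> (h \<circ> \<gamma>) x = (h \<circ> \<gamma>') x"
      using eventually_nhds_in_open[OF assms(1,2)] by eventually_elim (use assms(3) in auto)
  qed auto
  then show ?thesis using assms by (simp add: riemannian_speed_def)
qed

section \<open>Speed of curves in charts, its integrability and its behaviour under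
  reparametrisation\<close>

context riemannian_manifold begin

lemma chart_subset: "c \<in> atlas \<Longrightarrow> fst c \<subseteq> topspace X"
  using chart_domain openin_subset by blast

lemma chart_inj: "c \<in> atlas \<Longrightarrow> inj_on (snd c) (fst c)"
  using homeomorphic_imp_injective_map[OF chart_homeo] chart_subset by (simp add: Int_absorb1)

lemma chart_continuous: "c \<in> atlas \<Longrightarrow> continuous_map (subtopology X (fst c)) euclidean (snd c)"
  using homeomorphic_imp_continuous_map[OF chart_homeo] continuous_map_in_subtopology by blast

lemma chart_inv_continuous:
  assumes c: "c \<in> atlas"
  shows "continuous_map (top_of_set (snd c ` fst c)) X (inv_into (fst c) (snd c))"
proof -
  obtain k where k: "homeomorphic_maps (subtopology X (fst c)) (top_of_set (snd c ` fst c)) (snd c) k"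
    using chart_homeo[OF c] homeomorphic_map_maps by blast
  then have "continuous_map (top_of_set (snd c ` fst c)) X k"
    by (auto simp: homeomorphic_maps_def continuous_map_in_subtopology)
  moreover have "k u = inv_into (fst c) (snd c) u" if u: "u \<in> snd c ` fst c" for u
  proof -
    obtain p where p: "p \<in> fst c" "u = snd c p" using u by blast
    then have "k u = p" using k chart_subset[OF c] by (auto simp: homeomorphic_maps_def)
    then show ?thesis using p chart_inj[OF c] by simp
  qed
  ultimately show ?thesis by (rule continuous_map_eq) auto
qed

lemma some_chart:
  assumes "p \<in> topspace X"
  shows "(SOME c. c \<in> atlas \<and> p \<in> fst c) \<in> atlas" "p \<in> fst (SOME c. c \<in> atlas \<and> p \<in> fst c)"
proof -
  have "\<exists>c. c \<in> atlas \<and> p \<in> fst c" using assms cover by auto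
  from someI_ex[OF this] show "(SOME c. c \<in> atlas \<and> p \<in> fst c) \<in> atlas"
    "p \<in> fst (SOME c. c \<in> atlas \<and> p \<in> fst c)" by auto
qed

lemma g_nonneg: "c \<in> atlas \<Longrightarrow> p \<in> fst c \<Longrightarrow> 0 \<le> g c p v v"
  using g_pos[of c p v] bilinear_lzero[OF g_bilinear, of c p v] by (cases "v = 0") auto

lemma speed_nonneg: "\<gamma> t \<in> topspace X \<Longrightarrow> 0 \<le> riemannian_speed atlas g \<gamma> t"
  unfolding riemannian_speed_def Let_def using some_chart[of "\<gamma> t"] g_nonneg by auto

lemma transition_derivative:
  assumes c: "c \<in> atlas" "c' \<in> atlas" and p: "p \<in> fst c \<inter> fst c'"
  shows "(transition c c' has_derivative frechet_derivative (transition c c') (at (snd c p))) (at (snd c p))"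
proof -
  have "k_times_differentiable_on (Suc 0) (snd c ` (fst c \<inter> fst c')) (transition c c')"
    using transition_smooth[OF c] unfolding smooth_on_def by blast
  then have "transition c c' differentiable (at (snd c p))" using p by auto
  then show ?thesis using frechet_derivative_works by blast
qed

lemma curve_preimage_nbhd:
  assumes "continuous_map (top_of_set T) X \<gamma>" "openin X U" "t \<in> T" "\<gamma> t \<in> U"
  obtains \<epsilon> :: real where "\<epsilon> > 0" "\<And>s. s \<in> T \<Longrightarrow> dist s t < \<epsilon> \<Longrightarrow> \<gamma> s \<in> U"
proof -
  have "openin (top_of_set T) {s\<in>T. \<gamma> s \<in> U}"
    using openin_continuous_map_preimage[OF assms(1,2)] by simp
  then obtain O' where O': "open O'" "{s\<in>T. \<gamma> s \<in> U} = T \<inter> O'" by (auto simp: openin_open)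
  then have "t \<in> O'" using assms by blast
  then obtain \<epsilon> where "\<epsilon> > 0" "\<forall>s. dist s t < \<epsilon> \<longrightarrow> s \<in> O'" using O'(1) by (auto simp: open_dist)
  then show ?thesis using that O'(2) by blast
qed

lemma transition_apply:
  "c \<in> atlas \<Longrightarrow> p \<in> fst c \<Longrightarrow> transition c c' (snd c p) = snd c' p"
  using chart_inj by (simp add: transition_def)

lemma vector_derivative_transition:
  assumes c: "c \<in> atlas" "c' \<in> atlas" and \<gamma>: "continuous_map (top_of_set T) X \<gamma>"
    and t: "t \<in> T" "\<gamma> t \<in> fst c" "\<gamma> t \<in> fst c'"
    and v: "(snd c \<circ> \<gamma> has_vector_derivative v) (at t within T)"
  shows "(snd c' \<circ> \<gamma> has_vector_derivative frechet_derivative (transition c c') (at (snd c (\<gamma> t))) v) (at t within T)"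
proof -
  have D: "(transition c c' has_derivative frechet_derivative (transition c c') (at (snd c (\<gamma> t))))
      (at ((snd c \<circ> \<gamma>) t) within (snd c \<circ> \<gamma>) ` T)"
    using transition_derivative[OF c, of "\<gamma> t"] t by (auto intro: has_derivative_at_withinI)
  obtain \<epsilon> where e: "\<epsilon> > 0" "\<And>s. s \<in> T \<Longrightarrow> dist s t < \<epsilon> \<Longrightarrow> \<gamma> s \<in> fst c"
    using curve_preimage_nbhd[OF \<gamma> chart_domain[OF c(1)] t(1,2)] by blast
  show ?thesis
    using vector_derivative_diff_chain_within[OF v D] e(1) t(1)
    by (rule has_vector_derivative_transform_within) (use e(2) c transition_apply in auto)
qed

lemma g_expand:
  assumes "c \<in> atlas" "p \<in> fst c"
  shows "g c p v w = (\<Sum>(i, j)\<in>Basis \<times> Basis. (v \<bullet> i) * (w \<bullet> j) * g c p i j)"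
proof -
  have bl: "bilinear (g c p)" using g_bilinear assms by blast
  have "g c p v w = g c p (\<Sum>i\<in>Basis. (v \<bullet> i) *\<^sub>R i) (\<Sum>j\<in>Basis. (w \<bullet> j) *\<^sub>R j)"
    by (simp add: euclidean_representation)
  also have "\<dots> = (\<Sum>(i, j)\<in>Basis \<times> Basis. g c p ((v \<bullet> i) *\<^sub>R i) ((w \<bullet> j) *\<^sub>R j))"
    by (rule bilinear_sum[OF bl])
  also have "\<dots> = (\<Sum>(i, j)\<in>Basis \<times> Basis. (v \<bullet> i) * (w \<bullet> j) * g c p i j)"
    by (intro sum.cong) (auto simp: bilinear_lmul[OF bl] bilinear_rmul[OF bl])
  finally show ?thesis .
qed

text \<open>Smoothness of \<open>g\<close> is given for fixed vectors, so continuity with moving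
  vectors is obtained from the expansion in a basis.\<close>

lemma continuous_on_g_along:
  fixes T :: "real set"
  assumes c: "c \<in> atlas" and \<gamma>: "continuous_map (top_of_set T) X \<gamma>" "\<And>t. t \<in> T \<Longrightarrow> \<gamma> t \<in> fst c"
    and v: "continuous_on T v" "continuous_on T w"
  shows "continuous_on T (\<lambda>t. g c (\<gamma> t) (v t) (w t))"
proof -
  have "continuous_map (top_of_set T) (subtopology X (fst c)) \<gamma>"
    using \<gamma> by (intro continuous_map_into_subtopology) auto
  then have cg: "continuous_on T (snd c \<circ> \<gamma>)"
    using continuous_map_compose[OF _ chart_continuous[OF c]] by fastforce
  have "continuous_on T (\<lambda>t. g c (\<gamma> t) i j)" for i j
  proof -
    have "k_times_differentiable_on 0 (snd c ` fst c) (\<lambda>u. g c (inv_into (fst c) (snd c) u) i j)"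
      using g_smooth[OF c] unfolding smooth_on_def by blast
    then have "continuous_on (snd c ` fst c) (\<lambda>u. g c (inv_into (fst c) (snd c) u) i j)" by simp
    then have "continuous_on T (\<lambda>t. g c (inv_into (fst c) (snd c) ((snd c \<circ> \<gamma>) t)) i j)"
      by (rule continuous_on_compose2[OF _ cg]) (use \<gamma> in auto)
    then show ?thesis
      using chart_inj[OF c] \<gamma>(2) by (subst continuous_on_cong[OF HOL.refl]) auto
  qed
  then have "continuous_on T (\<lambda>t. \<Sum>(i, j)\<in>Basis \<times> Basis. (v t \<bullet> i) * (w t \<bullet> j) * g c (\<gamma> t) i j)"
    using v by (auto simp: case_prod_beta intro!: continuous_intros)
  then show ?thesis
    by (subst continuous_on_cong[OF HOL.refl g_expand]) (use c \<gamma> in auto)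
qed

text \<open>The chart selected in \<open>riemannian_speed\<close> may jump with \<open>t\<close>.
  The transformation rule makes the value \<open>\<sigma>\<close> independent of the chart, so near
  each \<open>t\<close> it may be computed in one fixed chart, where it is continuous.\<close>

lemma speed_integrable_C1:
  assumes ab: "a < b" and C1: "C1_curve_on X atlas a b \<gamma>"
  shows "riemannian_speed atlas g \<gamma> integrable_on {a..b}"
proof -
  let ?I = "{a..b}"
  have \<gamma>: "continuous_map (top_of_set ?I) X \<gamma>" using C1 by (simp add: C1_curve_on_def)
  have top: "\<gamma> t \<in> topspace X" if "t \<in> ?I" for t using \<gamma> that by (auto simp: continuous_map_def)
  have "\<forall>c\<in>atlas. \<exists>v. continuous_on {t\<in>?I. \<gamma> t \<in> fst c} v \<and>
      (\<forall>t\<in>?I. \<gamma> t \<in> fst c \<longrightarrow> (snd c \<circ> \<gamma> has_vector_derivative v t) (at t within ?I))"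
    using C1 unfolding C1_curve_on_iff[OF ab] by (rule conjunct2)
  from bchoice[OF this] obtain v where vcont: "\<And>c. c \<in> atlas \<Longrightarrow> continuous_on {t\<in>?I. \<gamma> t \<in> fst c} (v c)"
    and v: "\<And>c t. c \<in> atlas \<Longrightarrow> t \<in> ?I \<Longrightarrow> \<gamma> t \<in> fst c \<Longrightarrow> (snd c \<circ> \<gamma> has_vector_derivative v c t) (at t within ?I)"
    by blast
  define \<sigma> where "\<sigma> c t = sqrt (g c (\<gamma> t) (v c t) (v c t))" for c t
  define ch where "ch t = (SOME c. c \<in> atlas \<and> \<gamma> t \<in> fst c)" for t
  have ch: "ch t \<in> atlas" "\<gamma> t \<in> fst (ch t)" if "t \<in> ?I" for t
    using some_chart[OF top[OF that]] by (auto simp: ch_def)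
  have indep: "\<sigma> c t = \<sigma> c' t" if c: "c \<in> atlas" "c' \<in> atlas" and t: "t \<in> ?I" "\<gamma> t \<in> fst c" "\<gamma> t \<in> fst c'" for c c' t
  proof -
    have "(snd c' \<circ> \<gamma> has_vector_derivative frechet_derivative (transition c c') (at (snd c (\<gamma> t))) (v c t)) (at t within ?I)"
      by (rule vector_derivative_transition[OF c \<gamma> t v]) (use c t in auto)
    then have "v c' t = frechet_derivative (transition c c') (at (snd c (\<gamma> t))) (v c t)"
      using v[OF c(2) t(1,3)] vector_derivative_within_closed_interval[OF ab t(1)] by metis
    then show ?thesis using g_transition[OF c, of "\<gamma> t"] t by (simp add: \<sigma>_def)
  qed
  have "continuous_on ?I (\<lambda>t. \<sigma> (ch t) t)"
    unfolding continuous_on_eq_continuous_within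
  proof
    fix t assume t: "t \<in> ?I"
    let ?c = "ch t"
    let ?T = "{s\<in>?I. \<gamma> s \<in> fst ?c}"
    have "continuous_on ?T (\<sigma> ?c)"
      unfolding \<sigma>_def
    proof (intro continuous_intros continuous_on_g_along ch(1)[OF t])
      show "continuous_map (top_of_set ?T) X \<gamma>"
        by (rule continuous_map_from_subtopology_mono[OF \<gamma>]) blast
    qed (use vcont ch(1)[OF t] in auto)
    then have "continuous_on ?T (\<lambda>s. \<sigma> (ch s) s)"
      by (rule continuous_on_eq) (use indep ch t in auto)
    then have "continuous (at t within ?T) (\<lambda>s. \<sigma> (ch s) s)"
      using t ch by (auto simp: continuous_on_eq_continuous_within)
    moreover obtain \<epsilon> where e: "\<epsilon> > 0" "\<And>s. s \<in> ?I \<Longrightarrow> dist s t < \<epsilon> \<Longrightarrow> \<gamma> s \<in> fst ?c"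
      using curve_preimage_nbhd[OF \<gamma> chart_domain[OF ch(1)[OF t]] t ch(2)[OF t]] by blast
    moreover have "at t within ?T = at t within ?I"
      by (rule at_within_nhd[of t "ball t \<epsilon>"]) (use e in \<open>auto simp: dist_commute\<close>)
    ultimately show "continuous (at t within ?I) (\<lambda>s. \<sigma> (ch s) s)" by simp
  qed
  then have "(\<lambda>t. \<sigma> (ch t) t) integrable_on ?I" by (rule integrable_continuous_real)
  then show ?thesis
  proof (rule integrable_spike_finite[of "{a, b}", rotated 2])
    \<comment> \<open>The end points are excluded because the two-sided derivative there is not
      determined by the piece.\<close>
    fix t assume t: "t \<in> ?I - {a, b}"
    then have "(snd (ch t) \<circ> \<gamma> has_vector_derivative v (ch t) t) (at t)"
      using v[of "ch t" t] ch[of t] by (simp add: at_within_Icc_at)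
    then have "vector_derivative (snd (ch t) \<circ> \<gamma>) (at t) = v (ch t) t" by (rule vector_derivative_at)
    then show "riemannian_speed atlas g \<gamma> t = \<sigma> (ch t) t"
      by (simp add: riemannian_speed_def \<sigma>_def Let_def flip: ch_def)
  qed simp
qed

lemma speed_integrable:
  assumes "piecewise_C1_on X atlas \<gamma> a b"
  shows "riemannian_speed atlas g \<gamma> integrable_on {a..b}"
  using assms
proof (induction rule: piecewise_C1_on.induct)
  case (step a b c)
  have "riemannian_speed atlas g \<gamma> integrable_on {b..c}" using speed_integrable_C1 step by blast
  then show ?case
    using step piecewise_C1_on_le[OF step(1)] by (intro Henstock_Kurzweil_Integration.integrable_combine[of a b c]) auto
next
  case (empty a)
  show ?case using integrable_on_refl[of "riemannian_speed atlas g \<gamma>" a] unfolding box_real .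
qed

lemma speed_affine:
  assumes top: "\<gamma> (m * s + e) \<in> topspace X"
    and diff: "\<forall>c\<in>atlas. \<gamma> (m * s + e) \<in> fst c \<longrightarrow> (snd c \<circ> \<gamma>) differentiable (at (m * s + e))"
  shows "riemannian_speed atlas g (\<gamma> \<circ> (\<lambda>s. m * s + e)) s = \<bar>m\<bar> * riemannian_speed atlas g \<gamma> (m * s + e)"
proof -
  let ?t = "m * s + e"
  define c where "c = (SOME c. c \<in> atlas \<and> \<gamma> ?t \<in> fst c)"
  have c: "c \<in> atlas" "\<gamma> ?t \<in> fst c" using some_chart[OF top] by (auto simp: c_def)
  define v where "v = vector_derivative (snd c \<circ> \<gamma>) (at ?t)"
  have "(snd c \<circ> \<gamma> has_vector_derivative v) (at ?t)"
    using diff c by (simp add: v_def flip: vector_derivative_works)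
  moreover have "((\<lambda>s. m * s + e) has_vector_derivative m) (at s)"
    by (auto intro!: derivative_eq_intros simp: has_vector_derivative_def)
  ultimately have "((snd c \<circ> \<gamma>) \<circ> (\<lambda>s. m * s + e) has_vector_derivative m *\<^sub>R v) (at s)"
    by (intro vector_diff_chain_at) auto
  then have "vector_derivative (snd c \<circ> (\<gamma> \<circ> (\<lambda>s. m * s + e))) (at s) = m *\<^sub>R v"
    by (simp add: vector_derivative_at o_assoc)
  moreover have "g c (\<gamma> ?t) (m *\<^sub>R v) (m *\<^sub>R v) = m\<^sup>2 * g c (\<gamma> ?t) v v"
    using bilinear_lmul[OF g_bilinear[OF c]] bilinear_rmul[OF g_bilinear[OF c]]
    by (simp add: power2_eq_square)
  ultimately show ?thesis
    by (simp add: riemannian_speed_def real_sqrt_mult flip: c_def v_def)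
qed

text \<open>Invariance of length under affine reparametrisation: the factor
  \<open>\<bar>m\<bar>\<close> of the speed cancels the one from the substitution. Break points pull
  back to a finite set, which the integral ignores.\<close>

lemma has_integral_speed_affine:
  assumes pc: "piecewise_C1_on X atlas \<gamma> a b" and ab: "a < b" and m: "m \<noteq> 0"
    and int: "(riemannian_speed atlas g \<gamma> has_integral l) {a..b}"
    and img: "(\<lambda>x. (1 / m) * x + - ((1 / m) * e)) ` {a..b} = {\<alpha>..\<beta>}"
  shows "(riemannian_speed atlas g (\<gamma> \<circ> (\<lambda>s. m * s + e)) has_integral l) {\<alpha>..\<beta>}"
proof -
  obtain E where E: "finite E"
    "\<forall>t\<in>{a..b} - E. \<forall>c\<in>atlas. \<gamma> t \<in> fst c \<longrightarrow> (snd c \<circ> \<gamma>) differentiable (at t)"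
    using piecewise_C1_on_differentiable[OF pc] by blast
  have "((\<lambda>s. riemannian_speed atlas g \<gamma> (m * s + e)) has_integral (1 / \<bar>m\<bar>) * l) {\<alpha>..\<beta>}"
    using has_integral_affinity[of "riemannian_speed atlas g \<gamma>" l a b m e] int m img by simp
  then have "((\<lambda>s. \<bar>m\<bar> * riemannian_speed atlas g \<gamma> (m * s + e)) has_integral \<bar>m\<bar> * ((1 / \<bar>m\<bar>) * l)) {\<alpha>..\<beta>}"
    by (rule has_integral_mult_right)
  then have *: "((\<lambda>s. \<bar>m\<bar> * riemannian_speed atlas g \<gamma> (m * s + e)) has_integral l) {\<alpha>..\<beta>}"
    using m by simp
  show ?thesis
  proof (rule has_integral_spike_finite[OF _ _ *])
    show "finite ((\<lambda>s. m * s + e) -` E)"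
      using E(1) m by (intro finite_vimageI) (auto simp: inj_on_def)
    fix s assume s: "s \<in> {\<alpha>..\<beta>} - (\<lambda>s. m * s + e) -` E"
    then obtain x where "x \<in> {a..b}" "s = (1 / m) * x + - ((1 / m) * e)" using img by blast
    then have "m * s + e = x" using m by (simp add: field_simps)
    then have "m * s + e \<in> {a..b} - E" using \<open>x \<in> {a..b}\<close> s by auto
    then show "riemannian_speed atlas g (\<gamma> \<circ> (\<lambda>s. m * s + e)) s = \<bar>m\<bar> * riemannian_speed atlas g \<gamma> (m * s + e)"
      using E(2) piecewise_C1_on_in_topspace[OF pc ab] by (intro speed_affine) auto
  qed
qed

section \<open>Reversal, concatenation and existence of curves between two points\<close>

definition curves :: "'x \<Rightarrow> 'x \<Rightarrow> (real \<Rightarrow> 'x) set" where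
  "curves p q = {\<gamma>. piecewise_C1_on X atlas \<gamma> 0 1 \<and> \<gamma> 0 = p \<and> \<gamma> 1 = q}"

lemma riemannian_dist_eq:
  "riemannian_dist X atlas g p q = Inf (riemannian_length atlas g ` curves p q)"
  unfolding riemannian_dist_def curves_def piecewise_C1_curve_iff by (rule arg_cong[of _ _ Inf]) auto

lemma length_has_integral:
  "\<gamma> \<in> curves p q \<Longrightarrow> (riemannian_speed atlas g \<gamma> has_integral riemannian_length atlas g \<gamma>) {0..1}"
  unfolding curves_def riemannian_length_def using speed_integrable by (auto simp: integrable_integral)

lemma length_nonneg: "\<gamma> \<in> curves p q \<Longrightarrow> 0 \<le> riemannian_length atlas g \<gamma>"
  by (rule has_integral_nonneg[OF length_has_integral])
    (auto simp: curves_def intro!: speed_nonneg piecewise_C1_on_in_topspace[of X atlas _ 0 1])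

lemma curves_reverse:
  assumes \<gamma>: "\<gamma> \<in> curves p q"
  obtains \<eta> where "\<eta> \<in> curves q p" "riemannian_length atlas g \<eta> = riemannian_length atlas g \<gamma>"
proof -
  let ?\<eta> = "\<gamma> \<circ> (\<lambda>s. - 1 * s + 1)"
  have pc: "piecewise_C1_on X atlas \<gamma> 0 1" using \<gamma> by (simp add: curves_def)
  have "?\<eta> \<in> curves q p"
    using piecewise_C1_on_reverse[OF pc, of 1] \<gamma> by (simp add: curves_def)
  moreover have "(\<lambda>x::real. (1 / - 1) * x + - ((1 / - 1) * 1)) ` {0..1} = {0..1}"
    by (subst image_affinity_atLeastAtMost) auto
  then have "(riemannian_speed atlas g ?\<eta> has_integral riemannian_length atlas g \<gamma>) {0..1}"
    by (intro has_integral_speed_affine[OF pc _ _ length_has_integral[OF \<gamma>]]) auto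
  then have "riemannian_length atlas g ?\<eta> = riemannian_length atlas g \<gamma>"
    unfolding riemannian_length_def by (rule integral_unique)
  ultimately show ?thesis using that by blast
qed

lemma curves_concat:
  assumes \<gamma>: "\<gamma> \<in> curves p q" and \<eta>: "\<eta> \<in> curves q r"
  obtains \<kappa> where "\<kappa> \<in> curves p r"
    "riemannian_length atlas g \<kappa> = riemannian_length atlas g \<gamma> + riemannian_length atlas g \<eta>"
proof -
  let ?l = "riemannian_length atlas g" and ?s = "riemannian_speed atlas g"
  define \<kappa> where "\<kappa> t = (if t \<le> 1/2 then (\<gamma> \<circ> (\<lambda>s. 2 * s + 0)) t else (\<eta> \<circ> (\<lambda>s. 2 * s + - 1)) t)" for t
  have pc: "piecewise_C1_on X atlas \<gamma> 0 1" "piecewise_C1_on X atlas \<eta> 0 1"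
    and ends: "\<gamma> 0 = p" "\<gamma> 1 = q" "\<eta> 0 = q" "\<eta> 1 = r"
    using \<gamma> \<eta> by (auto simp: curves_def)
  have "piecewise_C1_on X atlas (\<gamma> \<circ> (\<lambda>s. 2 * s + 0)) 0 (1/2)"
    using piecewise_C1_on_affine_pos[OF pc(1), of 2 0] by simp
  then have "piecewise_C1_on X atlas \<kappa> 0 (1/2)"
    by (rule piecewise_C1_on_cong) (simp add: \<kappa>_def)
  moreover have "piecewise_C1_on X atlas (\<eta> \<circ> (\<lambda>s. 2 * s + - 1)) (1/2) 1"
    using piecewise_C1_on_affine_pos[OF pc(2), of 2 "- 1"] by simp
  then have "piecewise_C1_on X atlas \<kappa> (1/2) 1"
  proof (rule piecewise_C1_on_cong)
    fix t :: real assume "t \<in> {1/2..1}"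
    then consider "t = 1/2" | "t > 1/2" by force
    then show "(\<eta> \<circ> (\<lambda>s. 2 * s + - 1)) t = \<kappa> t"
    proof cases
      case 1
      show ?thesis unfolding 1 using ends by (simp add: \<kappa>_def)
    qed (simp add: \<kappa>_def)
  qed
  ultimately have "piecewise_C1_on X atlas \<kappa> 0 1" using piecewise_C1_on_trans by blast
  then have \<kappa>: "\<kappa> \<in> curves p r" using ends by (simp add: curves_def \<kappa>_def)
  have "(?s (\<gamma> \<circ> (\<lambda>s. 2 * s + 0)) has_integral ?l \<gamma>) {0..1/2}"
    by (rule has_integral_speed_affine[OF pc(1) _ _ length_has_integral[OF \<gamma>]])
      (auto simp: image_affinity_atLeastAtMost_div)
  then have 1: "(?s \<kappa> has_integral ?l \<gamma>) {0..1/2}"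
  proof (rule has_integral_spike_finite[of "{1/2}", rotated 2])
    fix t :: real assume "t \<in> {0..1/2} - {1/2}"
    then show "?s \<kappa> t = ?s (\<gamma> \<circ> (\<lambda>s. 2 * s + 0)) t"
      by (intro riemannian_speed_cong[of "{..<1/2}"]) (auto simp: \<kappa>_def)
  qed simp
  have img: "(\<lambda>x::real. (1 / 2) * x + - ((1 / 2) * - 1)) ` {0..1} = {1/2..1}"
    by (subst image_affinity_atLeastAtMost) auto
  have "(?s (\<eta> \<circ> (\<lambda>s. 2 * s + - 1)) has_integral ?l \<eta>) {1/2..1}"
    by (rule has_integral_speed_affine[OF pc(2) _ _ length_has_integral[OF \<eta>] img]) auto
  then have 2: "(?s \<kappa> has_integral ?l \<eta>) {1/2..1}"
  proof (rule has_integral_spike_finite[of "{1/2}", rotated 2])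
    fix t :: real assume "t \<in> {1/2..1} - {1/2}"
    then show "?s \<kappa> t = ?s (\<eta> \<circ> (\<lambda>s. 2 * s + - 1)) t"
      by (intro riemannian_speed_cong[of "{1/2<..}"]) (auto simp: \<kappa>_def)
  qed simp
  have "(?s \<kappa> has_integral ?l \<gamma> + ?l \<eta>) {0..1}"
    by (rule has_integral_combine[OF _ _ 1 2]) auto
  then have "?l \<kappa> = ?l \<gamma> + ?l \<eta>" unfolding riemannian_length_def[of _ _ \<kappa>] by (rule integral_unique)
  then show ?thesis using that \<kappa> by blast
qed

lemma curves_const:
  assumes p: "p \<in> topspace X"
  shows "(\<lambda>_. p) \<in> curves p p" "riemannian_length atlas g (\<lambda>_. p) = 0"
proof -
  have "C1_curve_on X atlas 0 1 (\<lambda>_. p)"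
    unfolding C1_curve_on_iff[OF zero_less_one]
    by (auto simp: p o_def intro!: exI[of _ "\<lambda>_. 0"])
  then show "(\<lambda>_. p) \<in> curves p p"
    by (auto simp: curves_def intro: piecewise_C1_on.intros)
  have "riemannian_speed atlas g (\<lambda>_. p) t = 0" for t
    using bilinear_lzero[OF g_bilinear[OF some_chart[OF p]]]
    by (simp add: riemannian_speed_def o_def)
  then show "riemannian_length atlas g (\<lambda>_. p) = 0"
    unfolding riemannian_length_def by (intro integral_unique has_integral_is_0) auto
qed

text \<open>A coordinate segment has to be \<open>C1\<close> in every chart of the atlas, not only
  in its own. This follows from the chain rule and the continuity of the derivatives of transition
  maps.\<close>

lemma chart_segment_curve:
  assumes c: "c \<in> atlas" and seg: "closed_segment u0 u1 \<subseteq> snd c ` fst c"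
  shows "curves (inv_into (fst c) (snd c) u0) (inv_into (fst c) (snd c) u1) \<noteq> {}"
proof -
  let ?inv = "inv_into (fst c) (snd c)"
  let ?l = "\<lambda>t::real. u0 + t *\<^sub>R (u1 - u0)"
  let ?\<gamma> = "?inv \<circ> ?l"
  have l: "?l t \<in> snd c ` fst c" if "t \<in> {0..1}" for t
    using seg that by (force simp: closed_segment_def algebra_simps)
  have \<gamma>in: "?\<gamma> t \<in> fst c" "snd c (?\<gamma> t) = ?l t" if "t \<in> {0..1}" for t
    using l[OF that] by (auto simp: inv_into_into f_inv_into_f)
  have cont: "continuous_map (top_of_set {0..1}) X ?\<gamma>"
  proof (rule continuous_map_compose[OF _ chart_inv_continuous[OF c]])
    show "continuous_map (top_of_set {0..1}) (top_of_set (snd c ` fst c)) ?l"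
      using l by (auto intro!: continuous_intros)
  qed
  have der: "(snd c \<circ> ?\<gamma> has_vector_derivative (u1 - u0)) (at t within {0..1})" if t: "t \<in> {0..1}" for t
  proof (rule has_vector_derivative_transform[OF t])
    show "(?l has_vector_derivative (u1 - u0)) (at t within {0..1})"
      by (auto intro!: derivative_eq_intros)
  qed (use \<gamma>in in auto)
  have "C1_curve_on X atlas 0 1 ?\<gamma>"
    unfolding C1_curve_on_iff[OF zero_less_one]
  proof (intro conjI cont ballI exI impI)
    fix c' assume c': "c' \<in> atlas"
    let ?v = "\<lambda>t. frechet_derivative (transition c c') (at (snd c (?\<gamma> t))) (u1 - u0)"
    show "(snd c' \<circ> ?\<gamma> has_vector_derivative ?v t) (at t within {0..1})"
      if "t \<in> {0..1}" "?\<gamma> t \<in> fst c'" for t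
      using vector_derivative_transition[OF c c' cont that(1) \<gamma>in(1)[OF that(1)] that(2) der[OF that(1)]] .
    let ?T = "{t \<in> {0..1}. ?\<gamma> t \<in> fst c'}"
    have "k_times_differentiable_on (Suc 0) (snd c ` (fst c \<inter> fst c')) (transition c c')"
      using transition_smooth[OF c c'] unfolding smooth_on_def by blast
    then have "continuous_on (snd c ` (fst c \<inter> fst c'))
        (\<lambda>x. frechet_derivative (transition c c') (at x) (u1 - u0))" by simp
    then show "continuous_on ?T ?v"
    proof (rule continuous_on_compose2)
      show "continuous_on ?T (\<lambda>t. snd c (?\<gamma> t))"
        by (rule continuous_on_eq[of _ ?l]) (use \<gamma>in in \<open>auto intro!: continuous_intros\<close>)
      show "(\<lambda>t. snd c (?\<gamma> t)) ` ?T \<subseteq> snd c ` (fst c \<inter> fst c')"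
        using \<gamma>in(1) by blast
    qed
  qed
  then have "piecewise_C1_on X atlas ?\<gamma> 0 1"
    by (auto intro: piecewise_C1_on.intros)
  then have "?\<gamma> \<in> curves (?inv u0) (?inv u1)" by (simp add: curves_def)
  then show ?thesis by blast
qed

text \<open>The set of points reachable from \<open>p\<close> is open and closed, since coordinate
  balls are joined to their centres by segments. Without it the infimum defining the distance would
  range over the empty set.\<close>

lemma curves_nonempty:
  assumes conn: "connected_space X" and p: "p \<in> topspace X" and q: "q \<in> topspace X"
  shows "curves p q \<noteq> {}"
proof -
  define R where "R = {q\<in>topspace X. curves p q \<noteq> {}}"
  have nbhd: "\<exists>W. openin X W \<and> x \<in> W \<and> (\<forall>y\<in>W. curves x y \<noteq> {})" if x: "x \<in> topspace X" for x
  proof -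
    obtain c where c: "c \<in> atlas" "x \<in> fst c" using x cover by auto
    obtain r where r: "r > 0" "ball (snd c x) r \<subseteq> snd c ` fst c"
      using chart_range[OF c(1)] c(2) by (meson imageI open_contains_ball)
    let ?W = "{y \<in> topspace (subtopology X (fst c)). snd c y \<in> ball (snd c x) r}"
    have "openin (subtopology X (fst c)) ?W"
      by (rule openin_continuous_map_preimage[OF chart_continuous[OF c(1)]]) simp
    then have "openin X ?W" using chart_domain[OF c(1)] openin_trans_full by blast
    moreover have "x \<in> ?W" using x c r by simp
    moreover have "curves x y \<noteq> {}" if y: "y \<in> ?W" for y
    proof -
      have "closed_segment (snd c x) (snd c y) \<subseteq> ball (snd c x) r"
        using y r by (intro closed_segment_subset) auto
      then have "curves (inv_into (fst c) (snd c) (snd c x)) (inv_into (fst c) (snd c) (snd c y)) \<noteq> {}"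
        using r by (intro chart_segment_curve[OF c(1)]) auto
      then show ?thesis using chart_inj[OF c(1)] c y by simp
    qed
    ultimately show ?thesis by blast
  qed
  have step: "curves p y \<noteq> {}" if "curves p x \<noteq> {}" "curves x y \<noteq> {}" for x y
    using that curves_concat by (metis ex_in_conv)
  have rev: "curves y x \<noteq> {}" if "curves x y \<noteq> {}" for x y
    using that curves_reverse by (metis ex_in_conv)
  have "openin X R"
  proof (subst openin_subopen, intro ballI)
    fix x assume x: "x \<in> R"
    then obtain W where W: "openin X W" "x \<in> W" "\<forall>y\<in>W. curves x y \<noteq> {}" using nbhd by (auto simp: R_def)
    then have "W \<subseteq> R" using x step openin_subset[OF W(1)] by (auto simp: R_def)
    then show "\<exists>T. openin X T \<and> x \<in> T \<and> T \<subseteq> R" using W by blast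
  qed
  moreover have "openin X (topspace X - R)"
  proof (subst openin_subopen, intro ballI)
    fix x assume x: "x \<in> topspace X - R"
    then obtain W where W: "openin X W" "x \<in> W" "\<forall>y\<in>W. curves x y \<noteq> {}" using nbhd by auto
    have "y \<notin> R" if "y \<in> W" for y
    proof
      assume "y \<in> R"
      then have "curves p x \<noteq> {}" using step[of y x] rev[of x y] W(3) that by (simp add: R_def)
      then show False using x by (simp add: R_def)
    qed
    then have "W \<subseteq> topspace X - R" using openin_subset[OF W(1)] by blast
    then show "\<exists>T. openin X T \<and> x \<in> T \<and> T \<subseteq> topspace X - R" using W by blast
  qed
  moreover have "p \<in> R" using curves_const[OF p] p by (auto simp: R_def)
  ultimately have "topspace X - R = {}"
    using conn unfolding connected_space_def by (metis Diff_disjoint Un_Diff_cancel Un_upper2 empty_iff)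
  then show ?thesis using q by (auto simp: R_def)
qed

end

lemma (in riemannian_manifold) pseudometric_riemannian_dist:
  assumes conn: "connected_space X"
  shows "pseudometric (topspace X) (riemannian_dist X atlas g)"
proof
  let ?d = "riemannian_dist X atlas g" and ?l = "riemannian_length atlas g"
  have lower: "?d p q \<le> ?l \<gamma>" if "\<gamma> \<in> curves p q" for p q \<gamma>
    unfolding riemannian_dist_eq
    by (rule cInf_lower) (use that length_nonneg in \<open>auto intro!: bdd_belowI[of _ 0]\<close>)
  have greatest: "z \<le> ?d p q" if "p \<in> topspace X" "q \<in> topspace X" "\<And>\<gamma>. \<gamma> \<in> curves p q \<Longrightarrow> z \<le> ?l \<gamma>" for p q z
    unfolding riemannian_dist_eq by (rule cInf_greatest) (use that curves_nonempty[OF conn] in auto)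
  show "0 \<le> ?d x y" if "x \<in> topspace X" "y \<in> topspace X" for x y
    using greatest[OF that] length_nonneg by blast
  then show "?d x x = 0" if "x \<in> topspace X" for x
    using lower[OF curves_const(1)[OF that]] curves_const(2)[OF that] that by force
  have le: "?d x y \<le> ?d y x" if "x \<in> topspace X" "y \<in> topspace X" for x y
    using greatest[OF that(2,1)] lower curves_reverse by metis
  then show "?d x y = ?d y x" if "x \<in> topspace X" "y \<in> topspace X" for x y
    using that by (intro antisym) auto
  show "?d x z \<le> ?d x y + ?d y z" if X: "x \<in> topspace X" "y \<in> topspace X" "z \<in> topspace X" for x y z
  proof -
    have "?d x z - ?l \<gamma> \<le> ?d y z" if \<gamma>: "\<gamma> \<in> curves x y" for \<gamma>
    proof (rule greatest[OF X(2,3)])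
      fix \<eta> assume "\<eta> \<in> curves y z"
      then obtain \<kappa> where "\<kappa> \<in> curves x z" "?l \<kappa> = ?l \<gamma> + ?l \<eta>" using curves_concat[OF \<gamma>] by blast
      then show "?d x z - ?l \<gamma> \<le> ?l \<eta>" using lower by fastforce
    qed
    then have "?d x z - ?d y z \<le> ?d x y"
      using greatest[OF X(1,2), of "?d x z - ?d y z"] by fastforce
    then show ?thesis by simp
  qed
qed

section \<open>Triangulations of manifolds\<close>

definition std_simplex :: "'i set \<Rightarrow> ('i \<Rightarrow> real) set" where
  "std_simplex J = {x. (\<forall>i. 0 \<le> x i) \<and> (\<forall>i. i \<notin> J \<longrightarrow> x i = 0) \<and> sum x J = 1}"

text \<open>If nonnegative coordinates have total sum 1 and those in \<open>J\<close> already sum to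
  1, all the others vanish. Hence a simplex depends on its vertex set alone, not on
  \<open>I\<close>.\<close>

lemma full_simplex_face_eq_std_simplex:
  assumes J: "finite J" "J \<subseteq> I"
  shows "{x \<in> full_simplex I. (\<Sum>j\<in>J. x j) = 1} = std_simplex J"
proof (intro equalityI subsetI)
  fix x assume "x \<in> {x \<in> full_simplex I. (\<Sum>j\<in>J. x j) = 1}"
  then have x: "x \<in> ell2 I" "\<And>i. i \<in> I \<Longrightarrow> 0 \<le> x i" "(x has_sum 1) I" "sum x J = 1"
    by (auto simp: full_simplex_def)
  have out: "x i = 0" if "i \<notin> J" for i
  proof (cases "i \<in> I")
    case True
    have "sum x (insert i J) \<le> 1"
      using x True J by (intro finite_sum_le_has_sum[OF x(3)]) auto
    then show ?thesis using x True J that by force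
  qed (use x(1) in \<open>auto simp: ell2_def\<close>)
  moreover have "0 \<le> x i" for i using x(2) out J by (cases "i \<in> J") auto
  ultimately show "x \<in> std_simplex J" using x(4) by (simp add: std_simplex_def)
next
  fix x assume x: "x \<in> std_simplex J"
  have "(x has_sum sum x J) I"
    by (rule has_sum_finite_neutralI) (use x J in \<open>auto simp: std_simplex_def\<close>)
  moreover have "((\<lambda>i. (x i)\<^sup>2) has_sum (\<Sum>i\<in>J. (x i)\<^sup>2)) I"
    by (rule has_sum_finite_neutralI) (use x J in \<open>auto simp: std_simplex_def\<close>)
  then have "x \<in> ell2 I" using x J by (auto simp: ell2_def std_simplex_def summable_on_def)
  ultimately show "x \<in> {x \<in> full_simplex I. (\<Sum>j\<in>J. x j) = 1}"
    using x by (auto simp: full_simplex_def std_simplex_def)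
qed

lemma is_simplex_iff:
  "is_simplex I m \<Delta> \<longleftrightarrow> (\<exists>J\<subseteq>I. finite J \<and> card J = m + 1 \<and> \<Delta> = std_simplex J)"
  unfolding is_simplex_def using full_simplex_face_eq_std_simplex by metis

lemma std_simplex_mono:
  assumes "finite J" "K \<subseteq> J"
  shows "std_simplex K \<subseteq> std_simplex J"
proof
  fix x assume x: "x \<in> std_simplex K"
  have "sum x J = sum x K" using assms x by (intro sum.mono_neutral_right) (auto simp: std_simplex_def)
  then show "x \<in> std_simplex J" using x assms by (auto simp: std_simplex_def)
qed

lemma std_simplex_restrict:
  assumes "x \<in> std_simplex J" "finite J" "{i. x i \<noteq> 0} \<subseteq> K" "finite K"
  shows "x \<in> std_simplex K"
proof -
  have supp: "{i. x i \<noteq> 0} \<subseteq> J" using assms(1) by (auto simp: std_simplex_def)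
  have "sum x J = sum x {i. x i \<noteq> 0}" by (rule sum.mono_neutral_right) (use assms supp in auto)
  moreover have "sum x K = sum x {i. x i \<noteq> 0}" by (rule sum.mono_neutral_right) (use assms in auto)
  moreover have "x i = 0" if "i \<notin> K" for i using assms(3) that by blast
  ultimately show ?thesis using assms(1) by (simp add: std_simplex_def)
qed

text \<open>For finite nonempty \<open>J\<close> this is a point whose support is exactly
  \<open>J\<close>, hence a witness for the relative interior.\<close>

definition simplex_center :: "'i set \<Rightarrow> 'i \<Rightarrow> real" where
  "simplex_center J i = (if i \<in> J then 1 / real (card J) else 0)"

lemma simplex_center_in:
  assumes "finite J" "J \<noteq> {}"
  shows "simplex_center J \<in> std_simplex J"
  using assms by (auto simp: std_simplex_def simplex_center_def)

lemma std_simplex_subset_iff: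
  assumes "finite J" "J \<noteq> {}" "finite K"
  shows "std_simplex J \<subseteq> std_simplex K \<longleftrightarrow> J \<subseteq> K"
proof
  assume "std_simplex J \<subseteq> std_simplex K"
  then have "simplex_center J \<in> std_simplex K" using simplex_center_in[OF assms(1,2)] by blast
  then show "J \<subseteq> K" using assms by (force simp: std_simplex_def simplex_center_def)
qed (rule std_simplex_mono[OF assms(3)])

lemma ell2_dist_finite:
  assumes "finite J" "J \<subseteq> I" "\<And>i. i \<notin> J \<Longrightarrow> x i = y i"
  shows "ell2_dist I x y = sqrt (\<Sum>j\<in>J. (x j - y j)\<^sup>2)"
proof -
  have "((\<lambda>i. (x i - y i)\<^sup>2) has_sum (\<Sum>j\<in>J. (x j - y j)\<^sup>2)) I"
    by (rule has_sum_finite_neutralI) (use assms in auto)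
  then show ?thesis by (simp add: ell2_dist_def infsumI)
qed

lemma continuous_map_ell2_coordinate:
  assumes i: "i \<in> I"
  shows "continuous_map (mtopology_of (ell2_metric I)) euclidean (\<lambda>x. x i :: real)"
proof -
  have "Lipschitz_continuous_map (ell2_metric I) euclidean_metric (\<lambda>x. x i :: real)"
    unfolding Lipschitz_continuous_map_def
  proof (intro conjI exI[of _ 1] ballI)
    fix x y assume "x \<in> mspace (ell2_metric I)" "y \<in> mspace (ell2_metric I)"
    then have "L2_set (\<lambda>i. x i - y i) {i} \<le> ell2_dist I x y"
      using i by (intro L2_set_le_ell2_dist) auto
    then show "mdist euclidean_metric (x i) (y i) \<le> 1 * mdist (ell2_metric I) x y"
      by (simp add: L2_set_def dist_real_def)
  qed auto
  then show ?thesis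
    using Lipschitz_continuous_imp_continuous_map by fastforce
qed

text \<open>Only the finitely many coordinates in \<open>J\<close> vary, so distances between values
  are finite sums and coordinatewise continuity suffices.\<close>

lemma continuous_map_into_ell2:
  assumes J: "finite J" "J \<subseteq> I" and S: "S \<subseteq> ell2 I"
    and e: "\<And>v. v \<in> T \<Longrightarrow> e v \<in> S" "\<And>v w i. v \<in> T \<Longrightarrow> w \<in> T \<Longrightarrow> i \<notin> J \<Longrightarrow> e v i = e w i"
    and cont: "\<And>i. i \<in> J \<Longrightarrow> continuous_on T (\<lambda>v. e v i)"
  shows "continuous_map (top_of_set T) (subtopology (mtopology_of (ell2_metric I)) S) e"
proof (rule continuous_map_into_subtopology)
  interpret M: Metric_space "ell2 I" "ell2_dist I" by (rule Metric_space_ell2)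
  show "e \<in> topspace (top_of_set T) \<rightarrow> S" using e(1) by simp
  have "continuous_map (top_of_set T) M.mtopology e"
    unfolding M.continuous_map_to_metric
  proof (intro ballI allI impI)
    fix v and \<epsilon> :: real assume v: "v \<in> topspace (top_of_set T)" and \<epsilon>: "\<epsilon> > 0"
    have dist: "ell2_dist I (e v) (e w) = sqrt (\<Sum>j\<in>J. (e v j - e w j)\<^sup>2)" if "w \<in> T" for w
      by (rule ell2_dist_finite[OF J e(2)]) (use v that in auto)
    have "continuous_on T (\<lambda>w. sqrt (\<Sum>j\<in>J. (e v j - e w j)\<^sup>2))"
      using cont by (intro continuous_intros) auto
    then have "continuous_map (top_of_set T) euclidean (\<lambda>w. sqrt (\<Sum>j\<in>J. (e v j - e w j)\<^sup>2))" by simp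
    from openin_continuous_map_preimage[OF this, of "{..<\<epsilon>}"]
    have "openin (top_of_set T) {w \<in> T. sqrt (\<Sum>j\<in>J. (e v j - e w j)\<^sup>2) \<in> {..<\<epsilon>}}" by simp
    moreover have "e w \<in> M.mball (e v) \<epsilon>" if "w \<in> {w \<in> T. sqrt (\<Sum>j\<in>J. (e v j - e w j)\<^sup>2) \<in> {..<\<epsilon>}}" for w
      using that v e(1) S dist by auto
    ultimately show "\<exists>U. openin (top_of_set T) U \<and> v \<in> U \<and> (\<forall>w\<in>U. e w \<in> M.mball (e v) \<epsilon>)"
      using v \<epsilon> by (intro exI[of _ "{w \<in> T. sqrt (\<Sum>j\<in>J. (e v j - e w j)\<^sup>2) \<in> {..<\<epsilon>}}"]) auto
  qed
  then show "continuous_map (top_of_set T) (mtopology_of (ell2_metric I)) e"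
    by (simp add: mtopology_of_def)
qed

section \<open>Local structure of triangulated manifolds by invariance of domain\<close>

locale triangulated_manifold = riemannian_manifold X atlas g
  for X :: "'x topology" and atlas :: "('x, 'e::euclidean_space) chart set" and g +
  fixes I :: "'i set" and S :: "('i \<Rightarrow> real) set" and \<phi> :: "('i \<Rightarrow> real) \<Rightarrow> 'x"
  assumes tri: "is_triangulation I S X \<phi>" and dim2: "DIM('e) \<ge> 2"
begin

abbreviation TS :: "('i \<Rightarrow> real) topology" where
  "TS \<equiv> subtopology (mtopology_of (ell2_metric I)) S"

lemma S_subset: "S \<subseteq> full_simplex I" "S \<subseteq> ell2 I"
  using tri by (auto simp: is_triangulation_def simplicial_complex_def full_simplex_def)

lemma topspace_TS: "topspace TS = S" using S_subset by auto

lemma \<phi>_homeo: "homeomorphic_map TS X \<phi>" using tri by (simp add: is_triangulation_def)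

lemma \<phi>_inj: "inj_on \<phi> S" using homeomorphic_imp_injective_map[OF \<phi>_homeo] topspace_TS by simp

lemma \<phi>_image: "\<phi> ` S = topspace X" using homeomorphic_imp_surjective_map[OF \<phi>_homeo] topspace_TS by simp

lemma in_simplex:
  assumes "x \<in> S"
  obtains J where "J \<subseteq> I" "finite J" "J \<noteq> {}" "x \<in> std_simplex J" "std_simplex J \<subseteq> S"
proof -
  obtain F where F: "\<forall>\<Delta>\<in>F. \<exists>n. is_simplex I n \<Delta>" "S = \<Union>F"
    using tri by (auto simp: is_triangulation_def simplicial_complex_def)
  then obtain \<Delta> n where "\<Delta> \<in> F" "x \<in> \<Delta>" "is_simplex I n \<Delta>" using assms by blast
  then obtain J where "J \<subseteq> I" "finite J" "card J = n + 1" "\<Delta> = std_simplex J" by (auto simp: is_simplex_iff)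
  then show ?thesis using that[of J] F \<open>\<Delta> \<in> F\<close> \<open>x \<in> \<Delta>\<close> by fastforce
qed

lemma support_simplex:
  assumes "x \<in> S"
  shows "{i. x i \<noteq> 0} \<subseteq> I" "finite {i. x i \<noteq> 0}" "{i. x i \<noteq> 0} \<noteq> {}"
    "x \<in> std_simplex {i. x i \<noteq> 0}" "std_simplex {i. x i \<noteq> 0} \<subseteq> S"
proof -
  obtain J where J: "J \<subseteq> I" "finite J" "x \<in> std_simplex J" "std_simplex J \<subseteq> S"
    by (rule in_simplex[OF assms])
  have sub: "{i. x i \<noteq> 0} \<subseteq> J" using J(3) by (auto simp: std_simplex_def)
  then show fin: "finite {i. x i \<noteq> 0}" "{i. x i \<noteq> 0} \<subseteq> I" using J finite_subset by blast+
  show x: "x \<in> std_simplex {i. x i \<noteq> 0}" using std_simplex_restrict[OF J(3,2)] fin by blast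
  show "std_simplex {i. x i \<noteq> 0} \<subseteq> S" using std_simplex_mono[OF J(2) sub] J(4) by blast
  show "{i. x i \<noteq> 0} \<noteq> {}"
  proof
    assume "{i. x i \<noteq> 0} = {}"
    then have "sum x {} = 1" using x by (simp add: std_simplex_def)
    then show False by simp
  qed
qed

text \<open>When \<open>K\<close> spans a simplex of the complex, this is its open star.\<close>

lemma openin_positive:
  assumes "finite K" "K \<subseteq> I"
  shows "openin TS {q\<in>S. \<forall>k\<in>K. q k > 0}"
proof -
  have "openin TS {q\<in>S. q k > 0}" if "k \<in> K" for k
    using openin_continuous_map_preimage[OF continuous_map_from_subtopology[OF continuous_map_ell2_coordinate], of k I "{0<..}" S]
      assms that unfolding topspace_TS by auto
  then have "openin TS (S \<inter> (\<Inter>k\<in>K. {q\<in>S. q k > 0}))"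
    using assms openin_topspace[of TS] unfolding topspace_TS
    by (cases "K = {}") (auto intro!: openin_Int openin_INT2)
  moreover have "S \<inter> (\<Inter>k\<in>K. {q\<in>S. q k > 0}) = {q\<in>S. \<forall>k\<in>K. q k > 0}" by auto
  ultimately show ?thesis by simp
qed

text \<open>Invariance of domain, applied to \<open>h\<close> read through the triangulation and a
  chart of \<open>X\<close>. The complex is thus locally a Euclidean space of dimension
  \<open>DIM('e)\<close>.\<close>

lemma open_injective_image:
  fixes h :: "('i \<Rightarrow> real) \<Rightarrow> 'e"
  assumes W: "openin TS W" and h: "continuous_map TS euclidean h" "inj_on h W"
  shows "open (h ` W)"
proof (subst open_subopen, intro ballI)
  fix y assume "y \<in> h ` W"
  then obtain w where w: "w \<in> W" "y = h w" by blast
  have WS: "W \<subseteq> S" using openin_subset[OF W] topspace_TS by simp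
  obtain k where k: "homeomorphic_maps TS X \<phi> k" using \<phi>_homeo homeomorphic_map_maps by blast
  have k\<phi>: "k (\<phi> x) = x" if "x \<in> S" for x using k that topspace_TS by (auto simp: homeomorphic_maps_def)
  have "\<phi> w \<in> topspace X" using \<phi>_image w WS by blast
  then obtain c where c: "c \<in> atlas" "\<phi> w \<in> fst c" using cover by auto
  have V: "openin X (\<phi> ` W)" using homeomorphic_map_openness[OF \<phi>_homeo, unfolded topspace_TS, OF WS] W by simp
  let ?V = "fst c \<inter> \<phi> ` W"
  let ?O = "snd c ` ?V"
  have "openin (subtopology X (fst c)) ?V" using V by (metis inf_commute openin_subtopology_Int)
  then have "openin (top_of_set (snd c ` fst c)) ?O"
    using homeomorphic_map_openness[OF chart_homeo[OF c(1)], of ?V] chart_subset[OF c(1)] by auto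
  then have O: "open ?O" using chart_range[OF c(1)] openin_open_trans by blast
  let ?inv = "inv_into (fst c) (snd c)"
  have inv: "?inv (snd c p) = p" if "p \<in> fst c" for p using chart_inj[OF c(1)] that by simp
  have "continuous_map (top_of_set (snd c ` fst c)) euclidean (h \<circ> (k \<circ> ?inv))"
    using k h(1) chart_inv_continuous[OF c(1)]
    by (intro continuous_map_compose[of _ TS] continuous_map_compose[of _ X]) (auto simp: homeomorphic_maps_def)
  then have "continuous_on (snd c ` fst c) (h \<circ> (k \<circ> ?inv))" by simp
  then have cont: "continuous_on ?O (h \<circ> (k \<circ> ?inv))" by (rule continuous_on_subset) blast
  have val: "(h \<circ> (k \<circ> ?inv)) (snd c (\<phi> x)) = h x" if "x \<in> W" "\<phi> x \<in> fst c" for x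
    using that inv k\<phi> WS by auto
  have "inj_on (h \<circ> (k \<circ> ?inv)) ?O"
  proof (rule inj_onI)
    fix a b assume "a \<in> ?O" "b \<in> ?O" and eq: "(h \<circ> (k \<circ> ?inv)) a = (h \<circ> (k \<circ> ?inv)) b"
    then obtain x x' where x: "x \<in> W" "\<phi> x \<in> fst c" "a = snd c (\<phi> x)" "x' \<in> W" "\<phi> x' \<in> fst c" "b = snd c (\<phi> x')"
      by auto
    then have "h x = h x'" using eq val by metis
    then show "a = b" using x h(2) by (metis inj_onD)
  qed
  then have "open ((h \<circ> (k \<circ> ?inv)) ` ?O)" using invariance_of_domain[OF cont O] by blast
  moreover have "y \<in> (h \<circ> (k \<circ> ?inv)) ` ?O" using val[OF w(1) c(2)] w c by (intro image_eqI[of _ _ "snd c (\<phi> w)"]) auto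
  moreover have "(h \<circ> (k \<circ> ?inv)) ` ?O \<subseteq> h ` W" using val by auto
  ultimately show "\<exists>T. open T \<and> y \<in> T \<and> T \<subseteq> h ` W" by blast
qed

text \<open>The counterpart for maps into the complex: followed by the triangulation and a chart,
  \<open>e\<close> becomes a map between subsets of \<open>'e\<close>, to which invariance of domain
  applies.\<close>

lemma injective_image_openin:
  fixes e :: "'e \<Rightarrow> 'i \<Rightarrow> real"
  assumes B: "open B" and e: "continuous_map (top_of_set B) TS e" "inj_on e B"
  shows "openin TS (e ` B)"
proof (subst openin_subopen, intro ballI)
  fix y assume "y \<in> e ` B"
  then obtain v where v: "v \<in> B" "y = e v" by blast
  have eS: "e u \<in> S" if "u \<in> B" for u using e(1) that topspace_TS by (auto simp: continuous_map_def)
  have \<phi>e: "continuous_map (top_of_set B) X (\<phi> \<circ> e)"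
    using continuous_map_compose[OF e(1)] homeomorphic_imp_continuous_map[OF \<phi>_homeo] by blast
  have "\<phi> y \<in> topspace X" using \<phi>_image v eS by blast
  then obtain c where c: "c \<in> atlas" "\<phi> y \<in> fst c" using cover by auto
  let ?B = "{u\<in>B. \<phi> (e u) \<in> fst c}"
  have "openin (top_of_set B) ?B"
    using openin_continuous_map_preimage[OF \<phi>e chart_domain[OF c(1)]] by simp
  then have oB: "open ?B" using B openin_open_trans by blast
  let ?f = "snd c \<circ> (\<phi> \<circ> e)"
  have "continuous_map (top_of_set ?B) (subtopology X (fst c)) (\<phi> \<circ> e)"
    by (intro continuous_map_into_subtopology continuous_map_from_subtopology_mono[OF \<phi>e]) auto
  then have cont: "continuous_on ?B ?f"
    using continuous_map_compose[OF _ chart_continuous[OF c(1)]] by fastforce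
  have "inj_on ?f ?B"
  proof (rule inj_onI)
    fix a b assume ab: "a \<in> ?B" "b \<in> ?B" and "?f a = ?f b"
    then have "\<phi> (e a) = \<phi> (e b)" using chart_inj[OF c(1)] by (auto dest: inj_onD)
    then have "e a = e b" using ab eS \<phi>_inj by (auto dest: inj_onD)
    then show "a = b" using ab e(2) by (auto dest: inj_onD)
  qed
  then have oF: "open (?f ` ?B)" using invariance_of_domain[OF cont oB] by blast
  let ?V = "{p \<in> topspace (subtopology X (fst c)). snd c p \<in> ?f ` ?B}"
  have "openin (subtopology X (fst c)) ?V"
    by (rule openin_continuous_map_preimage[OF chart_continuous[OF c(1)]]) (use oF in simp)
  then have "openin X ?V" using chart_domain[OF c(1)] openin_trans_full by blast
  then have "openin TS {x \<in> topspace TS. \<phi> x \<in> ?V}"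
    by (rule openin_continuous_map_preimage[OF homeomorphic_imp_continuous_map[OF \<phi>_homeo]])
  moreover have "y \<in> {x \<in> topspace TS. \<phi> x \<in> ?V}"
    using v eS c chart_subset[OF c(1)] topspace_TS by auto
  moreover have "{x \<in> topspace TS. \<phi> x \<in> ?V} \<subseteq> e ` B"
  proof
    fix x assume "x \<in> {x \<in> topspace TS. \<phi> x \<in> ?V}"
    then obtain u where u: "x \<in> S" "\<phi> x \<in> fst c" "u \<in> ?B" "snd c (\<phi> x) = snd c (\<phi> (e u))"
      using topspace_TS by auto
    then have "\<phi> x = \<phi> (e u)" using chart_inj[OF c(1)] by (auto dest: inj_onD)
    then have "x = e u" using u eS \<phi>_inj by (auto dest: inj_onD)
    then show "x \<in> e ` B" using u by blast
  qed
  ultimately show "\<exists>T. openin TS T \<and> y \<in> T \<and> T \<subseteq> e ` B" by blast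
qed

text \<open>A neighbourhood that is determined by at most \<open>DIM('e)\<close> of its barycentric coordinates maps onto
  an open set, so the sum of these coordinates cannot attain a maximum in it.\<close>

lemma no_boundary_point:
  assumes K: "finite K" "K \<noteq> {}" "K \<subseteq> I" "card K \<le> DIM('e)"
    and W: "openin TS W" "p \<in> W" and p: "sum p K = 1" and le: "\<And>q. q \<in> W \<Longrightarrow> sum q K \<le> 1"
    and inj: "\<And>q q'. q \<in> W \<Longrightarrow> q' \<in> W \<Longrightarrow> (\<And>k. k \<in> K \<Longrightarrow> q k = q' k) \<Longrightarrow> q = q'"
  shows False
proof -
  \<comment> \<open>Since \<open>card K \<le> DIM('e)\<close>, distinct vertices in \<open>K\<close>
    can be given distinct basis vectors, so that \<open>h\<close> records exactly the coordinates in
    \<open>K\<close>.\<close>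
  obtain b where b: "b ` K \<subseteq> (Basis :: 'e set)" "inj_on b K"
    using card_le_inj[OF K(1) finite_Basis K(4)] by blast
  define h where "h q = (\<Sum>k\<in>K. q k *\<^sub>R b k)" for q :: "'i \<Rightarrow> real"
  have bb: "b k \<bullet> b l = (if k = l then 1 else 0)" if "k \<in> K" "l \<in> K" for k l
    using b that by (simp add: inner_Basis image_subset_iff inj_on_eq_iff)
  have hb: "h q \<bullet> b l = q l" if l: "l \<in> K" for q l
  proof -
    have "h q \<bullet> b l = (\<Sum>k\<in>K. if k = l then q k else 0)"
      unfolding h_def inner_sum_left using l bb by (intro sum.cong) auto
    then show ?thesis using K l by simp
  qed
  have "continuous_map TS euclidean h"
    unfolding h_def
  proof (intro continuous_map_sum K(1))
    fix k assume "k \<in> K"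
    then have k: "continuous_map TS euclidean (\<lambda>q. q k)"
      using K(3) by (intro continuous_map_from_subtopology continuous_map_ell2_coordinate) auto
    have "continuous_map euclidean euclidean (\<lambda>r::real. r *\<^sub>R b k)"
      by (auto intro!: continuous_intros)
    from continuous_map_compose[OF k this]
    show "continuous_map TS euclidean (\<lambda>q. q k *\<^sub>R b k)" by (simp add: o_def)
  qed
  moreover have "inj_on h W"
    by (rule inj_onI, rule inj) (metis hb)+
  ultimately have "open (h ` W)" using open_injective_image W by blast
  then obtain r where r: "r > 0" "ball (h p) r \<subseteq> h ` W" using W by (meson imageI open_contains_ball)
  obtain l where l: "l \<in> K" using K by blast
  \<comment> \<open>A move along \<open>b l\<close> stays in the open image and raises only the
    coordinate \<open>l\<close>, which pushes the coordinate sum beyond 1.\<close>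
  have "h p + (r/2) *\<^sub>R b l \<in> ball (h p) r" using r b l by (auto simp: dist_norm norm_Basis image_subset_iff)
  then obtain q where q: "q \<in> W" "h q = h p + (r/2) *\<^sub>R b l" using r by (metis imageE subsetD)
  have "q k = p k + (if k = l then r/2 else 0)" if k: "k \<in> K" for k
    using hb[OF k, of q] hb[OF k, of p] bb[OF l k] q(2) by (auto simp: inner_simps)
  then have "sum q K = (\<Sum>k\<in>K. p k + (if k = l then r/2 else 0))" by simp
  then have "sum q K = sum p K + r/2" using K l by (simp add: sum.distrib)
  then show False using le[OF q(1)] p r by simp
qed

text \<open>Around the centre of a simplex with too many vertices there is an embedded disc of
  dimension \<open>DIM('e)\<close> along which the coordinate of a vertex \<open>j1\<close> is
  constant. The disc would be open in the complex by invariance of domain, yet shifting weight to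
  \<open>j1\<close> leaves it at once.\<close>

lemma card_simplex_le:
  assumes J: "finite J" "J \<subseteq> I" and JS: "std_simplex J \<subseteq> S"
  shows "card J \<le> DIM('e) + 1"
proof (rule ccontr)
  assume "\<not> ?thesis"
  then have card: "card J \<ge> DIM('e) + 2" by simp
  have Jne: "J \<noteq> {}" using card by auto
  obtain j0 where j0: "j0 \<in> J" using Jne by blast
  have "J - {j0} \<noteq> {}"
  proof
    assume "J - {j0} = {}"
    then have "card J \<le> card {j0}" by (intro card_mono) auto
    then show False using card by simp
  qed
  then obtain j1 where j: "j0 \<in> J" "j1 \<in> J" "j0 \<noteq> j1" using j0 by blast
  have "DIM('e) \<le> card (J - {j0, j1})" using card j J by (simp add: card_Diff_subset)
  then obtain b where b: "b ` (Basis :: 'e set) \<subseteq> J - {j0, j1}" "inj_on b Basis"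
    using card_le_inj[OF finite_Basis, of "J - {j0, j1}"] J by blast
  define p where "p = simplex_center J"
  define \<epsilon> where "\<epsilon> = 1 / real (card J)"
  have \<epsilon>: "\<epsilon> > 0" using card by (simp add: \<epsilon>_def)
  have p: "p \<in> std_simplex J" "\<And>i. i \<in> J \<Longrightarrow> p i = \<epsilon>"
    using simplex_center_in[OF J(1) Jne] by (auto simp: p_def \<epsilon>_def simplex_center_def)
  \<comment> \<open>Weight \<open>t k\<close> is added at each vertex \<open>k\<close> and taken
    away at \<open>j0\<close>. As all coordinates of the centre are \<open>\<epsilon>\<close>, such
    small changes remain in the simplex.\<close>
  have pert: "(\<lambda>i. p i + (\<Sum>k\<in>A. t k * (of_bool (i = k) - of_bool (i = j0)))) \<in> S"
    if A: "finite A" "A \<subseteq> J - {j0}" and t: "\<And>k. k \<in> A \<Longrightarrow> \<bar>t k\<bar> < \<epsilon>" "\<bar>sum t A\<bar> < \<epsilon>" for A and t :: "'i \<Rightarrow> real"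
  proof -
    let ?x = "\<lambda>i. p i + (\<Sum>k\<in>A. t k * (of_bool (i = k) - of_bool (i = j0)))"
    have val: "?x i = p i + (if i \<in> A then t i else 0) - (if i = j0 then sum t A else 0)" for i
      using A(1) by (simp add: right_diff_distrib sum_subtractf of_bool_def if_distrib[of "\<lambda>x. _ * x"] cong: if_cong)
    have nonneg: "0 \<le> ?x i" for i
      unfolding val using p(2)[of i] p(1) t(1)[of i] t(2) A j by (cases "i \<in> J") (auto simp: std_simplex_def)
    have "(\<Sum>i\<in>J. ?x i) = sum p J + sum t (J \<inter> A) - sum t A"
      unfolding val using J(1) j by (simp add: sum.distrib sum_subtractf sum.inter_restrict)
    also have "J \<inter> A = A" using A by blast
    finally have "(\<Sum>i\<in>J. ?x i) = 1" using p(1) by (simp add: std_simplex_def)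
    moreover have "?x i = 0" if "i \<notin> J" for i unfolding val using that p(1) A j by (auto simp: std_simplex_def)
    ultimately have "?x \<in> std_simplex J" using nonneg by (simp add: std_simplex_def)
    then show ?thesis using JS by blast
  qed
  \<comment> \<open>The denominator makes the sum of \<open>DIM('e)\<close> coordinates smaller than
    \<open>\<epsilon>\<close>, so the coordinate at \<open>j0\<close> stays nonnegative.\<close>
  define \<delta> where "\<delta> = \<epsilon> / (real (DIM('e)) + 1)"
  have \<delta>: "\<delta> > 0" "\<delta> \<le> \<epsilon>" "real (DIM('e)) * \<delta> < \<epsilon>" using \<epsilon> by (auto simp: \<delta>_def field_simps)
  define e where "e v = (\<lambda>i. p i + (\<Sum>k\<in>b ` Basis. (v \<bullet> the_inv_into Basis b k) * (of_bool (i = k) - of_bool (i = j0))))"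
    for v :: 'e
  let ?B = "ball (0::'e) \<delta>"
  have eS: "e v \<in> S" if v: "v \<in> ?B" for v
    unfolding e_def
  proof (rule pert)
    have small: "\<bar>v \<bullet> u\<bar> < \<delta>" if "u \<in> Basis" for u
      using Basis_le_norm[OF that, of v] v by simp
    then show "\<bar>v \<bullet> the_inv_into Basis b k\<bar> < \<epsilon>" if "k \<in> b ` Basis" for k
      using that b(2) \<delta> by (force simp: the_inv_into_f_f)
    have "\<bar>\<Sum>k\<in>b ` Basis. v \<bullet> the_inv_into Basis b k\<bar> = \<bar>\<Sum>u\<in>Basis. v \<bullet> u\<bar>"
      using b(2) by (simp add: sum.reindex the_inv_into_f_f)
    also have "\<dots> \<le> (\<Sum>u\<in>Basis. \<bar>v \<bullet> u\<bar>)" by (rule sum_abs)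
    also have "\<dots> \<le> real (DIM('e)) * \<delta>" using small by (intro sum_bounded_above) (auto intro: less_imp_le)
    finally show "\<bar>\<Sum>k\<in>b ` Basis. v \<bullet> the_inv_into Basis b k\<bar> < \<epsilon>" using \<delta> by simp
  qed (use b in auto)
  have e_out: "e v i = p i" if "i \<notin> b ` Basis" "i \<noteq> j0" for v i
    unfolding e_def using that by (auto intro!: sum.neutral)
  have e_in: "e v (b u) = p (b u) + v \<bullet> u" if u: "u \<in> Basis" for v u
  proof -
    have "b u \<noteq> j0" using b u by blast
    then have "e v (b u) = p (b u) + (\<Sum>k\<in>b ` Basis. if k = b u then v \<bullet> the_inv_into Basis b k else 0)"
      unfolding e_def by (auto intro!: sum.cong)
    then show ?thesis using u b(2) by (simp add: the_inv_into_f_f)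
  qed
  have "continuous_map (top_of_set ?B) TS e"
  proof (rule continuous_map_into_ell2[OF J S_subset(2)])
    show "e v i = e w i" if "i \<notin> J" for v w i
      using that e_out[of i] b(1) j by (metis Diff_iff subsetD)
    show "continuous_on ?B (\<lambda>v. e v i)" for i unfolding e_def by (intro continuous_intros)
  qed (use eS in auto)
  moreover have "inj_on e ?B"
  proof (rule inj_onI)
    fix v w assume "e v = e w"
    then have "v \<bullet> u = w \<bullet> u" if "u \<in> Basis" for u using e_in[OF that, of v] e_in[OF that, of w] by simp
    then show "v = w" by (rule euclidean_eqI)
  qed
  ultimately have op: "openin TS (e ` ?B)" by (intro injective_image_openin) auto
  \<comment> \<open>The curve that leaves the disc: it shifts weight from \<open>j0\<close> to
    \<open>j1\<close>, whose coordinate is \<open>p j1\<close> throughout the disc.\<close>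
  define c where "c t = (\<lambda>i. p i + (\<Sum>k\<in>{j1}. t * (of_bool (i = k) - of_bool (i = j0))))" for t :: real
  let ?T = "{- \<epsilon><..<\<epsilon>}"
  have "continuous_map (top_of_set ?T) TS c"
  proof (rule continuous_map_into_ell2[OF J S_subset(2)])
    show "c t \<in> S" if "t \<in> ?T" for t
      unfolding c_def using that j by (intro pert) auto
    show "c v i = c w i" if "i \<notin> J" for v w i using that j by (auto simp: c_def)
    show "continuous_on ?T (\<lambda>v. c v i)" for i unfolding c_def by (intro continuous_intros)
  qed
  then have "openin (top_of_set ?T) {t\<in>?T. c t \<in> e ` ?B}"
    using openin_continuous_map_preimage[OF _ op] by fastforce
  then have opT: "open {t\<in>?T. c t \<in> e ` ?B}" by (rule openin_open_trans) simp
  have "c 0 = e 0" by (auto simp: c_def e_def)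
  then have "0 \<in> {t\<in>?T. c t \<in> e ` ?B}" using \<epsilon> \<delta> by auto
  then obtain r where r: "r > 0" "ball 0 r \<subseteq> {t\<in>?T. c t \<in> e ` ?B}" using opT open_contains_ball by meson
  have "r / 2 \<in> ball 0 r" using r by simp
  then obtain v where v: "c (r / 2) = e v" using r by blast
  have "e v j1 = p j1" using e_out[of j1] b(1) j by blast
  moreover have "c (r / 2) j1 = p j1 + r / 2" using j by (simp add: c_def)
  ultimately show False using v r by simp
qed

text \<open>Among the points outside all top-dimensional simplices take one, \<open>p\<close>, with
  largest support \<open>?K\<close>; the bound on simplices makes this possible. Its open star
  consists of points with the same support, so at most \<open>DIM('e)\<close> coordinates determine
  them and have constant sum 1. This contradicts \<open>no_boundary_point\<close>.\<close>

lemma in_top_simplex: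
  assumes x: "x \<in> S"
  obtains J where "J \<subseteq> I" "finite J" "card J = DIM('e) + 1" "x \<in> std_simplex J" "std_simplex J \<subseteq> S"
proof (rule ccontr)
  assume contra: "\<not> thesis"
  define bad where "bad x \<longleftrightarrow> x \<in> S \<and> \<not> (\<exists>J\<subseteq>I. finite J \<and> card J = DIM('e) + 1 \<and> x \<in> std_simplex J \<and> std_simplex J \<subseteq> S)" for x
  let ?supp = "\<lambda>x::'i \<Rightarrow> real. {i. x i \<noteq> 0}"
  have "bad x" using x contra that by (auto simp: bad_def)
  moreover have bound: "card (?supp y) \<le> DIM('e) + 1" if "y \<in> S" for y
    using card_simplex_le support_simplex[OF that] by blast
  then have "\<forall>y. bad y \<longrightarrow> card (?supp y) < Suc (DIM('e) + 1)" by (simp add: bad_def less_Suc_eq_le)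
  ultimately have "\<exists>p. bad p \<and> (\<forall>y. bad y \<longrightarrow> card (?supp y) \<le> card (?supp p))"
    by (rule Lattices_Big.ex_has_greatest_nat)
  then obtain p where p: "bad p" and max: "\<And>y. bad y \<Longrightarrow> card (?supp y) \<le> card (?supp p)" by blast
  have pS: "p \<in> S" using p by (simp add: bad_def)
  let ?K = "?supp p"
  note K = support_simplex[OF pS]
  have "card ?K \<noteq> DIM('e) + 1" using p K unfolding bad_def by blast
  then have cardK: "card ?K \<le> DIM('e)" using bound[OF pS] by simp
  define W where "W = {q\<in>S. \<forall>k\<in>?K. q k > 0}"
  \<comment> \<open>A top-dimensional simplex that contains \<open>q\<close> contains the support of
    \<open>q\<close>, hence \<open>?K\<close>, hence \<open>p\<close>. So \<open>q\<close> is bad as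
    well, and maximality leaves no room for a larger support.\<close>
  have Wsupp: "?supp q = ?K" if q: "q \<in> W" for q
  proof -
    have qS: "q \<in> S" and sub: "?K \<subseteq> ?supp q" using q by (force simp: W_def)+
    have "bad q"
      unfolding bad_def
    proof (intro conjI notI qS)
      assume "\<exists>J\<subseteq>I. finite J \<and> card J = DIM('e) + 1 \<and> q \<in> std_simplex J \<and> std_simplex J \<subseteq> S"
      then obtain J where J: "J \<subseteq> I" "finite J" "card J = DIM('e) + 1" "q \<in> std_simplex J" "std_simplex J \<subseteq> S" by blast
      have "?supp q \<subseteq> J" using J(4) by (auto simp: std_simplex_def)
      then have "p \<in> std_simplex J" using std_simplex_mono[of J ?K] K(4) J sub by blast
      then show False using p J unfolding bad_def by blast
    qed
    then show ?thesis using max[of q] sub support_simplex(2)[OF qS] by (metis card_seteq)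
  qed
  have Wq: "sum q ?K = 1" if "q \<in> W" for q
    using support_simplex(4)[of q] Wsupp[OF that] that by (simp add: W_def std_simplex_def)
  have pW: "p \<in> W" using pS K(4) by (auto simp: W_def std_simplex_def less_le)
  show False
  proof (rule no_boundary_point[OF K(2,3,1) cardK _ pW Wq[OF pW]])
    show "openin TS W" unfolding W_def using openin_positive K by blast
    show "q = q'" if q: "q \<in> W" "q' \<in> W" and eq: "\<And>k. k \<in> ?K \<Longrightarrow> q k = q' k" for q q'
    proof
      fix i
      show "q i = q' i"
      proof (cases "i \<in> ?K")
        case False
        have "i \<notin> {i. q i \<noteq> 0}" "i \<notin> {i. q' i \<noteq> 0}"
          unfolding Wsupp[OF q(1)] Wsupp[OF q(2)] by (rule False)+
        then show ?thesis by simp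
      qed (rule eq)
    qed
  qed (use Wq in auto)
qed

text \<open>If no other simplex contained the facet, its centre would have a neighbourhood within
  \<open>std_simplex J\<close>. There the coordinates of the facet determine the point, and their
  sum \<open>1 - q j\<close> is largest at the centre, which \<open>no_boundary_point\<close>
  forbids.\<close>

lemma facet_in_two_simplices:
  assumes J: "J \<subseteq> I" "finite J" "card J = DIM('e) + 1" "std_simplex J \<subseteq> S" and j: "j \<in> J"
  shows "\<exists>j'\<in>I - J. std_simplex (insert j' (J - {j})) \<subseteq> S"
proof (rule ccontr)
  assume contra: "\<not> ?thesis"
  let ?K = "J - {j}"
  have K: "finite ?K" "?K \<subseteq> I" "card ?K \<le> DIM('e)" "?K \<noteq> {}"
  proof -
    have card: "card ?K = DIM('e)" using J j by simp
    show "card ?K \<le> DIM('e)" using card by simp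
    show "?K \<noteq> {}" using card dim2 by (metis card.empty not_numeral_le_zero)
  qed (use J in auto)
  define p where "p = simplex_center ?K"
  have p: "p \<in> std_simplex ?K" "\<And>k. k \<in> ?K \<Longrightarrow> p k > 0"
    using simplex_center_in[OF K(1,4)] K by (auto simp: p_def simplex_center_def card_gt_0_iff)
  have pS: "p \<in> S" using p(1) std_simplex_mono[OF J(2), of ?K] J(4) by blast
  define W where "W = {q\<in>S. \<forall>k\<in>?K. q k > 0}"
  have WJ: "q \<in> std_simplex J" if q: "q \<in> W" for q
  proof -
    have qS: "q \<in> S" using q by (simp add: W_def)
    note Q = support_simplex[OF qS]
    have "{i. q i \<noteq> 0} \<subseteq> J"
    proof
      fix i assume i: "i \<in> {i. q i \<noteq> 0}"
      show "i \<in> J"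
      proof (rule ccontr)
        assume "i \<notin> J"
        have "insert i ?K \<subseteq> {i. q i \<noteq> 0}" using q i by (force simp: W_def)
        then have "std_simplex (insert i ?K) \<subseteq> S" using std_simplex_mono[OF Q(2)] Q(5) by blast
        then show False using contra \<open>i \<notin> J\<close> i Q(1) by blast
      qed
    qed
    then show ?thesis using std_simplex_mono[OF J(2)] Q(4) by blast
  qed
  have Wsum: "sum q ?K = 1 - q j" if "q \<in> W" for q
    using WJ[OF that] J j by (simp add: std_simplex_def sum_diff1)
  show False
  proof (rule no_boundary_point[OF K(1,4,2,3)])
    show "openin TS W" unfolding W_def using openin_positive K by blast
    show "p \<in> W" using pS p by (simp add: W_def)
    show "sum p ?K = 1" using p by (simp add: std_simplex_def)
    show "sum q ?K \<le> 1" if "q \<in> W" for q using Wsum[OF that] WJ[OF that] by (simp add: std_simplex_def)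
    show "q = q'" if q: "q \<in> W" "q' \<in> W" and eq: "\<And>k. k \<in> ?K \<Longrightarrow> q k = q' k" for q q'
    proof
      fix i
      have "sum q ?K = sum q' ?K" using eq by (intro sum.cong) auto
      then have "q j = q' j" using Wsum q by simp
      then show "q i = q' i"
        using eq[of i] WJ[OF q(1)] WJ[OF q(2)] by (cases "i \<in> J"; cases "i = j") (auto simp: std_simplex_def)
    qed
  qed
qed

lemma top_simplices_eq:
  "simplices_of I (DIM('e)) S = {\<Delta>. \<exists>J\<subseteq>I. finite J \<and> card J = DIM('e) + 1 \<and> \<Delta> = std_simplex J \<and> \<Delta> \<subseteq> S}"
  by (auto simp: simplices_of_def is_simplex_iff)

text \<open>One simplex and its neighbours across its \<open>DIM('e) + 1\<close> facets. The
  neighbours differ: the one opposite to \<open>i\<close> lacks the vertex \<open>i\<close>, which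
  all the other neighbours contain.\<close>

lemma card_top_simplices_ge:
  assumes "S \<noteq> {}" and fin: "finite (simplices_of I (DIM('e)) S)"
  shows "DIM('e) + 2 \<le> card (simplices_of I (DIM('e)) S)"
proof -
  obtain J where J: "J \<subseteq> I" "finite J" "card J = DIM('e) + 1" "std_simplex J \<subseteq> S"
    using in_top_simplex assms(1) by (metis ex_in_conv)
  have "\<forall>j\<in>J. \<exists>j'. j' \<in> I - J \<and> std_simplex (insert j' (J - {j})) \<subseteq> S"
    using facet_in_two_simplices[OF J] by blast
  from bchoice[OF this] obtain v where v: "\<And>j. j \<in> J \<Longrightarrow> v j \<in> I - J"
    "\<And>j. j \<in> J \<Longrightarrow> std_simplex (insert (v j) (J - {j})) \<subseteq> S" by blast
  let ?F = "\<lambda>j. insert (v j) (J - {j})"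
  have cardF: "card (?F j) = DIM('e) + 1" if "j \<in> J" for j
    using v(1)[OF that] J that by (simp add: card_insert_if)
  have eqD: "A = B" if "std_simplex A = std_simplex B" "finite A" "finite B" "A \<noteq> {}" "B \<noteq> {}" for A B :: "'i set"
    using that std_simplex_subset_iff by (metis order_refl subset_antisym)
  have inj: "inj_on (std_simplex \<circ> ?F) J"
  proof (rule inj_onI)
    fix i j assume ij: "i \<in> J" "j \<in> J" "(std_simplex \<circ> ?F) i = (std_simplex \<circ> ?F) j"
    then have "?F i = ?F j" using eqD[of "?F i" "?F j"] J by simp
    moreover have "i \<notin> ?F i" using ij v(1)[of i] by auto
    ultimately have "i \<notin> ?F j" by simp
    then show "i = j" using ij by blast
  qed
  have "std_simplex J \<noteq> (std_simplex \<circ> ?F) j" if "j \<in> J" for j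
  proof
    assume "std_simplex J = (std_simplex \<circ> ?F) j"
    then have "J = ?F j" using eqD[of J "?F j"] J that by auto
    then show False using v(1)[OF that] by blast
  qed
  then have "std_simplex J \<notin> (std_simplex \<circ> ?F) ` J" by blast
  then have "card (insert (std_simplex J) ((std_simplex \<circ> ?F) ` J)) = DIM('e) + 2"
    using J card_image[OF inj] by simp
  moreover have "insert (std_simplex J) ((std_simplex \<circ> ?F) ` J) \<subseteq> simplices_of I (DIM('e)) S"
  proof -
    have "std_simplex (?F j) \<in> simplices_of I (DIM('e)) S" if "j \<in> J" for j
    proof -
      have "?F j \<subseteq> I" "finite (?F j)" using v(1)[OF that] J by auto
      then show ?thesis unfolding top_simplices_eq using v(2)[OF that] cardF[OF that] by blast
    qed
    moreover have "std_simplex J \<in> simplices_of I (DIM('e)) S" unfolding top_simplices_eq using J by blast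
    ultimately show ?thesis by auto
  qed
  ultimately show ?thesis using card_mono[OF fin] by metis
qed

end

section \<open>Packing numbers and the extension constant\<close>

text \<open>Each half-open cube of side \<open>r / sqrt m\<close> contains at most one point of an \<open>r\<close>-separated set.\<close>

lemma separated_set_card_le:
  fixes P :: "('i \<Rightarrow> real) set"
  assumes J: "finite J" "J \<subseteq> I" "card J = m" "m > 0"
    and P: "\<And>x i. x \<in> P \<Longrightarrow> i \<notin> J \<Longrightarrow> x i = 0" and r: "r > 0"
    and R0: "0 \<le> R" and R: "\<And>x y. x \<in> P \<Longrightarrow> y \<in> P \<Longrightarrow> ell2_dist I x y \<le> R"
    and sep: "\<And>x y. x \<in> P \<Longrightarrow> y \<in> P \<Longrightarrow> x \<noteq> y \<Longrightarrow> r \<le> ell2_dist I x y"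
  shows "finite P \<and> real (card P) \<le> (2 * R * sqrt m / r + 3) ^ m"
proof (cases "P = {}")
  case True
  then show ?thesis using R0 r by simp
next
  case False
  then obtain x0 where x0: "x0 \<in> P" by blast
  define s where "s = r / sqrt m"
  have s: "s > 0" using r J by (simp add: s_def)
  have dist: "ell2_dist I x y = sqrt (\<Sum>j\<in>J. (x j - y j)\<^sup>2)" if "x \<in> P" "y \<in> P" for x y
    by (rule ell2_dist_finite[OF J(1,2)]) (simp add: P[OF that(1)] P[OF that(2)])
  have coord: "\<bar>x j - y j\<bar> \<le> R" if "x \<in> P" "y \<in> P" "j \<in> J" for x y j
  proof -
    have "(x j - y j)\<^sup>2 \<le> (\<Sum>j\<in>J. (x j - y j)\<^sup>2)" using J that by (intro member_le_sum) auto
    then have "\<bar>x j - y j\<bar> \<le> sqrt (\<Sum>j\<in>J. (x j - y j)\<^sup>2)" by (simp add: real_le_rsqrt)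
    then show ?thesis using R[OF that(1,2)] dist[OF that(1,2)] by simp
  qed
  define G where "G x = restrict (\<lambda>j. \<lfloor>x j / s\<rfloor>) J" for x :: "'i \<Rightarrow> real"
  \<comment> \<open>Every coordinate lies within \<open>R\<close> of that of \<open>x0\<close>, so
    its cell index is one of \<open>2 * \<lceil>R / s\<rceil> + 1\<close> integers, at most
    \<open>2 * R / s + 3\<close>.\<close>
  define C where "C = (\<Pi>\<^sub>E j\<in>J. {\<lfloor>x0 j / s\<rfloor> - \<lceil>R / s\<rceil>..\<lfloor>x0 j / s\<rfloor> + \<lceil>R / s\<rceil>})"
  have GC: "G ` P \<subseteq> C"
  proof (rule image_subsetI)
    fix x assume x: "x \<in> P"
    have "\<lfloor>x j / s\<rfloor> \<in> {\<lfloor>x0 j / s\<rfloor> - \<lceil>R / s\<rceil>..\<lfloor>x0 j / s\<rfloor> + \<lceil>R / s\<rceil>}" if j: "j \<in> J" for j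
    proof -
      have "\<bar>x j / s - x0 j / s\<bar> = \<bar>x j - x0 j\<bar> / s" using s by (simp flip: diff_divide_distrib)
      also have "\<dots> \<le> R / s" using coord[OF x x0 j] s by (intro divide_right_mono) auto
      finally have "\<bar>x j / s - x0 j / s\<bar> \<le> R / s" .
      then show ?thesis by simp linarith
    qed
    then show "G x \<in> C" by (auto simp: G_def C_def)
  qed
  have inj: "inj_on G P"
  proof (rule inj_onI, rule ccontr)
    fix x y assume xy: "x \<in> P" "y \<in> P" "G x = G y" "x \<noteq> y"
    have lt: "(x j - y j)\<^sup>2 < s\<^sup>2" if j: "j \<in> J" for j
    proof -
      have "\<lfloor>x j / s\<rfloor> = \<lfloor>y j / s\<rfloor>" using fun_cong[OF xy(3), of j] j by (simp add: G_def)
      then have "\<bar>x j / s - y j / s\<bar> < 1" by linarith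
      moreover have "\<bar>x j / s - y j / s\<bar> = \<bar>x j - y j\<bar> / s" using s by (simp flip: diff_divide_distrib)
      ultimately have "\<bar>x j - y j\<bar> < s" using s by simp
      then show ?thesis using power_strict_mono[of "\<bar>x j - y j\<bar>" s 2] by simp
    qed
    have "J \<noteq> {}" using J by auto
    then have "(\<Sum>j\<in>J. (x j - y j)\<^sup>2) < (\<Sum>j\<in>J. s\<^sup>2)" using lt J by (intro sum_strict_mono) auto
    also have "\<dots> = r\<^sup>2" using J by (simp add: s_def power_divide)
    finally have "ell2_dist I x y < r" using r dist[OF xy(1,2)] by (simp add: real_less_lsqrt sum_nonneg)
    then show False using sep[OF xy(1,2,4)] by simp
  qed
  have finC: "finite C" unfolding C_def using J by (intro finite_PiE) auto
  have "card P \<le> card C" using card_inj_on_le[OF inj GC finC] .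
  also have "card C = (nat (2 * \<lceil>R / s\<rceil> + 1)) ^ m"
    unfolding C_def using J by (simp add: card_PiE)
  finally have "real (card P) \<le> real (nat (2 * \<lceil>R / s\<rceil> + 1)) ^ m" by (metis of_nat_le_iff of_nat_power)
  also have "\<dots> \<le> (2 * R * sqrt m / r + 3) ^ m"
  proof (rule power_mono)
    have "0 \<le> R / s" using R0 s by simp
    then have "real (nat (2 * \<lceil>R / s\<rceil> + 1)) = 2 * real_of_int \<lceil>R / s\<rceil> + 1" by simp
    also have "\<dots> \<le> 2 * (R / s) + 3" by linarith
    finally show "real (nat (2 * \<lceil>R / s\<rceil> + 1)) \<le> 2 * R * sqrt m / r + 3" by (simp add: s_def)
  qed simp
  finally show ?thesis using inj_on_finite[OF inj GC finC] by blast
qed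

lemma log2_nat_le: "log 2 (real k) \<le> real k - 1" if "k \<ge> 1" for k :: nat
proof -
  have "k \<le> 2 ^ (k - 1)"
    using that less_exp[of "k - 1"] by linarith
  then have "real k \<le> 2 powr real (k - 1)"
    by (metis (mono_tags) of_nat_le_iff of_nat_numeral of_nat_power powr_realpow zero_less_numeral)
  then have "log 2 (real k) \<le> log 2 (2 powr real (k - 1))" using that by (subst log_le_cancel_iff) auto
  then show ?thesis using that by (simp add: of_nat_diff)
qed

text \<open>Here \<open>q\<close> is the rounded binary logarithm of the packing bound
  \<open>M\<close>. Logarithms are replaced by linear bounds in \<open>D\<close> and
  \<open>N\<close>, and the dimension is eliminated by \<open>n + 2 \<le> N\<close>. The slack
  between 10 and what is needed at \<open>n = 2\<close> pays for all constants.\<close>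

lemma extension_constant_le:
  fixes D :: real and N n :: nat
  assumes D: "D \<ge> 1" and n: "n \<ge> 2" and N: "N \<ge> n + 2"
  obtains q :: nat where "q \<ge> 1"
    "real N * (16 * D\<^sup>2 * sqrt (real n + 1)) ^ (n + 1) \<le> 2 ^ q"
    "280 * real (Suc q) \<le> D * real N powr (10 * ln (real n))"
proof -
  define M where "M = real N * (16 * D\<^sup>2 * sqrt (real n + 1)) ^ (n + 1)"
  have D2: "1 \<le> D\<^sup>2" using D by simp
  have B: "1 \<le> 16 * D\<^sup>2 * sqrt (real n + 1)"
  proof -
    have "1 * 1 * 1 \<le> 16 * D\<^sup>2 * sqrt (real n + 1)" using D2 by (intro mult_mono) auto
    then show ?thesis by simp
  qed
  have M4: "4 \<le> M"
  proof -
    have "4 * 1 \<le> M" unfolding M_def using N n B by (intro mult_mono one_le_power) auto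
    then show ?thesis by simp
  qed
  define q where "q = nat \<lceil>log 2 M\<rceil>"
  have logM: "log 2 M \<ge> 2"
    using M4 by (simp add: le_log_iff)
  have q1: "q \<ge> 1" unfolding q_def using logM by linarith
  have qle: "log 2 M \<le> real q" unfolding q_def by linarith
  have Mq: "M \<le> 2 ^ q"
  proof -
    have "M = 2 powr log 2 M" using M4 by simp
    also have "\<dots> \<le> 2 powr real q" using qle by (intro powr_mono) auto
    finally show ?thesis by (simp add: powr_realpow)
  qed
  have qM: "real (Suc q) \<le> log 2 M + 2" unfolding q_def using logM by linarith
  have ln2: "2/3 \<le> ln (2::real)" by (rule ln2_ge_two_thirds)
  have lnD: "ln D \<le> D - 1" using D ln_le_minus_one by simp
  \<comment> \<open>The bound \<open>3 * (D - 1)\<close> is weakened so that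
    \<open>4 + 4 * (D - 1) = 4 * D\<close>, where 4 is the binary logarithm of 16; then
    \<open>D\<close> can be factored out.\<close>
  have logD: "2 * log 2 D \<le> 4 * (D - 1)"
  proof -
    have "log 2 D = ln D / ln 2" by (simp add: log_def)
    also have "\<dots> \<le> (D - 1) / (2/3)" using lnD ln2 D by (intro frac_le) auto
    finally show ?thesis using D by simp
  qed
  let ?B = "16 * D\<^sup>2 * sqrt (real n + 1)"
  have logB: "log 2 ?B \<le> D * (4 + (real N - 2) / 2)"
  proof -
    have "log 2 (16::real) = log 2 (2 ^ 4)" by simp
    then have 16: "log 2 (16::real) = 4" by (simp only: log_nat_power) simp
    have "log 2 (sqrt (real n + 1)) = log 2 (real (n + 1)) / 2"
      by (simp add: log_def ln_sqrt add.commute mult.commute)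
    then have "log 2 ?B = 4 + 2 * log 2 D + log 2 (real (n + 1)) / 2"
      using D by (simp add: log_mult log_nat_power 16)
    also have "\<dots> \<le> 4 + 4 * (D - 1) + 1 * ((real N - 2) / 2)"
    proof -
      have "log 2 (real (n + 1)) \<le> real (n + 1) - 1" by (rule log2_nat_le) simp
      also have "\<dots> \<le> real N - 2" using N by simp
      finally have "log 2 (real (n + 1)) / 2 \<le> (real N - 2) / 2" by (rule divide_right_mono) simp
      then show ?thesis unfolding mult_1 by (intro add_mono order_refl logD)
    qed
    also have "\<dots> \<le> 4 + 4 * (D - 1) + D * ((real N - 2) / 2)"
      using D N by (intro add_left_mono mult_right_mono) auto
    also have "\<dots> = D * (4 + (real N - 2) / 2)" by (simp add: distrib_left right_diff_distrib)
    finally show ?thesis .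
  qed
  have logB0: "0 \<le> log 2 ?B" using zero_le_log_cancel_iff[of 2 ?B] B by linarith
  have logN: "log 2 (real N) \<le> D * (real N - 1)"
  proof -
    have "log 2 (real N) \<le> 1 * (real N - 1)" using log2_nat_le[of N] N by simp
    also have "\<dots> \<le> D * (real N - 1)" using D N by (intro mult_right_mono) auto
    finally show ?thesis .
  qed
  have "log 2 M = log 2 (real N) + log 2 (?B ^ (n + 1))"
    unfolding M_def using N B D by (intro log_mult_pos zero_less_power) auto
  also have "log 2 (?B ^ (n + 1)) = real (n + 1) * log 2 ?B"
    using B by (intro log_nat_power) simp
  also have "log 2 (real N) + real (n + 1) * log 2 ?B \<le>
      D * (real N - 1) + (real N - 1) * (D * (4 + (real N - 2) / 2))"
    using logB0 N by (intro add_mono[OF logN] mult_mono logB) auto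
  also have "\<dots> = D * ((real N)\<^sup>2 / 2 + 7/2 * real N - 4)"
    by (simp add: field_simps power2_eq_square)
  finally have "log 2 M \<le> D * ((real N)\<^sup>2 / 2 + 7/2 * real N - 4)" .
  moreover have "2 \<le> D * 2" using D by simp
  ultimately have "real (Suc q) \<le> D * ((real N)\<^sup>2 / 2 + 7/2 * real N)" using qM by (simp add: algebra_simps)
  also have "\<dots> \<le> D * (7/5 * (real N)\<^sup>2)"
  proof (rule mult_left_mono)
    have "4 * real N \<le> real N * real N" using N n by (intro mult_right_mono) auto
    then show "(real N)\<^sup>2 / 2 + 7/2 * real N \<le> 7/5 * (real N)\<^sup>2" by (simp add: power2_eq_square)
  qed (use D in simp)
  finally have 1: "280 * real (Suc q) \<le> D * (392 * (real N)\<^sup>2)" by simp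
  have N4: "4 \<le> real N" using N n by simp
  \<comment> \<open>\<open>392 \<le> 4 ^ 4 * 2\<close>, and \<open>4 \<le> N\<close>,
    \<open>2 \<le> sqrt N\<close> turn this into the power 9/2 of \<open>N\<close>. The resulting
    exponent 13/2 is below \<open>10 * 2/3\<close>, a lower bound of
    \<open>10 * ln 2\<close>.\<close>
  have "392 * (real N)\<^sup>2 \<le> (real N)\<^sup>2 * 4 ^ 4 * 2" by simp
  also have "\<dots> \<le> (real N)\<^sup>2 * real N ^ 4 * sqrt (real N)"
    using N4 by (intro mult_mono power_mono real_le_rsqrt) auto
  also have "\<dots> = real N powr 6 * real N powr (1/2)"
    using N4 by (simp add: powr_half_sqrt powr_numeral flip: power_add)
  also have "\<dots> = real N powr (13/2)" using powr_add[of "real N" 6 "1/2"] by simp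
  also have "\<dots> \<le> real N powr (10 * ln (real n))"
  proof (rule powr_mono)
    have "ln 2 \<le> ln (real n)" using n by simp
    then show "13/2 \<le> 10 * ln (real n)" using ln2 by simp
  qed (use N4 in simp)
  finally have "D * (392 * (real N)\<^sup>2) \<le> D * real N powr (10 * ln (real n))"
    using D by (intro mult_left_mono) auto
  then show ?thesis using that[of q] q1 Mq 1 unfolding M_def by linarith
qed

section \<open>Packing bounds from the triangulation, and the degenerate case\<close>

context triangulated_manifold begin

text \<open>Pulled back to a single simplex, the points are separated by \<open>r / D\<close> and
  have diameter at most \<open>D * (20/3 * r)\<close>; the quotient of these is the source of
  \<open>D\<^sup>2\<close>. The top-dimensional simplices cover, so the counts add up.\<close>

lemma packing_bound:
  fixes d :: "'x \<Rightarrow> 'x \<Rightarrow> real"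
  assumes D: "D \<ge> 1" and fin: "finite (simplices_of I (DIM('e)) S)"
    and bilip: "\<forall>\<Delta>\<in>simplices_of I (DIM('e)) S. bi_lipschitz_on D \<Delta> (ell2_dist I) d \<phi>"
    and Z: "Z \<subseteq> topspace X" and r: "r > 0"
    and ZZ: "\<forall>z\<in>Z. \<forall>z'\<in>Z. d z z' \<le> 20/3 * r \<and> (z \<noteq> z' \<longrightarrow> r \<le> d z z')"
  shows "finite Z \<and> real (card Z) \<le> real (card (simplices_of I (DIM('e)) S)) *
    (16 * D\<^sup>2 * sqrt (real (DIM('e)) + 1)) ^ (DIM('e) + 1)"
proof -
  let ?\<S> = "simplices_of I (DIM('e)) S"
  let ?m = "DIM('e) + 1"
  let ?B = "(16 * D\<^sup>2 * sqrt (real (DIM('e)) + 1)) ^ ?m"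
  define P where "P \<Delta> = {x\<in>\<Delta>. \<phi> x \<in> Z}" for \<Delta>
  have P: "finite (P \<Delta>) \<and> real (card (P \<Delta>)) \<le> ?B" if \<Delta>: "\<Delta> \<in> ?\<S>" for \<Delta>
  proof -
    obtain J where J: "J \<subseteq> I" "finite J" "card J = ?m" "\<Delta> = std_simplex J" "\<Delta> \<subseteq> S"
      using \<Delta> unfolding top_simplices_eq by blast
    have bl: "ell2_dist I x y \<le> D * d (\<phi> x) (\<phi> y)" "d (\<phi> x) (\<phi> y) \<le> D * ell2_dist I x y"
      if "x \<in> \<Delta>" "y \<in> \<Delta>" for x y
    proof -
      have "inverse D * ell2_dist I x y \<le> d (\<phi> x) (\<phi> y)" "d (\<phi> x) (\<phi> y) \<le> D * ell2_dist I x y"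
        using bilip \<Delta> that by (auto simp: bi_lipschitz_on_def)
      then show "ell2_dist I x y \<le> D * d (\<phi> x) (\<phi> y)" "d (\<phi> x) (\<phi> y) \<le> D * ell2_dist I x y"
        using D by (auto simp: field_simps)
    qed
    have "finite (P \<Delta>) \<and> real (card (P \<Delta>)) \<le> (2 * (D * (20/3 * r)) * sqrt ?m / (r / D) + 3) ^ ?m"
    proof (rule separated_set_card_le[OF J(2,1,3)])
      show "x i = 0" if "x \<in> P \<Delta>" "i \<notin> J" for x i using that J(4) by (auto simp: P_def std_simplex_def)
      show "ell2_dist I x y \<le> D * (20/3 * r)" if "x \<in> P \<Delta>" "y \<in> P \<Delta>" for x y
      proof -
        have "ell2_dist I x y \<le> D * d (\<phi> x) (\<phi> y)" using bl that by (auto simp: P_def)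
        also have "\<dots> \<le> D * (20/3 * r)" using ZZ that D by (intro mult_left_mono) (auto simp: P_def)
        finally show ?thesis .
      qed
      show "r / D \<le> ell2_dist I x y" if xy: "x \<in> P \<Delta>" "y \<in> P \<Delta>" "x \<noteq> y" for x y
      proof -
        have "\<phi> x \<noteq> \<phi> y" using xy \<phi>_inj J(5) by (auto simp: P_def dest: inj_onD)
        then have "r \<le> d (\<phi> x) (\<phi> y)" using ZZ xy by (auto simp: P_def)
        also have "\<dots> \<le> D * ell2_dist I x y" using bl xy by (auto simp: P_def)
        finally show ?thesis using D by (simp add: field_simps)
      qed
    qed (use r D in auto)
    moreover have "(2 * (D * (20/3 * r)) * sqrt ?m / (r / D) + 3) ^ ?m \<le> ?B"
    proof (rule power_mono)
      \<comment> \<open>The gap \<open>16 - 40/3 = 8/3\<close>, times a quantity of at least 3/2,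
        absorbs the additive 3 of the grid count.\<close>
      have "3/2 \<le> sqrt (real (DIM('e)) + 1)" using dim2 by (intro real_le_rsqrt) (simp add: power2_eq_square)
      then have "1 * (3/2) \<le> D\<^sup>2 * sqrt (real (DIM('e)) + 1)" using D by (intro mult_mono) auto
      moreover have "2 * (D * (20/3 * r)) * sqrt ?m / (r / D) = 40/3 * (D\<^sup>2 * sqrt (real (DIM('e)) + 1))"
        using r D by (simp add: field_simps power2_eq_square)
      ultimately show "2 * (D * (20/3 * r)) * sqrt ?m / (r / D) + 3 \<le> 16 * D\<^sup>2 * sqrt (real (DIM('e)) + 1)"
        by simp
      show "0 \<le> 2 * (D * (20/3 * r)) * sqrt ?m / (r / D) + 3" using r D by simp
    qed
    ultimately show ?thesis by linarith
  qed
  have cover: "Z \<subseteq> (\<Union>\<Delta>\<in>?\<S>. \<phi> ` P \<Delta>)"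
  proof
    fix z assume z: "z \<in> Z"
    then obtain x where x: "x \<in> S" "z = \<phi> x" using Z \<phi>_image by blast
    obtain J where J: "J \<subseteq> I" "finite J" "card J = ?m" "x \<in> std_simplex J" "std_simplex J \<subseteq> S"
      by (rule in_top_simplex[OF x(1)])
    then have "std_simplex J \<in> ?\<S>" unfolding top_simplices_eq by blast
    moreover have "z \<in> \<phi> ` P (std_simplex J)" using J(4) x z by (auto simp: P_def)
    ultimately show "z \<in> (\<Union>\<Delta>\<in>?\<S>. \<phi> ` P \<Delta>)" by blast
  qed
  have finU: "finite (\<Union>\<Delta>\<in>?\<S>. \<phi> ` P \<Delta>)" using fin P by blast
  have "card Z \<le> card (\<Union>\<Delta>\<in>?\<S>. \<phi> ` P \<Delta>)" by (rule card_mono[OF finU cover])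
  also have "\<dots> \<le> (\<Sum>\<Delta>\<in>?\<S>. card (\<phi> ` P \<Delta>))" by (rule card_UN_le[OF fin])
  also have "\<dots> \<le> (\<Sum>\<Delta>\<in>?\<S>. card (P \<Delta>))" using P by (intro sum_mono card_image_le) auto
  finally have "real (card Z) \<le> (\<Sum>\<Delta>\<in>?\<S>. real (card (P \<Delta>)))" by (metis of_nat_le_iff of_nat_sum)
  also have "\<dots> \<le> real (card ?\<S>) * ?B" using P by (intro sum_bounded_above) auto
  finally show ?thesis using finite_subset[OF cover finU] by blast
qed

text \<open>Within the complex the simplex on \<open>J\<close> is the level set of the continuous
  function \<open>sum x J\<close> at 1.\<close>

lemma closedin_simplex_image:
  assumes "\<Delta> \<in> simplices_of I (DIM('e)) S"
  shows "closedin X (\<phi> ` \<Delta>)"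
proof -
  obtain J where J: "J \<subseteq> I" "finite J" "\<Delta> = std_simplex J" "\<Delta> \<subseteq> S"
    using assms unfolding top_simplices_eq by blast
  have "continuous_map TS euclidean (\<lambda>x. sum x J)"
    using J by (intro continuous_map_sum continuous_map_from_subtopology continuous_map_ell2_coordinate) auto
  from closedin_continuous_map_preimage[OF this, of "{1}"]
  have "closedin TS {x \<in> S. sum x J = 1}" unfolding topspace_TS by simp
  moreover have "{x \<in> S. sum x J = 1} = \<Delta>"
    using J S_subset(1) full_simplex_face_eq_std_simplex[OF J(2,1)] by blast
  ultimately have "closedin TS \<Delta>" by simp
  then show ?thesis using homeomorphic_map_closedness[OF \<phi>_homeo, unfolded topspace_TS, OF J(4)] by simp
qed

text \<open>Since \<open>inverse 0 = 0\<close>, \<open>bi_lipschitz_on 0\<close> holds on sets of diameter \<open>0\<close>, so \<open>D = 0\<close> has to be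
  treated separately.\<close>

lemma dist_zero_if_simplices_degenerate:
  assumes conn: "connected_space X" and fin: "finite (simplices_of I (DIM('e)) S)"
    and d: "pseudometric (topspace X) d"
    and zero: "\<And>\<Delta> x y. \<Delta> \<in> simplices_of I (DIM('e)) S \<Longrightarrow> x \<in> \<Delta> \<Longrightarrow> y \<in> \<Delta> \<Longrightarrow> d (\<phi> x) (\<phi> y) = 0"
    and p: "p \<in> topspace X" and q: "q \<in> topspace X"
  shows "d p q = 0"
proof (rule ccontr)
  assume pq: "d p q \<noteq> 0"
  interpret pseudometric "topspace X" d by (rule d)
  let ?\<S> = "simplices_of I (DIM('e)) S"
  define E where "E = {x\<in>topspace X. d p x = 0}"
  \<comment> \<open>The union of the images of all simplices that meet \<open>B\<close>; it is
    closed because there are finitely many. Both \<open>E\<close> and its complement are unions of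
    this kind, so connectedness rules out that both are nonempty.\<close>
  define G where "G B = (\<Union>\<Delta>\<in>{\<Delta>\<in>?\<S>. \<phi> ` \<Delta> \<inter> B \<noteq> {}}. \<phi> ` \<Delta>)" for B
  have clG: "closedin X (G B)" for B
    unfolding G_def using fin closedin_simplex_image by (intro closedin_Union) auto
  have GX: "G B \<subseteq> topspace X" for B using closedin_subset[OF clG] .
  have cover: "B \<subseteq> G B" if "B \<subseteq> topspace X" for B
  proof
    fix z assume z: "z \<in> B"
    then have "z \<in> \<phi> ` S" unfolding \<phi>_image using that by (rule subsetD[rotated])
    then obtain x where x: "x \<in> S" "z = \<phi> x" by (rule imageE) simp
    obtain J where J: "J \<subseteq> I" "finite J" "card J = DIM('e) + 1" "x \<in> std_simplex J" "std_simplex J \<subseteq> S"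
      by (rule in_top_simplex[OF x(1)])
    then have "std_simplex J \<in> ?\<S>" unfolding top_simplices_eq by blast
    moreover have z\<Delta>: "z \<in> \<phi> ` std_simplex J" unfolding x(2) using J(4) by (rule imageI)
    moreover have "\<phi> ` std_simplex J \<inter> B \<noteq> {}" using z\<Delta> z by (simp only: disjoint_iff) fast
    ultimately show "z \<in> G B" unfolding G_def by (intro UN_I[of "std_simplex J"]) auto
  qed
  have same: "d p x = d p y" if "x \<in> \<phi> ` \<Delta>" "y \<in> \<phi> ` \<Delta>" "\<Delta> \<in> ?\<S>" for x y \<Delta>
  proof -
    have X: "x \<in> topspace X" "y \<in> topspace X"
      using that(1,2) closedin_subset[OF closedin_simplex_image[OF that(3)]] by blast+
    have "d x y = 0" using that(1,2) zero[OF that(3)] by auto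
    then show ?thesis using triangle[OF p X] triangle[OF p X(2,1)] sym[OF X] by simp
  qed
  have "G E \<subseteq> E"
  proof
    fix z assume "z \<in> G E"
    then obtain \<Delta> y where "\<Delta> \<in> ?\<S>" "z \<in> \<phi> ` \<Delta>" "y \<in> \<phi> ` \<Delta>" "y \<in> E" by (auto simp: G_def)
    then show "z \<in> E" using same[of z \<Delta> y] GX[of E] \<open>z \<in> G E\<close> by (auto simp: E_def)
  qed
  moreover have "G (topspace X - E) \<subseteq> topspace X - E"
  proof
    fix z assume z: "z \<in> G (topspace X - E)"
    then obtain \<Delta> y where "\<Delta> \<in> ?\<S>" "z \<in> \<phi> ` \<Delta>" "y \<in> \<phi> ` \<Delta>" "y \<in> topspace X - E" by (auto simp: G_def)
    then show "z \<in> topspace X - E" using same[of z \<Delta> y] GX z by (auto simp: E_def)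
  qed
  ultimately have "G E = E" "G (topspace X - E) = topspace X - E"
    using cover[of E] cover[of "topspace X - E"] by (auto simp: E_def)
  then have "closedin X E" "closedin X (topspace X - E)" using clG by metis+
  moreover have "p \<in> E" "q \<in> topspace X - E" using p q pq refl by (auto simp: E_def)
  moreover have "topspace X \<subseteq> E \<union> (topspace X - E)" "E \<inter> (topspace X - E) = {}" by auto
  ultimately show False using conn unfolding connected_space_closedin by blast
qed

end

theorem theorem1p3:
  fixes X :: "'x topology"
    and atlas :: "('x, 'e::euclidean_space) chart set"
    and g :: "('x, 'e) chart \<Rightarrow> 'x \<Rightarrow> 'e \<Rightarrow> 'e \<Rightarrow> real"
    and I :: "'i set" and S :: "('i \<Rightarrow> real) set" and \<phi> :: "('i \<Rightarrow> real) \<Rightarrow> 'x"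
    and D :: real and N n :: nat
    and Y :: "'y metric" and A :: "'x set" and f :: "'x \<Rightarrow> 'y"
  assumes "riemannian_manifold X atlas g" and "n = DIM('e)" and "n \<ge> 2"
    and "compact_space X" and "connected_space X"
    and "is_triangulation I S X \<phi>"
    and "\<forall>\<Delta>\<in>simplices_of I n S.
           bi_lipschitz_on D \<Delta> (ell2_dist I) (riemannian_dist X atlas g) \<phi>"
    and "finite (simplices_of I n S)" and "card (simplices_of I n S) \<le> N"
    and "mcomplete_of Y" and "CAT0_space Y"
    and "A \<subseteq> topspace X" and "f \<in> A \<rightarrow> mspace Y"
    and "\<forall>x\<in>A. \<forall>y\<in>A. mdist Y (f x) (f y) \<le> riemannian_dist X atlas g x y"
  shows "\<exists>F. F \<in> topspace X \<rightarrow> mspace Y \<and> (\<forall>x\<in>A. F x = f x) \<and>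
           (\<forall>x\<in>topspace X. \<forall>y\<in>topspace X.
              mdist Y (F x) (F y) \<le>
                D * real N powr (10 * ln (real n)) * riemannian_dist X atlas g x y)"
proof (cases "topspace X = {}")
  case True
  then show ?thesis using assms(12) by auto
next
  case False
  let ?d = "riemannian_dist X atlas g"
  interpret riemannian_manifold X atlas g by (rule assms(1))
  interpret triangulated_manifold X atlas g I S \<phi>
    using assms(2,3,6) by unfold_locales auto
  have pm: "pseudometric (topspace X) ?d" by (rule pseudometric_riemannian_dist[OF assms(5)])
  interpret d: pseudometric "topspace X" ?d by (rule pm)
  let ?\<S> = "simplices_of I (DIM('e)) S"
  have fin: "finite ?\<S>" using assms(2,8) by simp
  have bilip: "\<forall>\<Delta>\<in>?\<S>. bi_lipschitz_on D \<Delta> (ell2_dist I) ?d \<phi>" using assms(2,7) by simp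
  have Sne: "S \<noteq> {}" using False \<phi>_image by blast
  have N: "N \<ge> n + 2" using card_top_simplices_ge[OF Sne fin] assms(2,9) by simp
  \<comment> \<open>The centre and a vertex of a simplex are two points at positive distance. The
    two Lipschitz bounds for them give \<open>0 \<le> D\<close>, and
    \<open>inverse D \<le> D\<close> when \<open>D\<close> is positive.\<close>
  have D: "D = 0 \<or> D \<ge> 1"
  proof -
    obtain J where J: "J \<subseteq> I" "finite J" "card J = DIM('e) + 1" "std_simplex J \<subseteq> S"
      using in_top_simplex Sne by (metis ex_in_conv)
    then have \<Delta>: "std_simplex J \<in> ?\<S>" unfolding top_simplices_eq by blast
    obtain j where j: "j \<in> J" using J(3) by fastforce
    define x y where "x = simplex_center J" and "y = simplex_center {j}"
    have xy: "x \<in> std_simplex J" "y \<in> std_simplex J"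
      using simplex_center_in[of J] simplex_center_in[of "{j}"] std_simplex_mono[OF J(2), of "{j}"] J j
      by (auto simp: x_def y_def)
    have "x j \<noteq> y j" using J j assms(2,3) by (simp add: x_def y_def simplex_center_def)
    then have "x \<noteq> y" by auto
    moreover have "x \<in> ell2 I" "y \<in> ell2 I" using xy J(4) S_subset(2) by blast+
    ultimately have pos: "ell2_dist I x y > 0" using Metric_space.mdist_pos_less[OF Metric_space_ell2] by blast
    have X: "\<phi> x \<in> topspace X" "\<phi> y \<in> topspace X" using xy J(4) \<phi>_image by blast+
    have b: "inverse D * ell2_dist I x y \<le> ?d (\<phi> x) (\<phi> y)" "?d (\<phi> x) (\<phi> y) \<le> D * ell2_dist I x y"
      using bilip \<Delta> xy by (auto simp: bi_lipschitz_on_def)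
    have "0 \<le> D * ell2_dist I x y" using b(2) d.nonneg[OF X] by linarith
    then have "D \<ge> 0" using pos by (simp add: zero_le_mult_iff)
    moreover have "D \<ge> 1" if "D > 0"
    proof -
      have "inverse D * ell2_dist I x y \<le> D * ell2_dist I x y" using b by linarith
      then have "inverse D \<le> D" using pos by simp
      then have "1 \<le> D * D" using that by (simp add: field_simps)
      then show ?thesis using that by (smt (verit) mult_left_le)
    qed
    ultimately show ?thesis by linarith
  qed
  consider "A = {}" | "A \<noteq> {}" "D = 0" | "A \<noteq> {}" "D \<ge> 1" using D by blast
  then show ?thesis
  proof cases
    case 1
    obtain y where y: "y \<in> mspace Y" using assms(11) by (auto simp: CAT0_space_def)
    have yy: "mdist Y y y = 0" using y by simp
    have "mdist Y y y \<le> D * real N powr (10 * ln (real n)) * ?d x z"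
      if "x \<in> topspace X" "z \<in> topspace X" for x z
      unfolding yy using D d.nonneg[OF that] by (intro mult_nonneg_nonneg) auto
    then show ?thesis using 1 y by (intro exI[of _ "\<lambda>_. y"]) auto
  next
    case 2
    obtain a where a: "a \<in> A" using 2 by blast
    have ya: "f a \<in> mspace Y" using assms(13) a by blast
    \<comment> \<open>For \<open>D = 0\<close> the claimed Lipschitz constant is 0. All distances in
      \<open>X\<close> vanish, so \<open>f\<close> is constant and extends by its value at
      \<open>a\<close>.\<close>
    have zero: "?d x y = 0" if "x \<in> topspace X" "y \<in> topspace X" for x y
    proof (rule dist_zero_if_simplices_degenerate[OF assms(5) fin pm _ that])
      fix \<Delta> x y assume \<Delta>: "\<Delta> \<in> ?\<S>" "x \<in> \<Delta>" "y \<in> \<Delta>"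
      then have "?d (\<phi> x) (\<phi> y) \<le> 0" using bilip 2 by (auto simp: bi_lipschitz_on_def)
      moreover have "\<phi> x \<in> topspace X" "\<phi> y \<in> topspace X"
        using closedin_subset[OF closedin_simplex_image[OF \<Delta>(1)]] \<Delta> by blast+
      ultimately show "?d (\<phi> x) (\<phi> y) = 0" using d.nonneg by (meson order_antisym)
    qed
    have const: "f a = f x" if x: "x \<in> A" for x
    proof -
      have "a \<in> topspace X" "x \<in> topspace X" using assms(12) a x by blast+
      then have "mdist Y (f a) (f x) \<le> 0" using assms(14) zero[of a x] a x by metis
      then have "mdist Y (f a) (f x) = 0" using mdist_nonneg by (metis order_antisym)
      moreover have "f x \<in> mspace Y" using assms(13) x by blast
      ultimately show ?thesis using ya by simp
    qed
    have "mdist Y (f a) (f a) = 0" using ya by simp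
    then show ?thesis using const ya 2(2) by (intro exI[of _ "\<lambda>_. f a"] conjI ballI) (simp_all only: mult_zero_left order_refl Pi_I)
  next
    case 3
    obtain q :: nat where q: "q \<ge> 1"
      "real N * (16 * D\<^sup>2 * sqrt (real n + 1)) ^ (n + 1) \<le> 2 ^ q"
      "280 * real (Suc q) \<le> D * real N powr (10 * ln (real n))"
      by (rule extension_constant_le[OF 3(2) assms(3) N])
    have packing: "\<forall>Z\<subseteq>topspace X. \<forall>r>0.
        (\<forall>z\<in>Z. \<forall>z'\<in>Z. ?d z z' \<le> 20/3 * r \<and> (z \<noteq> z' \<longrightarrow> r \<le> ?d z z')) \<longrightarrow> finite Z \<and> card Z \<le> 2 ^ q"
    proof (intro allI impI)
      fix Z and r :: real
      assume Z: "Z \<subseteq> topspace X" "r > 0" "\<forall>z\<in>Z. \<forall>z'\<in>Z. ?d z z' \<le> 20/3 * r \<and> (z \<noteq> z' \<longrightarrow> r \<le> ?d z z')"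
      let ?B = "(16 * D\<^sup>2 * sqrt (real n + 1)) ^ (n + 1)"
      have fZ: "finite Z" "real (card Z) \<le> real (card ?\<S>) * ?B"
        using packing_bound[OF 3(2) fin bilip Z] assms(2) by auto
      note fZ(2)
      also have "real (card ?\<S>) * ?B \<le> real N * ?B"
        using assms(2,9) 3 by (intro mult_right_mono) auto
      also have "\<dots> \<le> 2 ^ q" by (rule q(2))
      finally have "real (card Z) \<le> real (2 ^ q)" by simp
      then show "finite Z \<and> card Z \<le> 2 ^ q" using fZ(1) by (simp only: of_nat_le_iff)
    qed
    have lip: "mdist Y (f x) (f y) \<le> ?d x y" if "x \<in> A" "y \<in> A" for x y using assms(14) that by blast
    obtain F where F: "F \<in> topspace X \<rightarrow> mspace Y" "\<And>x. x \<in> A \<Longrightarrow> F x = f x"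
      "\<And>x y. x \<in> topspace X \<Longrightarrow> y \<in> topspace X \<Longrightarrow> mdist Y (F x) (F y) \<le> 280 * real (Suc q) * ?d x y"
      using d.lipschitz_extension_CAT0[OF assms(11,10,12) 3(1) assms(13) lip q(1) packing] by metis
    have "mdist Y (F x) (F y) \<le> D * real N powr (10 * ln (real n)) * ?d x y"
      if "x \<in> topspace X" "y \<in> topspace X" for x y
      using F(3)[OF that] mult_right_mono[OF q(3) d.nonneg[OF that]] by linarith
    then show ?thesis using F by blast
  qed
qed

end
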